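(* Consider a left-invariant Lorentzian problem on $G=\mathrm{Aff}_+(\mathbb R)$ given by a matrix $A$, $|A|>0$, $a\ge0$, with sectional curvature $K$. Let $\mathrm{Exp}:N\to M$ be the Lorentzian exponential mapping. Its inverse $\mathrm{Exp}^{-1}:M\to N$, $(x_1,y_1)\mapsto(\psi_0,t_1)$, is given as follows. (1) If $K<0$, then $t_1=\frac{\tau-\rho}{\Delta}$, $\psi_0=\operatorname{arsinh}\tan\rho-\theta$, where $$\tau=\arcsin\left(\frac{y_1^2+w^2-1}{2y_1w}\right),\qquad \rho=\arcsin\left(\frac{y_1^2-w^2-1}{2w}\right),\qquad w=\frac{x_1-\nu(y_1-1)}{\lambda}.$$ (2) Let $K>0$, and let $w=\frac{x_1+\nu(y_1-1)}{\lambda}$, $s_1=\operatorname{sgn}\gamma$. (2.1) If $w=0$, then $t_1=s_1\frac{\ln y_1}{\Delta}$, $\psi_0=-\theta$. (2.2) If $w\ne0$, then $t_1=s_1\frac{\rho-\tau}{\Delta}$, $\psi_0=\operatorname{arcosh}\coth\rho-\theta$, where $$\tau=\operatorname{arcosh}\left(s_2\frac{1-y_1^2-w^2}{2y_1w}\right),\qquad \rho=\operatorname{arcosh}\left(s_2\frac{1-y_1^2+w^2}{2w}\right),\qquad s_2=\operatorname{sgn}(\lambda w).$$ (3) If $K=0$, then $t_1=\frac{\rho-\tau}{\gamma}$, $\psi_0=-s_1\ln\rho$, where $$\tau=\sqrt{\frac{w}{y_1-y_1^2}},\qquad \rho=\sqrt{\frac{wy_1}{1-y_1}},\qquad w=\frac{x_1-\mathsf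 g(1-y_1)}{f},\qquad f=-\frac{\alpha-s_1\beta}{2\gamma},\quad \mathsf g=-\frac{\alpha+s_1\beta}{2\gamma},\quad s_1=\operatorname{sgn}\gamma.$$ For any $(x_1,y_1)\in M$ there is a unique arclength-parametrized optimal trajectory (Lorentzian length maximizer) connecting $\mathrm{Id}$ to $(x_1,y_1)$, and it is $q(t)=\mathrm{Exp}(\psi_0,t)$, $t\in[0,t_1]$.
   Context: $G=\mathrm{Aff}_+(\mathbb R)=\{(x,y)\in\mathbb R^2: y>0\}$ with product $(x_2,y_2)\cdot(x_1,y_1)=(x_2+y_2x_1,\,y_2y_1)$ and identity $\mathrm{Id}=(0,1)$; left-invariant frame $X_1=y\,\partial_x$, $X_2=y\,\partial_y$. A real matrix $A=\begin{pmatrix}a&b\\c&d\end{pmatrix}$ with $|A|=ad-bc>0$ determines the left-invariant Lorentzian form $g(u_1X_1+u_2X_2)=-v_1^2+v_2^2$, $v_1=au_1+bu_2$, $v_2=cu_1+du_2$, with time orientation in which future directed nonspacelike vectors are those with $v_1\ge|v_2|$. Standing assumption of the paper: $a\ge0$. Write $A^{-1}=\begin{pmatrix}\alpha&\beta\\ \gamma&\delta\end{pmatrix}$, so $\delta\ge0$; $Y_1=\alpha X_1+\gamma X_2$, $Y_2=\beta X_1+\delta X_2$. The sectional curvature is $K=(c^2-a^2)/|A|^2=\gamma^2-\delta^2$. A future directed nonspacelike curve is a Lipschitz curve whose velocity is a.e. future directed nonspacelike; its length is $l=\int\sqrt{v_1^2-v_2^2}\,dt$; it is arclength-parametrized if $v_1^2-v_2^2\equiv1$.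 $J^+$ is the set of endpoints of such curves starting at $\mathrm{Id}$. A Lorentzian length maximizer is such a curve having the largest length among all such curves with the same endpoints. Constants. If $K<0$: $\Delta=\sqrt{\delta^2-\gamma^2}$ and $\theta$ is defined by $\delta=\Delta\cosh\theta$, $\gamma=\Delta\sinh\theta$. If $K>0$: $\Delta=\sqrt{\gamma^2-\delta^2}$, $s_1=\operatorname{sgn}\gamma$, and $\theta$ is defined by $\gamma=s_1\Delta\cosh\theta$, $\delta=s_1\Delta\sinh\theta$. In both cases $\lambda=\frac{\alpha\delta-\beta\gamma}{\Delta^2}$, $\nu=\frac{\beta\delta-\alpha\gamma}{\Delta^2}$. Lorentzian exponential mapping: for $\psi_0\in\mathbb R$ let $(\psi(t),q(t))$ be the solution of $\dot\psi=\delta\cosh\psi+\gamma\sinh\psi$, $\dot q=\cosh\psi\,Y_1(q)+\sinh\psi\,Y_2(q)$, $\psi(0)=\psi_0$, $q(0)=\mathrm{Id}$, on its maximal interval $(t_{\min}(\psi_0),t_{\max}(\psi_0))$; put $\mathrm{Exp}(\psi_0,t)=q(t)$ and $N=\{(\psi_0,t):\psi_0\in\mathbb R,\ 0<t<t_{\max}(\psi_0)\}$. Let $\lambda_1(x,y)=(c-a)x+(d-b)(y-1)$, $\lambda_2(x,y)=(c+a)x+(d+b)(y-1)$. If $K\ge0$, $M=\operatorname{int}J^+$. If $K<0$, $M=\{q\in G:\lambda_1(q)<0<\lambda_2(q),\ \lambda_3(q)>0\}$ with $\lambda_3(q)=\lambda_1(q)-\lambda_1(B)$, $B=\left(\fr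ac{d+b}{c+a},0\right)$.
   Formalization: In case (2.2) the printed signs fail (e.g. a=d=0, b=1, c=-1 at (1,3) gives arcosh(-7/2)); corrected to s_2 = -s_1 sgn(λw) and ψ_0 = s_2 arcosh coth ρ - θ, which agrees with the printed formula for s_1 = -1, w > 0. *)

theory Defs
  imports "HOL-Analysis.Analysis"
begin

section \<open>The group of orientation preserving affine maps of the line\<close>

definition Aff :: "(real \<times> real) set" where
  "Aff = {q. snd q > 0}"

definition aff_mult :: "real \<times> real \<Rightarrow> real \<times> real \<Rightarrow> real \<times> real" where
  "aff_mult p q = (fst p + snd p * fst q, snd p * snd q)"

definition aff_id :: "real \<times> real" where
  "aff_id = (0, 1)"

definition X1 :: "real \<times> real \<Rightarrow> real \<times> real" where
  "X1 q = (snd q, 0)"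

definition X2 :: "real \<times> real \<Rightarrow> real \<times> real" where
  "X2 q = (0, snd q)"

lemma aff_mult_id: "aff_mult aff_id q = q" "aff_mult q aff_id = q"
  by (auto simp: aff_mult_def aff_id_def)

lemma left_invariant_frame:
  "(aff_mult p has_derivative (\<lambda>v. snd p *\<^sub>R v)) (at q)"
  "snd p *\<^sub>R X1 q = X1 (aff_mult p q)"
  "snd p *\<^sub>R X2 q = X2 (aff_mult p q)"
proof -
  have "aff_mult p = (\<lambda>q. (fst p, 0) + snd p *\<^sub>R q)"
    by (auto simp: aff_mult_def fun_eq_iff)
  then show "(aff_mult p has_derivative (\<lambda>v. snd p *\<^sub>R v)) (at q)"
    by (auto intro!: derivative_eq_intros)
qed (auto simp: X1_def X2_def aff_mult_def)

text \<open>Components \<open>(u\<^sub>1, u\<^sub>2)\<close> of a tangent vector \<open>\<xi>\<close> at \<open>q\<close> in the frame \<open>X1, X2\<close>.\<close>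

definition frame_coords :: "real \<times> real \<Rightarrow> real \<times> real \<Rightarrow> real^2" where
  "frame_coords q \<xi> = vector [fst \<xi> / snd q, snd \<xi> / snd q]"

lemma frame_coords:
  "q \<in> Aff \<Longrightarrow> \<xi> = (frame_coords q \<xi> $ 1) *\<^sub>R X1 q + (frame_coords q \<xi> $ 2) *\<^sub>R X2 q"
  by (auto simp: frame_coords_def X1_def X2_def Aff_def prod_eq_iff)


section \<open>Left-invariant Lorentzian structures\<close>

definition v1 :: "real^2^2 \<Rightarrow> real \<times> real \<Rightarrow> real \<times> real \<Rightarrow> real" where
  "v1 A q \<xi> = (A *v frame_coords q \<xi>) $ 1"

definition v2 :: "real^2^2 \<Rightarrow> real \<times> real \<Rightarrow> real \<times> real \<Rightarrow> real" where
  "v2 A q \<xi> = (A *v frame_coords q \<xi>) $ 2"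

definition lorentz_form :: "real^2^2 \<Rightarrow> real \<times> real \<Rightarrow> real \<times> real \<Rightarrow> real" where
  "lorentz_form A q \<xi> = - (v1 A q \<xi>)\<^sup>2 + (v2 A q \<xi>)\<^sup>2"

definition future_nonspacelike :: "real^2^2 \<Rightarrow> real \<times> real \<Rightarrow> real \<times> real \<Rightarrow> bool" where
  "future_nonspacelike A q \<xi> \<longleftrightarrow> v1 A q \<xi> \<ge> \<bar>v2 A q \<xi>\<bar>"

definition sec_curv :: "real^2^2 \<Rightarrow> real" where
  "sec_curv A = ((A$2$1)\<^sup>2 - (A$1$1)\<^sup>2) / (det A)\<^sup>2"

abbreviation al :: "real^2^2 \<Rightarrow> real" where "al A \<equiv> matrix_inv A $ 1 $ 1"
abbreviation be :: "real^2^2 \<Rightarrow> real" where "be A \<equiv> matrix_inv A $ 1 $ 2"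
abbreviation ga :: "real^2^2 \<Rightarrow> real" where "ga A \<equiv> matrix_inv A $ 2 $ 1"
abbreviation de :: "real^2^2 \<Rightarrow> real" where "de A \<equiv> matrix_inv A $ 2 $ 2"

definition Y1 :: "real^2^2 \<Rightarrow> real \<times> real \<Rightarrow> real \<times> real" where
  "Y1 A q = al A *\<^sub>R X1 q + ga A *\<^sub>R X2 q"

definition Y2 :: "real^2^2 \<Rightarrow> real \<times> real \<Rightarrow> real \<times> real" where
  "Y2 A q = be A *\<^sub>R X1 q + de A *\<^sub>R X2 q"


section \<open>Nonspacelike curves, length, maximizers\<close>

text \<open>A curve is a map on a compact interval \<open>{0..T}\<close>; values outside the interval are
  irrelevant. A Lipschitz curve has a velocity almost everywhere. On a compact interval,
  Lipschitz continuity with respect to the Euclidean metric and with respect to any Riemannian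
  metric on the group are the same, since the image is compact.\<close>

definition future_curve :: "real^2^2 \<Rightarrow> (real \<Rightarrow> real \<times> real) \<Rightarrow> real \<Rightarrow> bool" where
  "future_curve A q T \<longleftrightarrow> 0 \<le> T \<and> q ` {0..T} \<subseteq> Aff \<and> (\<exists>C. C-lipschitz_on {0..T} q) \<and>
     (AE t in lebesgue_on {0..T}.
        q differentiable (at t) \<and> future_nonspacelike A (q t) (vector_derivative q (at t)))"

definition lor_length :: "real^2^2 \<Rightarrow> (real \<Rightarrow> real \<times> real) \<Rightarrow> real \<Rightarrow> real" where
  "lor_length A q T =
     integral {0..T} (\<lambda>t. sqrt (- lorentz_form A (q t) (vector_derivative q (at t))))"

definition arclength_param :: "real^2^2 \<Rightarrow> (real \<Rightarrow> real \<times> real) \<Rightarrow> real \<Rightarrow> bool" where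
  "arclength_param A q T \<longleftrightarrow>
     (AE t in lebesgue_on {0..T}. - lorentz_form A (q t) (vector_derivative q (at t)) = 1)"

definition J_plus :: "real^2^2 \<Rightarrow> (real \<times> real) set" where
  "J_plus A = {p. \<exists>q T. future_curve A q T \<and> q 0 = aff_id \<and> q T = p}"

definition length_maximizer :: "real^2^2 \<Rightarrow> (real \<Rightarrow> real \<times> real) \<Rightarrow> real \<Rightarrow> bool" where
  "length_maximizer A q T \<longleftrightarrow> future_curve A q T \<and>
     (\<forall>p S. future_curve A p S \<and> p 0 = q 0 \<and> p S = q T \<longrightarrow> lor_length A p S \<le> lor_length A q T)"

definition optimal_arclength_from_id_to ::
    "real^2^2 \<Rightarrow> real \<times> real \<Rightarrow> (real \<Rightarrow> real \<times> real) \<Rightarrow> real \<Rightarrow> bool" where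
  "optimal_arclength_from_id_to A p q T \<longleftrightarrow>
     length_maximizer A q T \<and> arclength_param A q T \<and> q 0 = aff_id \<and> q T = p"


section \<open>The Lorentzian exponential mapping\<close>

definition extremal_on ::
    "real^2^2 \<Rightarrow> real \<Rightarrow> real set \<Rightarrow> (real \<Rightarrow> real) \<Rightarrow> (real \<Rightarrow> real \<times> real) \<Rightarrow> bool" where
  "extremal_on A \<psi>\<^sub>0 I \<psi> q \<longleftrightarrow> open I \<and> is_interval I \<and> 0 \<in> I \<and> \<psi> 0 = \<psi>\<^sub>0 \<and> q 0 = aff_id \<and>
     (\<forall>t\<in>I. q t \<in> Aff \<and>
        (\<psi> has_real_derivative de A * cosh (\<psi> t) + ga A * sinh (\<psi> t)) (at t) \<and>
        (q has_vector_derivative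
            cosh (\<psi> t) *\<^sub>R Y1 A (q t) + sinh (\<psi> t) *\<^sub>R Y2 A (q t)) (at t))"

text \<open>By uniqueness of solutions, the maximal interval is the union of all intervals on which a
  solution exists, and all solutions agree where they are defined.\<close>

definition max_interval :: "real^2^2 \<Rightarrow> real \<Rightarrow> real set" where
  "max_interval A \<psi>\<^sub>0 = \<Union>{I. \<exists>\<psi> q. extremal_on A \<psi>\<^sub>0 I \<psi> q}"

definition t_max :: "real^2^2 \<Rightarrow> real \<Rightarrow> ereal" where
  "t_max A \<psi>\<^sub>0 = (SUP t\<in>max_interval A \<psi>\<^sub>0. ereal t)"

definition Exp :: "real^2^2 \<Rightarrow> real \<times> real \<Rightarrow> real \<times> real" where
  "Exp A = (\<lambda>(\<psi>\<^sub>0, t). THE p. \<exists>I \<psi> q. extremal_on A \<psi>\<^sub>0 I \<psi> q \<and> t \<in> I \<and> q t = p)"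

definition N_dom :: "real^2^2 \<Rightarrow> (real \<times> real) set" where
  "N_dom A = {(\<psi>\<^sub>0, t). 0 < t \<and> ereal t < t_max A \<psi>\<^sub>0}"


section \<open>The image of the exponential mapping\<close>

definition lambda1 :: "real^2^2 \<Rightarrow> real \<times> real \<Rightarrow> real" where
  "lambda1 A q = (A$2$1 - A$1$1) * fst q + (A$2$2 - A$1$2) * (snd q - 1)"

definition lambda2 :: "real^2^2 \<Rightarrow> real \<times> real \<Rightarrow> real" where
  "lambda2 A q = (A$2$1 + A$1$1) * fst q + (A$2$2 + A$1$2) * (snd q - 1)"

definition lambda3 :: "real^2^2 \<Rightarrow> real \<times> real \<Rightarrow> real" where
  "lambda3 A q = lambda1 A q - lambda1 A ((A$2$2 + A$1$2) / (A$2$1 + A$1$1), 0)"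

definition M_im :: "real^2^2 \<Rightarrow> (real \<times> real) set" where
  "M_im A = (if sec_curv A \<ge> 0 then interior (J_plus A)
     else {q \<in> Aff. lambda1 A q < 0 \<and> 0 < lambda2 A q \<and> lambda3 A q > 0})"


section \<open>Constants\<close>

definition s1 :: "real^2^2 \<Rightarrow> real" where
  "s1 A = sgn (ga A)"

definition Delta :: "real^2^2 \<Rightarrow> real" where
  "Delta A = (if sec_curv A < 0 then sqrt ((de A)\<^sup>2 - (ga A)\<^sup>2) else sqrt ((ga A)\<^sup>2 - (de A)\<^sup>2))"

definition theta :: "real^2^2 \<Rightarrow> real" where
  "theta A = (THE \<theta>.
     if sec_curv A < 0 then de A = Delta A * cosh \<theta> \<and> ga A = Delta A * sinh \<theta>
     else ga A = s1 A * Delta A * cosh \<theta> \<and> de A = s1 A * Delta A * sinh \<theta>)"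

definition lam :: "real^2^2 \<Rightarrow> real" where
  "lam A = (al A * de A - be A * ga A) / (Delta A)\<^sup>2"

definition nu :: "real^2^2 \<Rightarrow> real" where
  "nu A = (be A * de A - al A * ga A) / (Delta A)\<^sup>2"

text \<open>Sign of \<open>\<psi>\<^sub>0 + \<theta>\<close> for \<open>K > 0\<close>. With \<open>\<phi> = \<psi> + \<theta>\<close> an extremal satisfies
  \<open>\<phi>' = s\<^sub>1 \<Delta> sinh \<phi>\<close> and \<open>y' = s\<^sub>1 \<Delta> y cosh \<phi>\<close>, and \<open>w = (x + \<nu> (y - 1)) / \<lambda>\<close> satisfies
  \<open>w' = - s\<^sub>1 \<Delta> y sinh \<phi>\<close>. As \<open>\<phi>\<close> keeps its sign and \<open>\<lambda> > 0\<close>, the sign of \<open>\<phi>\<close> is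
  \<open>- s\<^sub>1 sgn (\<lambda> w)\<close>. The factor \<open>- s\<^sub>1\<close> is needed: it is what makes the arguments of \<open>arcosh\<close> in
  the inversion formulas exceed 1.\<close>

definition s2 :: "real^2^2 \<Rightarrow> real \<Rightarrow> real" where
  "s2 A w = - s1 A * sgn (lam A * w)"

definition coth :: "real \<Rightarrow> real" where
  "coth x = cosh x / sinh x"

end

theory Submission
  imports Defs
begin

text \<open>
  The null covectors \<open>v\<^sub>1 - v\<^sub>2\<close> and \<open>v\<^sub>1 + v\<^sub>2\<close> of a left-invariant Lorentzian form on the affine
  group are \<open>d\<xi> / y\<close> and \<open>d\<eta> / y\<close> for two functions \<open>\<xi>\<close>, \<open>\<eta>\<close> (\<open>xi\<close>, \<open>eta\<close>) that are affine in
  \<open>(x, y)\<close> and vanish at the identity. In these coordinates \<open>y = 1 + k \<xi> + m \<eta>\<close> with constants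
  \<open>k\<close>, \<open>m\<close>, the curvature is \<open>K = 4 k m\<close>, and a future directed curve has \<open>\<xi>' \<ge> 0\<close>, \<open>\<eta>' \<ge> 0\<close> and
  length \<open>\<integral> sqrt (\<xi>' \<eta>') / y\<close>. The projective change \<open>P = \<xi> / (1 + k \<xi>)\<close>, \<open>Q = \<eta> / (1 + m \<eta>)\<close> gives,
  for all signs of the curvature at once, \<open>y = (1 + k \<xi>) (1 + m \<eta>) (1 - \<kappa> P Q)\<close> and the metric
  \<open>dP dQ / (1 - \<kappa> P Q)\<^sup>2\<close> with \<open>\<kappa> = k m\<close>. It is invariant under the boosts
  \<open>(P, Q) \<mapsto> (P / c, c Q)\<close>, so that polar coordinates \<open>P = r / e\<^sup>\<chi>\<close>, \<open>Q = r e\<^sup>\<chi>\<close> are natural.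

  The extremals starting at the identity are the rays \<open>\<chi> = \<psi>\<^sub>0\<close> with \<open>r' = 1 - \<kappa> r\<^sup>2\<close>
  (\<open>extremal_polar\<close>, which rests on three first integrals, and \<open>extremal_exists\<close>). Thus
  \<open>\<psi>\<^sub>0 = (ln Q - ln P) / 2\<close> and \<open>t\<^sub>1 = atn \<kappa> (sqrt (P Q))\<close> invert the exponential mapping, where
  \<open>atn \<kappa>\<close> is \<open>artanh\<close>, the identity or \<open>arctan\<close>, up to scaling. The image is the set where \<open>\<xi>\<close>, \<open>\<eta>\<close>,
  \<open>y\<close>, \<open>1 + k \<xi>\<close> and \<open>1 + m \<eta>\<close> are positive, which is \<open>M_im\<close> for each sign of \<open>K\<close> (\<open>M_im_eq\<close>).

  Optimality is a calibration argument. Along a future directed curve the inequality of arithmetic and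
  geometric mean gives \<open>sqrt (P' Q') \<le> r'\<close>, hence the length element is at most the differential of
  \<open>atn \<kappa> r\<close>, and the length of a curve from the identity to \<open>p\<close> is at most the value of \<open>atn \<kappa> r\<close> at
  \<open>p\<close> (\<open>length_le_dst\<close>), which the ray attains. Equality forces \<open>P' / P = Q' / Q\<close> almost everywhere,
  so an arclength-parametrized maximizer stays on the ray (\<open>unit_speed_maximizer_is_radial\<close>). As
  the curves are merely Lipschitz, the argument uses the fundamental theorem of calculus for Lipschitz
  functions (\<open>has_integral_deriv_lipschitz\<close>).

  The formulas of the theorem then express \<open>\<psi>\<^sub>0\<close> and \<open>t\<^sub>1\<close> through \<open>y\<close> and \<open>w\<close>, which is
  \<open>m \<eta> - k \<xi>\<close> for \<open>K < 0\<close>, its negative for \<open>K > 0\<close>, and \<open>- \<gamma> \<xi>\<close> or \<open>- \<gamma> \<eta>\<close> for \<open>K = 0\<close>.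
\<close>

section \<open>Lipschitz functions of one real variable\<close>

text \<open>
  The difference quotients of \<open>f\<close> are bounded by the Lipschitz constant and converge to \<open>f'\<close> off a
  negligible set, so dominated convergence reduces the claim to the integrals of the quotients.
  These are difference quotients, at the two end points, of an antiderivative of \<open>f\<close>.
\<close>

lemma has_integral_deriv_lipschitz:
  fixes f f' :: "real \<Rightarrow> real"
  assumes ab: "a \<le> b" and lip: "C-lipschitz_on {a..b} f" and N: "negligible N"
    and der: "\<And>t. t \<in> {a<..<b} - N \<Longrightarrow> (f has_real_derivative f' t) (at t)"
  shows "(f' has_integral f b - f a) {a..b}"
proof -
  \<comment> \<open>Extend \<open>f\<close> by constants, to have difference quotients up to the right end point.\<close>
  define F where "F x = f (max a (min b x))" for x
  define h where "h k = 1 / (real k + 1)" for k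
  have h: "h k > 0" "h k \<le> 1" for k by (auto simp: h_def)
  have C: "C \<ge> 0" using lip lipschitz_on_nonneg by blast
  have Flip: "\<bar>F x - F y\<bar> \<le> C * \<bar>x - y\<bar>" for x y
  proof -
    have "\<bar>F x - F y\<bar> \<le> C * \<bar>max a (min b x) - max a (min b y)\<bar>"
      unfolding F_def using lipschitz_onD[OF lip, of "max a (min b x)" "max a (min b y)"] ab
      by (auto simp: dist_real_def)
    also have "\<dots> \<le> C * \<bar>x - y\<bar>" using C by (intro mult_left_mono) auto
    finally show ?thesis .
  qed
  have "C-lipschitz_on UNIV F" by (rule lipschitz_onI) (use Flip C in \<open>auto simp: dist_real_def\<close>)
  then have Fcont: "continuous_on S F" for S
    using lipschitz_on_continuous_on continuous_on_subset by blast
  obtain G where "\<And>x. x \<in> {a-1..b+2} \<Longrightarrow> (G has_vector_derivative F x) (at x within {a-1..b+2})"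
    using antiderivative_continuous[OF Fcont] by blast
  then have G: "(G has_real_derivative F x) (at x)" if "x \<in> {a-1<..<b+2}" for x
    using that by (metis at_within_Icc_at has_real_derivative_iff_has_vector_derivative
        greaterThanLessThan_subseteq_atLeastAtMost_iff order_refl subsetD greaterThanLessThan_iff)
  define y where "y k = (G (b + h k) - G b) / h k - (G (a + h k) - G a) / h k" for k
  define D where "D k x = (F (x + h k) - F x) / h k" for k x
  have D_int: "(D k has_integral y k) {a..b}" for k
  proof -
    \<comment> \<open>The quotient of \<open>G\<close> with step \<open>h k\<close> is an antiderivative of the quotient of \<open>F\<close>.\<close>
    have "(D k has_integral (G (b + h k) - G b) / h k - (G (a + h k) - G a) / h k) {a..b}"
    proof (rule fundamental_theorem_of_calculus[OF ab])
      fix x assume x: "x \<in> {a..b}"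
      have "((\<lambda>x. (G (x + h k) - G x) / h k) has_real_derivative D k x) (at x)"
        unfolding D_def using x h[of k]
        by (auto intro!: derivative_eq_intros DERIV_chain2[OF G] G simp: field_simps)
      then show "((\<lambda>x. (G (x + h k) - G x) / h k) has_vector_derivative D k x) (at x within {a..b})"
        by (metis has_real_derivative_iff_has_vector_derivative has_vector_derivative_at_within)
    qed
    then show ?thesis by (simp add: y_def)
  qed
  have hlim: "filterlim h (at 0) sequentially"
    unfolding filterlim_at
  proof
    show "\<forall>\<^sub>F k in sequentially. h k \<in> UNIV \<and> h k \<noteq> 0" using h(1) by (auto simp: less_imp_neq[symmetric])
    show "h \<longlonglongrightarrow> 0" using LIMSEQ_inverse_real_of_nat by (simp add: h_def[abs_def] inverse_eq_divide add.commute)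
  qed
  have quot: "(\<lambda>k. (g (x + h k) - g x) / h k) \<longlonglongrightarrow> d" if "(g has_real_derivative d) (at x)" for g x d
    using filterlim_compose[OF that[unfolded DERIV_def] hlim] by simp
  have "y \<longlonglongrightarrow> F b - F a"
    unfolding y_def by (intro tendsto_diff quot G) (use ab in auto)
  then have ylim: "y \<longlonglongrightarrow> f b - f a" using ab by (simp add: F_def)
  define N' where "N' = N \<union> {a, b}"
  have N': "negligible N'" unfolding N'_def using N by (intro negligible_Un) auto
  have "((\<lambda>x. if x \<in> N' then 0 else f' x) has_integral f b - f a) {a..b}"
  proof (rule has_integral_dominated_convergence[where h="\<lambda>_. C"
          and f="\<lambda>k x. if x \<in> N' then 0 else D k x" and y=y])
    show "((\<lambda>x. if x \<in> N' then 0 else D k x) has_integral y k) {a..b}" for k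
      using has_integral_spike[OF N' _ D_int] by auto
    show "\<forall>x\<in>{a..b}. norm (if x \<in> N' then 0 else D k x) \<le> C" for k
    proof -
      have "\<bar>D k x\<bar> \<le> C" for x
        using Flip[of "x + h k" x] h[of k] by (simp add: D_def field_simps)
      then show ?thesis using C by auto
    qed
    show "\<forall>x\<in>{a..b}. (\<lambda>k. if x \<in> N' then 0 else D k x) \<longlonglongrightarrow> (if x \<in> N' then 0 else f' x)"
    proof
      fix x assume x: "x \<in> {a..b}"
      show "(\<lambda>k. if x \<in> N' then 0 else D k x) \<longlonglongrightarrow> (if x \<in> N' then 0 else f' x)"
      proof (cases "x \<in> N'")
        case False
        then have x': "x \<in> {a<..<b}" "x \<notin> N" using x by (auto simp: N'_def)
        have "(F has_real_derivative f' x) (at x)"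
          by (rule has_field_derivative_transform_within_open[OF der, where S="{a<..<b}"])
             (use x' in \<open>auto simp: F_def\<close>)
        from quot[OF this] show ?thesis using False by (simp add: D_def)
      qed simp
    qed
  qed (auto simp: ylim)
  then show ?thesis by (rule has_integral_spike[OF N', rotated]) auto
qed

lemma lipschitz_compose_C1:
  fixes f g g' :: "real \<Rightarrow> real"
  assumes lip: "C-lipschitz_on S f" and im: "f ` S \<subseteq> {c..d}"
    and der: "\<And>x. x \<in> {c..d} \<Longrightarrow> (g has_real_derivative g' x) (at x)"
    and cont: "continuous_on {c..d} g'"
  obtains B where "B-lipschitz_on S (\<lambda>x. g (f x))"
proof -
  obtain B0 where B0: "\<And>x. x \<in> {c..d} \<Longrightarrow> \<bar>g' x\<bar> \<le> B0"
    using compact_imp_bounded[OF compact_continuous_image[OF cont compact_Icc]]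
    unfolding bounded_iff by (metis image_eqI real_norm_def)
  define B where "B = max B0 0"
  have "B-lipschitz_on {c..d} g"
  proof (rule bounded_derivative_imp_lipschitz)
    show "(g has_derivative (\<lambda>h. g' x * h)) (at x within {c..d})" if "x \<in> {c..d}" for x
      using der[OF that] by (metis has_derivative_at_withinI has_field_derivative_def)
    show "onorm (\<lambda>h. g' x * h) \<le> B" if "x \<in> {c..d}" for x
      by (rule onorm_bound) (use B0[OF that] in \<open>auto simp: B_def abs_mult intro!: mult_right_mono\<close>)
  qed (auto simp: B_def)
  from lipschitz_on_compose2[OF lip lipschitz_on_subset[OF this im]] that show ?thesis by blast
qed

lemma integral_le_lipschitz_increment:
  fixes f f' g :: "real \<Rightarrow> real"
  assumes "a \<le> b" "C-lipschitz_on {a..b} f" and N: "negligible N"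
    and "\<And>t. t \<in> {a<..<b} - N \<Longrightarrow> (f has_real_derivative f' t) (at t)"
    and le: "\<And>t. t \<in> {a<..<b} - N \<Longrightarrow> g t \<le> f' t" and g: "g integrable_on {a..b}"
  shows "integral {a..b} g \<le> f b - f a"
proof (rule has_integral_le)
  have N': "negligible (N \<union> {a, b})" using N by (intro negligible_Un) auto
  show "((\<lambda>t. if t \<in> N \<union> {a, b} then 0 else g t) has_integral integral {a..b} g) {a..b}"
    using has_integral_spike[OF N' _ integrable_integral[OF g]] by auto
  show "((\<lambda>t. if t \<in> N \<union> {a, b} then 0 else f' t) has_integral f b - f a) {a..b}"
    using has_integral_spike[OF N' _ has_integral_deriv_lipschitz[OF assms(1-4)]] by auto
qed (use le in auto)

lemma lipschitz_deriv_eq_0_imp_const: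
  fixes f :: "real \<Rightarrow> real"
  assumes "a \<le> b" "C-lipschitz_on {a..b} f" "negligible N"
    and "\<And>t. t \<in> {a<..<b} - N \<Longrightarrow> (f has_real_derivative 0) (at t)"
  shows "f b = f a"
  using has_integral_unique[OF has_integral_deriv_lipschitz[OF assms] has_integral_0] by simp

lemma lipschitz_on_C1:
  fixes f f' :: "real \<Rightarrow> 'a::real_normed_vector"
  assumes der: "\<And>x. x \<in> {a..b} \<Longrightarrow> (f has_vector_derivative f' x) (at x)"
    and cont: "continuous_on {a..b} f'"
  shows "\<exists>C. C-lipschitz_on {a..b} f"
proof -
  obtain B0 where B0: "\<And>x. x \<in> {a..b} \<Longrightarrow> norm (f' x) \<le> B0"
    using compact_imp_bounded[OF compact_continuous_image[OF cont compact_Icc]]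
    unfolding bounded_iff by (metis image_eqI)
  have "(max B0 0)-lipschitz_on {a..b} f"
  proof (rule bounded_derivative_imp_lipschitz)
    show "(f has_derivative (\<lambda>h. h *\<^sub>R f' x)) (at x within {a..b})" if "x \<in> {a..b}" for x
      using der[OF that] by (metis has_derivative_at_withinI has_vector_derivative_def)
    show "onorm (\<lambda>h. h *\<^sub>R f' x) \<le> max B0 0" if "x \<in> {a..b}" for x
      by (rule onorm_bound) (use B0[OF that] in \<open>auto simp: mult.commute[of _ "norm _"] intro!: mult_right_mono\<close>)
  qed auto
  then show ?thesis by blast
qed

lemma deriv_ln_ratio:
  fixes x :: "real \<Rightarrow> real"
  assumes "(x has_real_derivative x') (at t)" "x t > 0" "1 + k * x t > 0"
  shows "((\<lambda>t. ln (x t / (1 + k * x t))) has_real_derivative x' / (x t * (1 + k * x t))) (at t)"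
proof -
  have "((\<lambda>t. x t / (1 + k * x t)) has_real_derivative x' / (1 + k * x t)\<^sup>2) (at t)"
    using assms by (auto intro!: derivative_eq_intros simp: field_simps power2_eq_square)
  from DERIV_chain2[OF DERIV_ln_divide this]
  have "((\<lambda>t. ln (x t / (1 + k * x t))) has_real_derivative
      1 / (x t / (1 + k * x t)) * (x' / (1 + k * x t)\<^sup>2)) (at t)"
    using assms by simp
  then show ?thesis using assms by (simp add: power2_eq_square)
qed

lemma affine_pos:
  fixes k :: real
  assumes "1 + k * a > 0" "1 + k * b > 0" "a \<le> x" "x \<le> b"
  shows "1 + k * x > 0"
proof (cases "k \<ge> 0")
  case True
  then have "k * a \<le> k * x" using assms by (intro mult_left_mono)
  then show ?thesis using assms by linarith
next
  case False
  then have "k * b \<le> k * x" using assms by (intro mult_left_mono_neg) auto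
  then show ?thesis using assms by linarith
qed

text \<open>
  Used for \<open>ln P\<close> and \<open>ln Q\<close> along a curve: \<open>x / (1 + k x)\<close> stays away from \<open>0\<close> and \<open>\<infinity>\<close> when \<open>x\<close> does
  and the affine function \<open>1 + k x\<close> is positive at both ends of the range of \<open>x\<close>.
\<close>

lemma lipschitz_ln_ratio:
  fixes x :: "real \<Rightarrow> real"
  assumes "C-lipschitz_on S x" "x ` S \<subseteq> {c..d}" "c > 0" "1 + k * c > 0" "1 + k * d > 0"
  shows "\<exists>B. B-lipschitz_on S (\<lambda>t. ln (x t / (1 + k * x t)))"
proof (rule lipschitz_compose_C1[OF assms(1,2)])
  have p: "y > 0" "1 + k * y > 0" if "y \<in> {c..d}" for y
    using that assms affine_pos[of k c d y] by auto
  show "((\<lambda>y. ln (y / (1 + k * y))) has_real_derivative 1 / (y * (1 + k * y))) (at y)" if "y \<in> {c..d}" for y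
    using deriv_ln_ratio[OF DERIV_ident p[OF that]] .
  have "y * (1 + k * y) \<noteq> 0" if "y \<in> {c..d}" for y using p[OF that] by auto
  then show "continuous_on {c..d} (\<lambda>y. 1 / (y * (1 + k * y)))"
    by (intro continuous_intros) auto
qed (rule exI)

section \<open>The tangent of constant curvature and its inverse\<close>

text \<open>
  The functions \<open>tn \<kappa>\<close> and \<open>atn \<kappa>\<close> solve \<open>r' = 1 - \<kappa> r\<^sup>2\<close> with \<open>r 0 = 0\<close>: they relate the coordinate \<open>r\<close> on
  a timelike ray to its arclength. The set \<open>tn_dom \<kappa>\<close> is the interval of existence of the solution.
\<close>

definition atn :: "real \<Rightarrow> real \<Rightarrow> real" where
  "atn \<kappa> r = (if \<kappa> > 0 then artanh (sqrt \<kappa> * r) / sqrt \<kappa> else if \<kappa> = 0 then r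
     else arctan (sqrt (- \<kappa>) * r) / sqrt (- \<kappa>))"

definition tn :: "real \<Rightarrow> real \<Rightarrow> real" where
  "tn \<kappa> t = (if \<kappa> > 0 then tanh (sqrt \<kappa> * t) / sqrt \<kappa> else if \<kappa> = 0 then t
     else tan (sqrt (- \<kappa>) * t) / sqrt (- \<kappa>))"

definition tn_dom :: "real \<Rightarrow> real set" where
  "tn_dom \<kappa> = (if \<kappa> \<ge> 0 then UNIV else {- pi / 2 / sqrt (- \<kappa>) <..< pi / 2 / sqrt (- \<kappa>)})"

lemma atn_0 [simp]: "atn \<kappa> 0 = 0"
  by (auto simp: atn_def)

lemma abs_sqrt_mult_less_1:
  assumes "\<kappa> > 0" "\<kappa> * r\<^sup>2 < 1"
  shows "\<bar>sqrt \<kappa> * r\<bar> < 1"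
  using assms by (metis abs_square_less_1 less_imp_le power_mult_distrib real_sqrt_pow2)

lemma atn_has_derivative:
  assumes "\<kappa> * r\<^sup>2 < 1"
  shows "(atn \<kappa> has_real_derivative 1 / (1 - \<kappa> * r\<^sup>2)) (at r)"
proof -
  consider "\<kappa> > 0" | "\<kappa> = 0" | "\<kappa> < 0" by linarith
  then show ?thesis
  proof cases
    case 1
    have "((\<lambda>r. artanh (sqrt \<kappa> * r)) has_real_derivative 1 / (1 - (sqrt \<kappa> * r)\<^sup>2) * sqrt \<kappa>) (at r)"
      by (rule DERIV_chain2[OF artanh_real_has_field_derivative])
        (use abs_sqrt_mult_less_1[OF 1 assms] in \<open>auto intro!: derivative_eq_intros\<close>)
    from DERIV_cdivide[OF this, of "sqrt \<kappa>"]
    have "((\<lambda>r. artanh (sqrt \<kappa> * r) / sqrt \<kappa>) has_real_derivative 1 / (1 - \<kappa> * r\<^sup>2)) (at r)"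
      using 1 by (simp add: power_mult_distrib)
    then show ?thesis using 1 by (simp add: atn_def[abs_def])
  next
    case 2
    then show ?thesis by (simp add: atn_def[abs_def])
  next
    case 3
    have "((\<lambda>r. arctan (sqrt (- \<kappa>) * r) / sqrt (- \<kappa>)) has_real_derivative 1 / (1 - \<kappa> * r\<^sup>2)) (at r)"
      using 3 by (auto intro!: derivative_eq_intros simp: power_mult_distrib divide_simps)
    then show ?thesis using 3 by (simp add: atn_def[abs_def])
  qed
qed

lemma kappa_sq_less_1_mono:
  assumes "0 \<le> r" "r \<le> s" "\<kappa> * s\<^sup>2 < 1"
  shows "\<kappa> * r\<^sup>2 < (1::real)"
proof (cases "\<kappa> \<le> 0")
  case True
  then have "\<kappa> * r\<^sup>2 \<le> 0" by (intro mult_nonpos_nonneg) auto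
  then show ?thesis by simp
next
  case False
  then have "\<kappa> * r\<^sup>2 \<le> \<kappa> * s\<^sup>2" using assms by (intro mult_left_mono power_mono) auto
  then show ?thesis using assms by simp
qed

lemma atn_less:
  assumes "0 \<le> r" "r < s" "\<kappa> * s\<^sup>2 < 1"
  shows "atn \<kappa> r < atn \<kappa> s"
proof (rule DERIV_pos_imp_increasing[OF assms(2)])
  fix x assume "r \<le> x" "x \<le> s"
  then have "\<kappa> * x\<^sup>2 < 1" using kappa_sq_less_1_mono assms by (meson order_trans)
  then show "\<exists>y. DERIV (atn \<kappa>) x :> y \<and> y > 0"
    using atn_has_derivative by (intro exI[of _ "1 / (1 - \<kappa> * x\<^sup>2)"]) auto
qed

lemma atn_inj:
  assumes "0 \<le> r" "0 \<le> s" "\<kappa> * r\<^sup>2 < 1" "\<kappa> * s\<^sup>2 < 1" "atn \<kappa> r = atn \<kappa> s"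
  shows "r = s"
  using assms atn_less by (metis less_irrefl linorder_neqE_linordered_idom)

lemma tn_atn: assumes "\<kappa> * r\<^sup>2 < 1" shows "tn \<kappa> (atn \<kappa> r) = r" "atn \<kappa> r \<in> tn_dom \<kappa>"
proof -
  have t: "tanh (artanh x) = x" if "\<bar>x\<bar> < 1" for x :: real
  proof -
    have p: "(1 + x) / (1 - x) > 0" using that by auto
    have "artanh x = ln (sqrt ((1 + x) / (1 - x)))" by (simp only: artanh_def ln_sqrt[OF less_imp_le[OF p]])
    then have "tanh (artanh x) = ((1 + x) / (1 - x) - 1) / ((1 + x) / (1 - x) + 1)"
      using p by (simp only: tanh_ln_real real_sqrt_gt_0_iff real_sqrt_pow2 less_imp_le)
    moreover have "(1 + x) / (1 - x) - 1 = 2 * x / (1 - x)" "(1 + x) / (1 - x) + 1 = 2 / (1 - x)"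
      using that by (auto simp: field_simps)
    ultimately show ?thesis using that by simp
  qed
  show "tn \<kappa> (atn \<kappa> r) = r"
    using assms abs_sqrt_mult_less_1[of \<kappa> r] by (auto simp: tn_def atn_def t tan_arctan)
  show "atn \<kappa> r \<in> tn_dom \<kappa>"
    using divide_strict_right_mono[OF arctan_lbound[of "sqrt (- \<kappa>) * r"], of "sqrt (- \<kappa>)"]
      divide_strict_right_mono[OF arctan_ubound[of "sqrt (- \<kappa>) * r"], of "sqrt (- \<kappa>)"]
    by (simp add: tn_dom_def atn_def)
qed

lemma open_tn_dom: "open (tn_dom \<kappa>)"
  by (auto simp: tn_dom_def)

lemma tn_dom_Icc: "t \<in> tn_dom \<kappa> \<Longrightarrow> {0..t} \<subseteq> tn_dom \<kappa>" "0 \<in> tn_dom \<kappa>"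
proof -
  show "0 \<in> tn_dom \<kappa>"
    using divide_pos_pos[of "pi / 2" "sqrt (- \<kappa>)"] by (simp add: tn_dom_def)
  then show "{0..t} \<subseteq> tn_dom \<kappa>" if "t \<in> tn_dom \<kappa>"
    using that by (auto simp: tn_dom_def split: if_splits)
qed

lemma tn_0 [simp]: "tn \<kappa> 0 = 0"
  by (simp add: tn_def)

lemma tn_has_derivative:
  assumes "t \<in> tn_dom \<kappa>"
  shows "(tn \<kappa> has_real_derivative 1 - \<kappa> * (tn \<kappa> t)\<^sup>2) (at t)" "\<kappa> * (tn \<kappa> t)\<^sup>2 < 1"
proof -
  have *: "(tn \<kappa> has_real_derivative 1 - \<kappa> * (tn \<kappa> t)\<^sup>2) (at t) \<and> \<kappa> * (tn \<kappa> t)\<^sup>2 < 1"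
  proof -
    consider "\<kappa> > 0" | "\<kappa> = 0" | "\<kappa> < 0" by linarith
    then show ?thesis
    proof cases
      case 1
      have "((\<lambda>t. tanh (sqrt \<kappa> * t) / sqrt \<kappa>) has_real_derivative 1 - \<kappa> * (tn \<kappa> t)\<^sup>2) (at t)"
        using 1 by (auto intro!: derivative_eq_intros simp: tn_def power_divide field_simps)
      moreover have "(tanh (sqrt \<kappa> * t))\<^sup>2 < 1"
        using tanh_real_bounds[of "sqrt \<kappa> * t"] by (auto simp: abs_square_less_1)
      ultimately show ?thesis using 1 by (simp add: tn_def[abs_def] power_divide)
    next
      case 2
      then show ?thesis by (simp add: tn_def[abs_def])
    next
      case 3
      have c: "cos (sqrt (- \<kappa>) * t) \<noteq> 0"
        using assms 3 by (intro less_imp_neq[symmetric] cos_gt_zero_pi) (auto simp: tn_dom_def field_simps)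
      have "((\<lambda>t. tan (sqrt (- \<kappa>) * t) / sqrt (- \<kappa>)) has_real_derivative 1 - \<kappa> * (tn \<kappa> t)\<^sup>2) (at t)"
        using 3 c by (auto intro!: derivative_eq_intros simp: tn_def power_divide tan_sec field_simps)
      moreover have "\<kappa> * (tn \<kappa> t)\<^sup>2 \<le> 0" using 3 by (intro mult_nonpos_nonneg) auto
      ultimately show ?thesis using 3 by (simp add: tn_def[abs_def])
    qed
  qed
  show "(tn \<kappa> has_real_derivative 1 - \<kappa> * (tn \<kappa> t)\<^sup>2) (at t)" "\<kappa> * (tn \<kappa> t)\<^sup>2 < 1" using * by auto
qed

lemma tn_mono:
  assumes "0 \<le> s" "s \<le> t" "t \<in> tn_dom \<kappa>"
  shows "tn \<kappa> s \<le> tn \<kappa> t"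
proof (rule DERIV_nonneg_imp_nondecreasing[OF assms(2)])
  fix x assume "s \<le> x" "x \<le> t"
  then have "x \<in> tn_dom \<kappa>" using tn_dom_Icc(1)[OF assms(3)] assms by auto
  from tn_has_derivative[OF this] show "\<exists>y. DERIV (tn \<kappa>) x :> y \<and> y \<ge> 0"
    by (intro exI[of _ "1 - \<kappa> * (tn \<kappa> x)\<^sup>2"]) auto
qed

section \<open>Null coordinates\<close>

lemma matrix_inv_2x2:
  fixes A :: "real^2^2"
  assumes "det A \<noteq> 0"
  shows "al A = A$2$2 / det A" "be A = - A$1$2 / det A" "ga A = - A$2$1 / det A" "de A = A$1$1 / det A"
proof -
  define r where "r = 1 / det A"
  have r: "A$1$1 * (A$2$2 * r) - A$1$2 * (A$2$1 * r) = 1"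
    using assms by (simp add: r_def det_2 diff_divide_distrib[symmetric])
  define B :: "real^2^2" where "B = vector [vector [A$2$2 * r, - A$1$2 * r], vector [- A$2$1 * r, A$1$1 * r]]"
  have "A ** B = mat 1"
    using r by (simp add: B_def vec_eq_iff forall_2 matrix_matrix_mult_def sum_2 mat_def algebra_simps)
  moreover have "matrix_inv A ** A = mat 1"
    using assms invertible_det_nz[of A] someI_ex[of "\<lambda>B. A ** B = mat 1 \<and> B ** A = mat 1"]
    unfolding matrix_inv_def invertible_def by blast
  ultimately have "matrix_inv A = B" by (metis matrix_mul_assoc matrix_mul_lid matrix_mul_rid)
  then show "al A = A$2$2 / det A" "be A = - A$1$2 / det A" "ga A = - A$2$1 / det A" "de A = A$1$1 / det A"
    by (auto simp: B_def r_def)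
qed

text \<open>
  All constants of the form are expressed by \<open>k\<close> and \<open>m\<close>, half the difference and half the sum of
  \<open>\<gamma>\<close> and \<open>\<delta>\<close>. The region \<open>M\<close> is described in the same way for all signs of the curvature; \<open>M_im_eq\<close>
  shows that it is the image of the exponential mapping.
\<close>

locale aff_lorentz =
  fixes A :: "real^2^2"
  assumes det_pos: "det A > 0" and a_nonneg: "A$1$1 \<ge> 0"
begin

definition k :: real where "k = (ga A - de A) / 2"
definition m :: real where "m = (ga A + de A) / 2"
definition \<kappa> :: real where "\<kappa> = k * m"
definition xi :: "real \<times> real \<Rightarrow> real" where "xi q = - lambda1 A q"
definition eta :: "real \<times> real \<Rightarrow> real" where "eta q = lambda2 A q"
definition u :: "real \<times> real \<Rightarrow> real" where "u q = 1 + k * xi q"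
definition v :: "real \<times> real \<Rightarrow> real" where "v q = 1 + m * eta q"
definition M :: "(real \<times> real) set" where
  "M = {q \<in> Aff. xi q > 0 \<and> eta q > 0 \<and> u q > 0 \<and> v q > 0}"

lemmas inv_entries = matrix_inv_2x2[OF less_imp_neq[OF det_pos, symmetric]]

lemma det_A: "det A = A$1$1 * A$2$2 - A$1$2 * A$2$1"
  by (simp add: det_2)

lemma km_alt: "2 * det A * k = - (A$2$1 + A$1$1)" "2 * det A * m = A$1$1 - A$2$1"
  using det_pos by (auto simp: k_def m_def inv_entries field_simps)

lemma k_le_m: "k \<le> m"
  using det_pos a_nonneg by (auto simp: k_def m_def inv_entries)

lemma sec_curv_eq: "sec_curv A = 4 * \<kappa>"
proof -
  have "4 * \<kappa> * (det A)\<^sup>2 = (2 * det A * k) * (2 * det A * m)" by (simp add: \<kappa>_def power2_eq_square)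
  also have "\<dots> = (A$2$1)\<^sup>2 - (A$1$1)\<^sup>2" unfolding km_alt by (simp add: power2_eq_square algebra_simps)
  finally show ?thesis using det_pos by (simp add: sec_curv_def field_simps)
qed

lemma snd_eq: "snd q = 1 + k * xi q + m * eta q"
proof -
  have "2 * det A * (k * xi q + m * eta q) = (2 * det A * k) * xi q + (2 * det A * m) * eta q"
    by (simp add: algebra_simps)
  also have "\<dots> = 2 * det A * (snd q - 1)"
    unfolding km_alt unfolding det_A xi_def eta_def lambda1_def lambda2_def by (simp add: algebra_simps)
  finally show ?thesis using det_pos by simp
qed

text \<open>
  This factorization makes the metric \<open>d\<xi> d\<eta> / y\<^sup>2\<close> conformal to \<open>dP dQ\<close> with a factor that depends on
  \<open>P Q\<close> alone.
\<close>

lemma snd_eq_uv: "snd q = u q * v q - \<kappa> * xi q * eta q"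
  unfolding snd_eq u_def v_def \<kappa>_def by (simp add: algebra_simps)

lemma xi_eta_inj:
  assumes "xi p = xi q" "eta p = eta q"
  shows "p = q"
proof -
  have s: "snd p = snd q" using assms snd_eq by metis
  have "(A$1$1 - A$2$1) * fst p = (A$1$1 - A$2$1) * fst q" "(A$1$1 + A$2$1) * fst p = (A$1$1 + A$2$1) * fst q"
    using assms s by (auto simp: xi_def eta_def lambda1_def lambda2_def algebra_simps)
  moreover have "A$1$1 - A$2$1 \<noteq> 0 \<or> A$1$1 + A$2$1 \<noteq> 0" using det_pos unfolding det_A by auto
  ultimately show ?thesis using s by (auto simp: prod_eq_iff)
qed

text \<open>
  The point with null coordinates \<open>x\<close> and \<open>e\<close>, by Cramer's rule.
\<close>

definition pt :: "real \<Rightarrow> real \<Rightarrow> real \<times> real" where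
  "pt x e = (((A$1$2 + A$2$2) * x - (A$1$2 - A$2$2) * e) / (2 * det A),
    1 + ((A$1$1 - A$2$1) * e - (A$1$1 + A$2$1) * x) / (2 * det A))"

lemma xi_eta_pt [simp]: "xi (pt x e) = x" "eta (pt x e) = e"
proof -
  define r where "r = 1 / (2 * det A)"
  have r: "r * (A$1$1 * A$2$2 - A$1$2 * A$2$1) = 1 / 2" using det_pos unfolding r_def det_A by simp
  have pt: "pt x e = (r * ((A$1$2 + A$2$2) * x - (A$1$2 - A$2$2) * e),
    1 + r * ((A$1$1 - A$2$1) * e - (A$1$1 + A$2$1) * x))"
    by (simp add: pt_def r_def)
  have "xi (pt x e) = 2 * (r * (A$1$1 * A$2$2 - A$1$2 * A$2$1)) * x"
    "eta (pt x e) = 2 * (r * (A$1$1 * A$2$2 - A$1$2 * A$2$1)) * e"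
    unfolding pt by (simp_all add: xi_def eta_def lambda1_def lambda2_def algebra_simps)
  then show "xi (pt x e) = x" "eta (pt x e) = e" using r by auto
qed

lemma id_coords [simp]: "xi aff_id = 0" "eta aff_id = 0"
  by (auto simp: xi_def eta_def lambda1_def lambda2_def aff_id_def)

lemma xi_linear: "xi q = (A$1$1 - A$2$1, A$1$2 - A$2$2) \<bullet> q - (A$1$2 - A$2$2)"
  by (cases q) (simp add: xi_def lambda1_def inner_prod_def algebra_simps)

lemma eta_linear: "eta q = (A$1$1 + A$2$1, A$1$2 + A$2$2) \<bullet> q - (A$1$2 + A$2$2)"
  by (cases q) (simp add: eta_def lambda2_def inner_prod_def algebra_simps)

text \<open>
  The linear parts of \<open>xi\<close> and \<open>eta\<close>, applied to a velocity: they are \<open>y\<close> times the left-invariant null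
  covectors, because the frame is \<open>y \<partial>\<^sub>x\<close>, \<open>y \<partial>\<^sub>y\<close>.
\<close>

lemma v1_v2:
  assumes "q \<in> Aff"
  shows "(A$1$1 - A$2$1, A$1$2 - A$2$2) \<bullet> w = snd q * (v1 A q w - v2 A q w)"
    "(A$1$1 + A$2$1, A$1$2 + A$2$2) \<bullet> w = snd q * (v1 A q w + v2 A q w)"
  using assms
  by (cases w; simp add: inner_prod_def Aff_def v1_def v2_def frame_coords_def matrix_vector_mult_def sum_2;
      simp add: field_simps)+

lemma null_derivatives:
  assumes "(q has_vector_derivative w) (at t)" "q t \<in> Aff"
  shows "((\<lambda>t. xi (q t)) has_real_derivative snd (q t) * (v1 A (q t) w - v2 A (q t) w)) (at t)"
    "((\<lambda>t. eta (q t)) has_real_derivative snd (q t) * (v1 A (q t) w + v2 A (q t) w)) (at t)"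
proof -
  have "((\<lambda>t. b \<bullet> q t - c) has_vector_derivative b \<bullet> w) (at t)" for b and c :: real
    using assms(1) unfolding has_vector_derivative_def by (auto intro!: derivative_eq_intros)
  then show "((\<lambda>t. xi (q t)) has_real_derivative snd (q t) * (v1 A (q t) w - v2 A (q t) w)) (at t)"
    "((\<lambda>t. eta (q t)) has_real_derivative snd (q t) * (v1 A (q t) w + v2 A (q t) w)) (at t)"
    unfolding xi_linear eta_linear v1_v2[OF assms(2), symmetric] has_real_derivative_iff_has_vector_derivative
    by blast+
qed

lemma xi_eta_lipschitz:
  assumes "C-lipschitz_on S q"
  obtains B B' where "B-lipschitz_on S (\<lambda>t. xi (q t))" "B'-lipschitz_on S (\<lambda>t. eta (q t))"
proof -
  have "\<exists>B. B-lipschitz_on S (\<lambda>t. b \<bullet> q t - c)" for b and c :: real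
  proof -
    obtain B where "B-lipschitz_on (q ` S) (\<lambda>x. b \<bullet> x)"
      using bounded_linear.lipschitz_boundE[OF bounded_linear_inner_right] by blast
    from lipschitz_on_diff[OF lipschitz_on_compose2[OF assms this] lipschitz_on_constant]
    show ?thesis by blast
  qed
  then show ?thesis using that unfolding xi_linear eta_linear by blast
qed

text \<open>
  For \<open>K < 0\<close> the choice \<open>a \<ge> 0\<close> selects \<open>k < 0 < m\<close>. The value of \<open>\<lambda>\<^sub>1\<close> at \<open>B\<close> is \<open>1 / k\<close>, so that
  \<open>\<lambda>\<^sub>3 > 0\<close> says that \<open>1 + k \<xi>\<close> is positive, while \<open>1 + m \<eta>\<close> is a sum of positive numbers.
\<close>

lemma M_im_negative_curvature:
  assumes "sec_curv A < 0"
  shows "M_im A = M" "k < 0" "m > 0"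
proof -
  have km: "k * m < 0" using assms sec_curv_eq by (simp add: \<kappa>_def)
  show "k < 0" "m > 0" using km k_le_m by (auto simp: mult_less_0_iff)
  then have ca: "A$2$1 + A$1$1 > 0" using km_alt(1) det_pos
    by (smt (verit) mult_pos_neg)
  have "lambda1 A ((A$2$2 + A$1$2) / (A$2$1 + A$1$1), 0) * (A$2$1 + A$1$1) = - 2 * det A"
    using ca by (simp add: lambda1_def distrib_right) (simp add: det_A algebra_simps)
  moreover have "1 / k * (A$2$1 + A$1$1) = - 2 * det A"
    using km_alt(1) \<open>k < 0\<close> by (simp add: field_simps)
  ultimately have B: "lambda1 A ((A$2$2 + A$1$2) / (A$2$1 + A$1$1), 0) = 1 / k"
    using ca by (metis mult_right_cancel less_irrefl)
  have "lambda3 A q > 0 \<longleftrightarrow> u q > 0" for q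
  proof -
    have "1 - k * lambda1 A q = - k * lambda3 A q"
      using \<open>k < 0\<close> unfolding lambda3_def B by (simp add: field_simps)
    then show ?thesis using \<open>k < 0\<close> by (simp add: u_def xi_def zero_less_mult_iff mult_less_0_iff)
  qed
  moreover have "v q > 0" if "eta q > 0" for q
    using that \<open>m > 0\<close> by (simp add: v_def add_pos_pos)
  ultimately show "M_im A = M" using assms by (auto simp: M_im_def M_def xi_def eta_def)
qed

text \<open>
  For \<open>K \<ge> 0\<close> the numbers \<open>k\<close> and \<open>m\<close> do not have opposite signs. If they are nonpositive, both \<open>u\<close> and \<open>v\<close>
  are at least \<open>y\<close>.
\<close>

lemma u_v_pos_if_nonneg_curv:
  assumes "sec_curv A \<ge> 0" "xi q \<ge> 0" "eta q \<ge> 0" "snd q > 0"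
  shows "u q > 0" "v q > 0"
proof -
  have "k * m \<ge> 0" using assms sec_curv_eq by (simp add: \<kappa>_def)
  then consider "k \<ge> 0" "m \<ge> 0" | "k \<le> 0" "m \<le> 0" by (auto simp: zero_le_mult_iff)
  then have "u q > 0 \<and> v q > 0"
  proof cases
    case 1
    then show ?thesis using assms by (auto simp: u_def v_def intro!: add_pos_nonneg)
  next
    case 2
    then have "k * xi q \<le> 0" "m * eta q \<le> 0" using assms by (auto simp: mult_nonpos_nonneg)
    then show ?thesis using assms(4) snd_eq[of q] by (auto simp: u_def v_def)
  qed
  then show "u q > 0" "v q > 0" by auto
qed

section \<open>Conformal null coordinates and polar coordinates\<close>

text \<open>
  The conformal null coordinates \<open>P\<close>, \<open>Q\<close> and the corresponding polar coordinates. The function \<open>dst\<close>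
  turns out to be the Lorentzian distance from the identity, and \<open>rapidity\<close> the initial value \<open>\<psi>\<^sub>0\<close> of
  the extremal that reaches the point.
\<close>

definition P :: "real \<times> real \<Rightarrow> real" where "P q = xi q / u q"
definition Q :: "real \<times> real \<Rightarrow> real" where "Q q = eta q / v q"
definition rad :: "real \<times> real \<Rightarrow> real" where "rad q = sqrt (P q * Q q)"
definition dst :: "real \<times> real \<Rightarrow> real" where "dst q = atn \<kappa> (rad q)"
definition rapidity :: "real \<times> real \<Rightarrow> real" where "rapidity q = (ln (Q q) - ln (P q)) / 2"

lemma M_pos:
  assumes "q \<in> M"
  shows "q \<in> Aff" "snd q > 0" "xi q > 0" "eta q > 0" "u q > 0" "v q > 0" "P q > 0" "Q q > 0" "rad q > 0"
  using assms by (auto simp: M_def Aff_def P_def Q_def rad_def)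

lemma rad_sq: "q \<in> M \<Longrightarrow> (rad q)\<^sup>2 = P q * Q q"
  using M_pos(7,8)[of q] by (simp add: rad_def)

lemma snd_eq_PQ:
  assumes "u q > 0" "v q > 0"
  shows "snd q = u q * v q * (1 - \<kappa> * (P q * Q q))"
  using assms by (subst snd_eq_uv) (simp add: P_def Q_def field_simps)

lemma rad_bound: "q \<in> M \<Longrightarrow> \<kappa> * (rad q)\<^sup>2 < 1"
proof -
  assume q: "q \<in> M"
  have "u q * v q \<ge> 0" "u q * v q * (1 - \<kappa> * (P q * Q q)) > 0"
    using snd_eq_PQ[of q] M_pos[OF q] by (auto simp: less_imp_le)
  then show ?thesis using rad_sq[OF q] by (simp add: zero_less_mult_iff)
qed

lemma coords_from_PQ:
  assumes "u q > 0" "v q > 0"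
  shows "u q = 1 / (1 - k * P q)" "v q = 1 / (1 - m * Q q)" "k * P q < 1" "m * Q q < 1"
    "xi q = P q / (1 - k * P q)" "eta q = Q q / (1 - m * Q q)"
proof -
  have 1: "1 - k * P q = 1 / u q" "1 - m * Q q = 1 / v q"
    using assms by (simp_all add: P_def Q_def field_simps) (simp_all add: u_def v_def)
  then show "u q = 1 / (1 - k * P q)" "v q = 1 / (1 - m * Q q)" by auto
  show "k * P q < 1" "m * Q q < 1" using 1 assms by (smt (verit) divide_pos_pos)+
  show "xi q = P q / (1 - k * P q)" "eta q = Q q / (1 - m * Q q)"
    unfolding 1 using assms by (auto simp: P_def Q_def)
qed

lemma PQ_inj:
  assumes "p \<in> M" "q \<in> M" "P p = P q" "Q p = Q q"
  shows "p = q"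
proof (rule xi_eta_inj)
  show "xi p = xi q" "eta p = eta q"
    using coords_from_PQ(5,6)[OF M_pos(5,6)[OF assms(1)]] coords_from_PQ(5,6)[OF M_pos(5,6)[OF assms(2)]]
    unfolding assms(3,4) by simp_all
qed

lemma rad_exp:
  assumes "q \<in> M"
  shows "rad q = exp ((ln (P q) + ln (Q q)) / 2)"
proof -
  have "(ln (P q) + ln (Q q)) / 2 = ln (rad q)"
    using M_pos(7,8)[OF assms] by (simp add: rad_def ln_sqrt ln_mult)
  then show ?thesis using M_pos(9)[OF assms] by simp
qed

lemma PQ_polar:
  assumes "q \<in> M"
  shows "P q = exp (- rapidity q) * rad q" "Q q = exp (rapidity q) * rad q"
proof -
  have pq: "P q > 0" "Q q > 0" using M_pos assms by auto
  show "P q = exp (- rapidity q) * rad q" "Q q = exp (rapidity q) * rad q"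
    unfolding rad_exp[OF assms] rapidity_def exp_add[symmetric] using pq by (simp_all add: field_simps flip: add_divide_distrib)
qed

section \<open>The length of a nonspacelike curve\<close>

text \<open>
  The integrand of the Lorentzian length.
\<close>

definition speed :: "(real \<Rightarrow> real \<times> real) \<Rightarrow> real \<Rightarrow> real" where
  "speed q t = sqrt (- lorentz_form A (q t) (vector_derivative q (at t)))"

lemma future_curve_nullE:
  assumes "future_curve A q T"
  obtains N x' e' B B' where "negligible N"
    "\<forall>t\<in>{0..T} - N. ((\<lambda>t. xi (q t)) has_real_derivative x' t) (at t)"
    "\<forall>t\<in>{0..T} - N. ((\<lambda>t. eta (q t)) has_real_derivative e' t) (at t)"
    "\<forall>t\<in>{0..T} - N. x' t \<ge> 0" "\<forall>t\<in>{0..T} - N. e' t \<ge> 0"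
    "\<forall>t\<in>{0..T} - N. speed q t = sqrt (x' t * e' t) / snd (q t)"
    "B-lipschitz_on {0..T} (\<lambda>t. xi (q t))" "B'-lipschitz_on {0..T} (\<lambda>t. eta (q t))"
proof -
  let ?w = "\<lambda>t. vector_derivative q (at t)"
  obtain C where C: "C-lipschitz_on {0..T} q" and Aff: "\<And>t. t \<in> {0..T} \<Longrightarrow> q t \<in> Aff"
    using assms unfolding future_curve_def by blast
  obtain N where N: "negligible N" "\<And>t. t \<in> {0..T} - N \<Longrightarrow> q differentiable at t"
    "\<And>t. t \<in> {0..T} - N \<Longrightarrow> future_nonspacelike A (q t) (?w t)"
  proof -
    have "AE t in lebesgue. t \<in> {0..T} \<longrightarrow> q differentiable (at t) \<and> future_nonspacelike A (q t) (?w t)"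
      using assms by (subst (asm) future_curve_def) (auto simp: AE_restrict_space_iff)
    then show ?thesis using that unfolding eventually_ae_filter_negligible by blast
  qed
  obtain B B' where B: "B-lipschitz_on {0..T} (\<lambda>t. xi (q t))" "B'-lipschitz_on {0..T} (\<lambda>t. eta (q t))"
    using xi_eta_lipschitz[OF C] by blast
  define x' where "x' t = snd (q t) * (v1 A (q t) (?w t) - v2 A (q t) (?w t))" for t
  define e' where "e' t = snd (q t) * (v1 A (q t) (?w t) + v2 A (q t) (?w t))" for t
  have "x' t \<ge> 0 \<and> e' t \<ge> 0 \<and> speed q t = sqrt (x' t * e' t) / snd (q t)" if "t \<in> {0..T} - N" for t
  proof -
    have f: "v1 A (q t) (?w t) \<ge> \<bar>v2 A (q t) (?w t)\<bar>" and p: "snd (q t) > 0"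
      using N(3)[OF that] Aff that by (auto simp: future_nonspacelike_def Aff_def)
    have "x' t * e' t = (snd (q t))\<^sup>2 * - lorentz_form A (q t) (?w t)"
      by (simp add: x'_def e'_def lorentz_form_def power2_eq_square algebra_simps)
    then have "sqrt (x' t * e' t) = snd (q t) * speed q t"
      unfolding speed_def using p by (simp only: real_sqrt_mult real_sqrt_abs abs_of_pos)
    with f p show ?thesis by (auto simp: x'_def e'_def)
  qed
  moreover have "((\<lambda>t. xi (q t)) has_real_derivative x' t) (at t)"
    "((\<lambda>t. eta (q t)) has_real_derivative e' t) (at t)" if "t \<in> {0..T} - N" for t
    unfolding x'_def e'_def using null_derivatives[of q "?w t" t] N(2)[OF that] Aff that
    by (auto simp: vector_derivative_works)
  ultimately show ?thesis using that[of N x' e'] N(1) B by blast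
qed

lemma future_curve_mono:
  assumes "future_curve A q T" "0 \<le> s" "s \<le> t" "t \<le> T"
  shows "xi (q s) \<le> xi (q t)" "eta (q s) \<le> eta (q t)"
proof -
  obtain N x' e' B B' where n: "negligible N"
    "\<forall>t\<in>{0..T} - N. ((\<lambda>t. xi (q t)) has_real_derivative x' t) (at t)"
    "\<forall>t\<in>{0..T} - N. ((\<lambda>t. eta (q t)) has_real_derivative e' t) (at t)"
    "\<forall>t\<in>{0..T} - N. x' t \<ge> 0" "\<forall>t\<in>{0..T} - N. e' t \<ge> 0"
    "\<forall>t\<in>{0..T} - N. speed q t = sqrt (x' t * e' t) / snd (q t)"
    "B-lipschitz_on {0..T} (\<lambda>t. xi (q t))" "B'-lipschitz_on {0..T} (\<lambda>t. eta (q t))"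
    by (rule future_curve_nullE[OF assms(1)])
  note n = n[rule_format]
  have sub: "{s..t} \<subseteq> {0..T}" using assms by auto
  have gen: "f s \<le> f t" if "C-lipschitz_on {0..T} f"
    "\<And>t. t \<in> {0..T} - N \<Longrightarrow> (f has_real_derivative f' t) (at t)" "\<And>t. t \<in> {0..T} - N \<Longrightarrow> f' t \<ge> 0"
    for f f' :: "real \<Rightarrow> real" and C
  proof -
    have "integral {s..t} (\<lambda>_. 0) \<le> f t - f s"
      by (rule integral_le_lipschitz_increment[OF assms(3) lipschitz_on_subset[OF that(1) sub] n(1), of f'])
        (use sub that(2,3) in \<open>auto simp: subset_iff\<close>)
    then show ?thesis by simp
  qed
  show "xi (q s) \<le> xi (q t)" "eta (q s) \<le> eta (q t)"
    using gen[OF n(7) n(2,4)] gen[OF n(8) n(3,5)] by auto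
qed

text \<open>
  It follows that a nonspacelike curve from the identity that ends in \<open>M\<close> stays in \<open>M\<close> once it has left the light
  cone: \<open>\<xi>\<close> and \<open>\<eta>\<close> are monotone along it, and affine functions that are positive at both ends of an
  interval are positive between them.
\<close>

lemma M_below:
  assumes "z \<in> M" "p \<in> Aff" "0 < xi p" "0 < eta p" "xi p \<le> xi z" "eta p \<le> eta z"
  shows "p \<in> M"
  using assms affine_pos[of k 0 "xi z" "xi p"] affine_pos[of m 0 "eta z" "eta p"]
  by (auto simp: M_def u_def v_def)

lemma dst_pos: "q \<in> M \<Longrightarrow> dst q > 0"
  using atn_less[of 0 "rad q" \<kappa>] M_pos(9)[of q] rad_bound[of q] by (simp add: dst_def)

lemma future_curve_restrict:
  assumes "future_curve A q T" "0 \<le> s" "s \<le> T"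
  shows "future_curve A q s"
proof -
  have sub: "{0..s} \<subseteq> {0..T}" using assms by auto
  have "AE t in lebesgue. t \<in> {0..T} \<longrightarrow> q differentiable (at t) \<and>
      future_nonspacelike A (q t) (vector_derivative q (at t))"
    using assms(1) by (subst (asm) future_curve_def) (auto simp: AE_restrict_space_iff)
  then have "AE t in lebesgue. t \<in> {0..s} \<longrightarrow> q differentiable (at t) \<and>
      future_nonspacelike A (q t) (vector_derivative q (at t))"
    using assms by (elim eventually_mono) auto
  then have "AE t in lebesgue_on {0..s}. q differentiable (at t) \<and>
      future_nonspacelike A (q t) (vector_derivative q (at t))"
    by (subst AE_restrict_space_iff) auto
  moreover have "q ` {0..s} \<subseteq> Aff" "\<exists>C. C-lipschitz_on {0..s} q"
    using assms(1) sub lipschitz_on_subset unfolding future_curve_def by blast+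
  ultimately show ?thesis using assms(2) unfolding future_curve_def by blast
qed

text \<open>
  On a piece of a curve inside \<open>M\<close> the functions \<open>ln P\<close> and \<open>ln Q\<close> are Lipschitz, with nonnegative
  derivatives \<open>p'\<close> and \<open>e'\<close> almost everywhere. Up to the common factor \<open>r / (1 - \<kappa> r\<^sup>2)\<close> the speed is the
  geometric mean of \<open>p'\<close> and \<open>e'\<close>, and the derivative of \<open>dst\<close> is their arithmetic mean, because
  \<open>ln r\<close> is the mean of \<open>ln P\<close> and \<open>ln Q\<close>.
\<close>

lemma log_coords_along_curve:
  assumes c: "future_curve A q T" "0 \<le> s" "s \<le> t" "t \<le> T" and M: "q s \<in> M" "q t \<in> M"
  obtains N p' e' B1 B2 B3 where "negligible N"
    "\<forall>\<tau>\<in>{s..t}. q \<tau> \<in> M"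
    "\<forall>\<tau>\<in>{s..t} - N. ((\<lambda>\<tau>. ln (P (q \<tau>))) has_real_derivative p' \<tau>) (at \<tau>)"
    "\<forall>\<tau>\<in>{s..t} - N. ((\<lambda>\<tau>. ln (Q (q \<tau>))) has_real_derivative e' \<tau>) (at \<tau>)"
    "\<forall>\<tau>\<in>{s<..<t} - N. ((\<lambda>\<tau>. dst (q \<tau>)) has_real_derivative
        rad (q \<tau>) / (1 - \<kappa> * (rad (q \<tau>))\<^sup>2) * ((p' \<tau> + e' \<tau>) / 2)) (at \<tau>)"
    "\<forall>\<tau>\<in>{s..t} - N. p' \<tau> \<ge> 0 \<and> e' \<tau> \<ge> 0"
    "\<forall>\<tau>\<in>{s..t} - N.
        speed q \<tau> = rad (q \<tau>) / (1 - \<kappa> * (rad (q \<tau>))\<^sup>2) * sqrt (p' \<tau> * e' \<tau>)"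
    "B1-lipschitz_on {s..t} (\<lambda>\<tau>. ln (P (q \<tau>)))" "B2-lipschitz_on {s..t} (\<lambda>\<tau>. ln (Q (q \<tau>)))"
    "B3-lipschitz_on {s..t} (\<lambda>\<tau>. dst (q \<tau>))"
proof -
  obtain N x' e' B B' where n: "negligible N"
    "\<forall>t\<in>{0..T} - N. ((\<lambda>t. xi (q t)) has_real_derivative x' t) (at t)"
    "\<forall>t\<in>{0..T} - N. ((\<lambda>t. eta (q t)) has_real_derivative e' t) (at t)"
    "\<forall>t\<in>{0..T} - N. x' t \<ge> 0" "\<forall>t\<in>{0..T} - N. e' t \<ge> 0"
    "\<forall>t\<in>{0..T} - N. speed q t = sqrt (x' t * e' t) / snd (q t)"
    "B-lipschitz_on {0..T} (\<lambda>t. xi (q t))" "B'-lipschitz_on {0..T} (\<lambda>t. eta (q t))"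
    by (rule future_curve_nullE[OF c(1)])
  note n = n[rule_format]
  have sub: "{s..t} \<subseteq> {0..T}" using c by auto
  have bet: "xi (q s) \<le> xi (q \<tau>)" "xi (q \<tau>) \<le> xi (q t)" "eta (q s) \<le> eta (q \<tau>)" "eta (q \<tau>) \<le> eta (q t)"
    if "\<tau> \<in> {s..t}" for \<tau>
    using future_curve_mono[OF c(1)] that c by auto
  have inM: "q \<tau> \<in> M" if "\<tau> \<in> {s..t}" for \<tau>
    using bet[OF that] M_pos[OF M(1)] c that
    by (intro M_below[OF M(2)]) (auto simp: future_curve_def image_subset_iff)
  have lnP: "(\<lambda>\<tau>. ln (P (q \<tau>))) = (\<lambda>\<tau>. ln (xi (q \<tau>) / (1 + k * xi (q \<tau>))))"
    and lnQ: "(\<lambda>\<tau>. ln (Q (q \<tau>))) = (\<lambda>\<tau>. ln (eta (q \<tau>) / (1 + m * eta (q \<tau>))))"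
    by (auto simp: P_def Q_def u_def v_def)
  have uv1: "1 + k * xi (q s) > 0" "1 + m * eta (q s) > 0" "1 + k * xi (q t) > 0" "1 + m * eta (q t) > 0"
    using M_pos[OF M(1)] M_pos[OF M(2)] by (auto simp: u_def v_def)
  have "\<exists>B. B-lipschitz_on {s..t} (\<lambda>\<tau>. ln (xi (q \<tau>) / (1 + k * xi (q \<tau>))))"
    by (rule lipschitz_ln_ratio[OF lipschitz_on_subset[OF n(7) sub], of "xi (q s)" "xi (q t)"])
      (use bet M_pos(3)[OF M(1)] uv1 in \<open>auto simp: image_subset_iff\<close>)
  then obtain B1 where B1: "B1-lipschitz_on {s..t} (\<lambda>\<tau>. ln (P (q \<tau>)))" unfolding lnP by blast
  have "\<exists>B. B-lipschitz_on {s..t} (\<lambda>\<tau>. ln (eta (q \<tau>) / (1 + m * eta (q \<tau>))))"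
    by (rule lipschitz_ln_ratio[OF lipschitz_on_subset[OF n(8) sub], of "eta (q s)" "eta (q t)"])
      (use bet M_pos(4)[OF M(1)] uv1 in \<open>auto simp: image_subset_iff\<close>)
  then obtain B2 where B2: "B2-lipschitz_on {s..t} (\<lambda>\<tau>. ln (Q (q \<tau>)))" unfolding lnQ by blast
  \<comment> \<open>\<open>L = ln r\<close>, so that \<open>dst = atn \<kappa> (exp L)\<close>\<close>
  define L where "L \<tau> = (ln (P (q \<tau>)) + ln (Q (q \<tau>))) / 2" for \<tau>
  have "L = (\<lambda>\<tau>. 1 / 2 * (ln (P (q \<tau>)) + ln (Q (q \<tau>))))" by (simp add: L_def fun_eq_iff)
  then obtain B4 where L_lip: "B4-lipschitz_on {s..t} L"
    using lipschitz_on_cmult_real[OF lipschitz_on_add[OF B1 B2], of "1 / 2"] by metis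
  have rad: "rad (q \<tau>) = exp (L \<tau>)" if "\<tau> \<in> {s..t}" for \<tau>
    using rad_exp[OF inM[OF that]] by (simp add: L_def)
  have dst: "dst (q \<tau>) = atn \<kappa> (exp (L \<tau>))" if "\<tau> \<in> {s..t}" for \<tau>
    using rad[OF that] by (simp add: dst_def)
  have L_cont: "continuous_on {s..t} L" using L_lip lipschitz_on_continuous_on by blast
  have atn_exp: "((\<lambda>l. atn \<kappa> (exp l)) has_real_derivative exp l / (1 - \<kappa> * (exp l)\<^sup>2)) (at l)"
    if "\<kappa> * (exp l)\<^sup>2 < 1" for l
    using DERIV_chain2[OF atn_has_derivative[OF that] DERIV_exp] by simp
  obtain B3 where B3: "B3-lipschitz_on {s..t} (\<lambda>\<tau>. dst (q \<tau>))"
  proof -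
    \<comment> \<open>The image of \<open>L\<close> lies between two values at which \<open>\<kappa> r\<^sup>2 < 1\<close>, where \<open>atn \<kappa>\<close> is smooth.\<close>
    have ne: "{s..t} \<noteq> {}" using c by simp
    obtain \<tau>0 where t0: "\<tau>0 \<in> {s..t}" "\<forall>\<tau>\<in>{s..t}. L \<tau>0 \<le> L \<tau>"
      using continuous_attains_inf[OF compact_Icc ne L_cont] by blast
    obtain \<tau>1 where t1: "\<tau>1 \<in> {s..t}" "\<forall>\<tau>\<in>{s..t}. L \<tau> \<le> L \<tau>1"
      using continuous_attains_sup[OF compact_Icc ne L_cont] by blast
    have k: "\<kappa> * (exp l)\<^sup>2 < 1" if "l \<in> {L \<tau>0..L \<tau>1}" for l
      using kappa_sq_less_1_mono[of "exp l" "exp (L \<tau>1)" \<kappa>] rad_bound[OF inM[OF t1(1)]] rad[OF t1(1)] that by auto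
    have "\<exists>B. B-lipschitz_on {s..t} (\<lambda>\<tau>. atn \<kappa> (exp (L \<tau>)))"
    proof (rule lipschitz_compose_C1[OF L_lip _ atn_exp[OF k]])
      show "L ` {s..t} \<subseteq> {L \<tau>0..L \<tau>1}" using t0 t1 by auto
      have "1 - \<kappa> * (exp l)\<^sup>2 \<noteq> 0" if "l \<in> {L \<tau>0..L \<tau>1}" for l using k[OF that] by auto
      then show "continuous_on {L \<tau>0..L \<tau>1} (\<lambda>l. exp l / (1 - \<kappa> * (exp l)\<^sup>2))"
        by (intro continuous_intros) auto
    qed (assumption | erule exI)+
    then obtain B where "B-lipschitz_on {s..t} (\<lambda>\<tau>. atn \<kappa> (exp (L \<tau>)))" by blast
    then have "B-lipschitz_on {s..t} (\<lambda>\<tau>. dst (q \<tau>))"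
      by (rule lipschitz_on_transform) (simp add: dst)
    then show ?thesis by (rule that)
  qed
  define pp where "pp \<tau> = x' \<tau> / (xi (q \<tau>) * u (q \<tau>))" for \<tau>
  define ee where "ee \<tau> = e' \<tau> / (eta (q \<tau>) * v (q \<tau>))" for \<tau>
  have dP: "((\<lambda>\<tau>. ln (P (q \<tau>))) has_real_derivative pp \<tau>) (at \<tau>)" 
    and dQ: "((\<lambda>\<tau>. ln (Q (q \<tau>))) has_real_derivative ee \<tau>) (at \<tau>)" if "\<tau> \<in> {s..t} - N" for \<tau>
  proof -
    have "\<tau> \<in> {0..T} - N" using that sub by auto
    then show "((\<lambda>\<tau>. ln (P (q \<tau>))) has_real_derivative pp \<tau>) (at \<tau>)"
      "((\<lambda>\<tau>. ln (Q (q \<tau>))) has_real_derivative ee \<tau>) (at \<tau>)"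
      unfolding lnP lnQ pp_def ee_def u_def v_def
      using deriv_ln_ratio[OF n(2)] deriv_ln_ratio[OF n(3)] M_pos[OF inM[of \<tau>]] that
      by (auto simp: u_def v_def)
  qed
  have dD: "((\<lambda>\<tau>. dst (q \<tau>)) has_real_derivative
        rad (q \<tau>) / (1 - \<kappa> * (rad (q \<tau>))\<^sup>2) * ((pp \<tau> + ee \<tau>) / 2)) (at \<tau>)" if "\<tau> \<in> {s<..<t} - N" for \<tau>
  proof -
    have \<tau>: "\<tau> \<in> {s..t}" "\<tau> \<in> {s..t} - N" using that by auto
    have L': "(L has_real_derivative (pp \<tau> + ee \<tau>) / 2) (at \<tau>)"
      unfolding L_def[abs_def] using DERIV_cdivide[OF DERIV_add[OF dP[OF \<tau>(2)] dQ[OF \<tau>(2)]]] .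
    have "\<kappa> * (exp (L \<tau>))\<^sup>2 < 1" using rad_bound[OF inM[OF \<tau>(1)]] rad[OF \<tau>(1)] by simp
    from DERIV_chain2[OF atn_exp[OF this] L']
    have "((\<lambda>\<tau>. atn \<kappa> (exp (L \<tau>))) has_real_derivative
        rad (q \<tau>) / (1 - \<kappa> * (rad (q \<tau>))\<^sup>2) * ((pp \<tau> + ee \<tau>) / 2)) (at \<tau>)"
      using rad[OF \<tau>(1)] by simp
    then show ?thesis
      by (rule has_field_derivative_transform_within_open[where S="{s<..<t}"]) (use that dst in auto)
  qed
  have pos: "pp \<tau> \<ge> 0 \<and> ee \<tau> \<ge> 0" if "\<tau> \<in> {s..t} - N" for \<tau>
    using n(4,5)[of \<tau>] M_pos[OF inM[of \<tau>]] that sub by (auto simp: pp_def ee_def)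
  have sp: "speed q \<tau> = rad (q \<tau>) / (1 - \<kappa> * (rad (q \<tau>))\<^sup>2) * sqrt (pp \<tau> * ee \<tau>)" if "\<tau> \<in> {s..t} - N" for \<tau>
  proof -
    note z = M_pos[OF inM[of \<tau>]]
    let ?q = "q \<tau>"
    have uv0: "u ?q * v ?q > 0" using z that by auto
    have s: "snd ?q = u ?q * v ?q * (1 - \<kappa> * (rad ?q)\<^sup>2)"
      using snd_eq_PQ[of ?q] z rad_sq[OF inM[of \<tau>]] that by simp
    have "P ?q * Q ?q * (pp \<tau> * ee \<tau>) = x' \<tau> * e' \<tau> / (u ?q * v ?q)\<^sup>2"
      using z that by (simp add: P_def Q_def pp_def ee_def power2_eq_square)
    then have "rad ?q * sqrt (pp \<tau> * ee \<tau>) = sqrt (x' \<tau> * e' \<tau>) / (u ?q * v ?q)"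
      using uv0 unfolding rad_def real_sqrt_mult[symmetric] 
      by (simp only: real_sqrt_divide real_sqrt_abs abs_of_pos)
    then show ?thesis using n(6)[of \<tau>] that sub s by auto
  qed
  show ?thesis by (rule that[of N pp ee B1 B2 B3]) (use n(1) inM dP dQ dD pos sp B1 B2 B3 in blast)+
qed

text \<open>
  The inequality of arithmetic and geometric mean, integrated. It says that \<open>dst\<close> calibrates the rays.
\<close>

lemma length_le_dst_diff:
  assumes c: "future_curve A q T" "0 \<le> s" "s \<le> t" "t \<le> T" and M: "q s \<in> M" "q t \<in> M"
    and int: "speed q integrable_on {s..t}"
  shows "integral {s..t} (speed q) \<le> dst (q t) - dst (q s)"
proof -
  obtain N p' e' B1 B2 B3 where n: "negligible N"
    "\<forall>\<tau>\<in>{s..t}. q \<tau> \<in> M"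
    "\<forall>\<tau>\<in>{s..t} - N. ((\<lambda>\<tau>. ln (P (q \<tau>))) has_real_derivative p' \<tau>) (at \<tau>)"
    "\<forall>\<tau>\<in>{s..t} - N. ((\<lambda>\<tau>. ln (Q (q \<tau>))) has_real_derivative e' \<tau>) (at \<tau>)"
    "\<forall>\<tau>\<in>{s<..<t} - N. ((\<lambda>\<tau>. dst (q \<tau>)) has_real_derivative
        rad (q \<tau>) / (1 - \<kappa> * (rad (q \<tau>))\<^sup>2) * ((p' \<tau> + e' \<tau>) / 2)) (at \<tau>)"
    "\<forall>\<tau>\<in>{s..t} - N. p' \<tau> \<ge> 0 \<and> e' \<tau> \<ge> 0"
    "\<forall>\<tau>\<in>{s..t} - N.
        speed q \<tau> = rad (q \<tau>) / (1 - \<kappa> * (rad (q \<tau>))\<^sup>2) * sqrt (p' \<tau> * e' \<tau>)"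
    "B1-lipschitz_on {s..t} (\<lambda>\<tau>. ln (P (q \<tau>)))" "B2-lipschitz_on {s..t} (\<lambda>\<tau>. ln (Q (q \<tau>)))"
    "B3-lipschitz_on {s..t} (\<lambda>\<tau>. dst (q \<tau>))"
    by (rule log_coords_along_curve[OF c M])
  note n = n[rule_format]
  show ?thesis
  proof (rule integral_le_lipschitz_increment[OF c(3) n(10) n(1) n(5) _ int])
    fix \<tau> assume \<tau>: "\<tau> \<in> {s<..<t} - N"
    then have \<tau>': "\<tau> \<in> {s..t} - N" "\<tau> \<in> {s..t}" by auto
    show "speed q \<tau> \<le> rad (q \<tau>) / (1 - \<kappa> * (rad (q \<tau>))\<^sup>2) * ((p' \<tau> + e' \<tau>) / 2)"
      unfolding n(7)[OF \<tau>'(1)]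
      using M_pos(9)[OF n(2)[OF \<tau>'(2)]] rad_bound[OF n(2)[OF \<tau>'(2)]] n(6)[OF \<tau>'(1)]
      by (intro mult_left_mono arith_geo_mean_sqrt) auto
  qed auto
qed

text \<open>
  If \<open>dst\<close> grows at unit rate along a curve of unit speed, the arithmetic and the geometric mean of the
  derivatives of \<open>ln P\<close> and \<open>ln Q\<close> agree. Then these derivatives agree, and \<open>ln Q - ln P\<close> is constant.
\<close>

lemma rapidity_const:
  assumes c: "future_curve A q T" "0 \<le> s" "s \<le> t" "t \<le> T" and M: "q s \<in> M" "q t \<in> M"
    and dst: "\<And>\<tau>. \<tau> \<in> {s..t} \<Longrightarrow> dst (q \<tau>) = \<tau>"
    and N0: "negligible N0" "\<And>\<tau>. \<tau> \<in> {s..t} - N0 \<Longrightarrow> speed q \<tau> = 1"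
  shows "rapidity (q t) = rapidity (q s)"
proof -
  obtain N p' e' B1 B2 B3 where n: "negligible N"
    "\<forall>\<tau>\<in>{s..t}. q \<tau> \<in> M"
    "\<forall>\<tau>\<in>{s..t} - N. ((\<lambda>\<tau>. ln (P (q \<tau>))) has_real_derivative p' \<tau>) (at \<tau>)"
    "\<forall>\<tau>\<in>{s..t} - N. ((\<lambda>\<tau>. ln (Q (q \<tau>))) has_real_derivative e' \<tau>) (at \<tau>)"
    "\<forall>\<tau>\<in>{s<..<t} - N. ((\<lambda>\<tau>. dst (q \<tau>)) has_real_derivative
        rad (q \<tau>) / (1 - \<kappa> * (rad (q \<tau>))\<^sup>2) * ((p' \<tau> + e' \<tau>) / 2)) (at \<tau>)"
    "\<forall>\<tau>\<in>{s..t} - N. p' \<tau> \<ge> 0 \<and> e' \<tau> \<ge> 0"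
    "\<forall>\<tau>\<in>{s..t} - N.
        speed q \<tau> = rad (q \<tau>) / (1 - \<kappa> * (rad (q \<tau>))\<^sup>2) * sqrt (p' \<tau> * e' \<tau>)"
    "B1-lipschitz_on {s..t} (\<lambda>\<tau>. ln (P (q \<tau>)))" "B2-lipschitz_on {s..t} (\<lambda>\<tau>. ln (Q (q \<tau>)))"
    "B3-lipschitz_on {s..t} (\<lambda>\<tau>. dst (q \<tau>))"
    by (rule log_coords_along_curve[OF c M])
  note n = n[rule_format]
  have "ln (Q (q t)) - ln (P (q t)) = ln (Q (q s)) - ln (P (q s))"
  proof (rule lipschitz_deriv_eq_0_imp_const[OF c(3) lipschitz_on_diff[OF n(9) n(8)] negligible_Un[OF n(1) N0(1)]])
    fix \<tau> assume \<tau>: "\<tau> \<in> {s<..<t} - (N \<union> N0)"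
    then have \<tau>': "\<tau> \<in> {s..t} - N" "\<tau> \<in> {s..t}" "\<tau> \<in> {s<..<t} - N" "\<tau> \<in> {s..t} - N0" by auto
    let ?r = "rad (q \<tau>) / (1 - \<kappa> * (rad (q \<tau>))\<^sup>2)"
    have r: "?r > 0" using M_pos(9)[OF n(2)[OF \<tau>'(2)]] rad_bound[OF n(2)[OF \<tau>'(2)]] by simp
    have "((\<lambda>\<tau>. \<tau>) has_real_derivative ?r * ((p' \<tau> + e' \<tau>) / 2)) (at \<tau>)"
      by (rule has_field_derivative_transform_within_open[OF n(5)[OF \<tau>'(3)], where S="{s<..<t}"])
        (use \<tau> dst in auto)
    then have "?r * ((p' \<tau> + e' \<tau>) / 2) = 1" using DERIV_ident DERIV_unique by blast
    also have "1 = ?r * sqrt (p' \<tau> * e' \<tau>)"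
      unfolding n(7)[OF \<tau>'(1), symmetric] by (rule N0(2)[OF \<tau>'(4), symmetric])
    finally have e: "(p' \<tau> + e' \<tau>) / 2 = sqrt (p' \<tau> * e' \<tau>)"
      using r by (metis less_irrefl mult_left_cancel)
    have "((p' \<tau> + e' \<tau>) / 2)\<^sup>2 = p' \<tau> * e' \<tau>"
      unfolding e using n(6)[OF \<tau>'(1)] by simp
    then have "(e' \<tau> - p' \<tau>)\<^sup>2 = 0" by (simp add: power2_eq_square field_simps)
    then have "e' \<tau> - p' \<tau> = 0" by simp
    then show "((\<lambda>\<tau>. ln (Q (q \<tau>)) - ln (P (q \<tau>))) has_real_derivative 0) (at \<tau>)"
      using DERIV_diff[OF n(4)[OF \<tau>'(1)] n(3)[OF \<tau>'(1)]] by simp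
  qed
  then show ?thesis by (simp add: rapidity_def)
qed

text \<open>
  As \<open>\<xi>\<close> and \<open>\<eta>\<close> are monotone along the curve, one of them vanishes up to time \<open>t\<close>, and the speed
  vanishes with its derivative.
\<close>

lemma speed_0_on_cone:
  assumes c: "future_curve A q T" "q 0 = aff_id" "0 \<le> t" "t \<le> T" and z: "xi (q t) = 0 \<or> eta (q t) = 0"
  obtains N where "negligible N" "\<And>\<tau>. \<tau> \<in> {0..t} - N \<Longrightarrow> speed q \<tau> = 0"
proof -
  obtain N x' e' B B' where n: "negligible N"
    "\<forall>t\<in>{0..T} - N. ((\<lambda>t. xi (q t)) has_real_derivative x' t) (at t)"
    "\<forall>t\<in>{0..T} - N. ((\<lambda>t. eta (q t)) has_real_derivative e' t) (at t)"
    "\<forall>t\<in>{0..T} - N. x' t \<ge> 0" "\<forall>t\<in>{0..T} - N. e' t \<ge> 0"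
    "\<forall>t\<in>{0..T} - N. speed q t = sqrt (x' t * e' t) / snd (q t)"
    "B-lipschitz_on {0..T} (\<lambda>t. xi (q t))" "B'-lipschitz_on {0..T} (\<lambda>t. eta (q t))"
    by (rule future_curve_nullE[OF c(1)])
  note n = n[rule_format]
  have const: "d = 0" if "(f has_real_derivative d) (at \<tau>)" "\<tau> \<in> {0<..<t}" "\<And>\<sigma>. \<sigma> \<in> {0..t} \<Longrightarrow> f \<sigma> = 0"
    for f :: "real \<Rightarrow> real" and d \<tau>
  proof -
    have "((\<lambda>_. 0) has_real_derivative d) (at \<tau>)"
      by (rule has_field_derivative_transform_within_open[OF that(1), where S="{0<..<t}"])
        (use that(2,3) in auto)
    then show ?thesis using DERIV_const DERIV_unique by blast
  qed
  have mono: "0 \<le> xi (q \<sigma>)" "xi (q \<sigma>) \<le> xi (q t)" "0 \<le> eta (q \<sigma>)" "eta (q \<sigma>) \<le> eta (q t)" if "\<sigma> \<in> {0..t}" for \<sigma>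
    using future_curve_mono[OF c(1), of 0 \<sigma>] future_curve_mono[OF c(1), of \<sigma> t] that c by auto
  have "speed q \<tau> = 0" if "\<tau> \<in> {0..t} - (N \<union> {0, t})" for \<tau>
  proof -
    have t: "\<tau> \<in> {0<..<t}" "\<tau> \<in> {0..T} - N" using that c by auto
    from z have "x' \<tau> = 0 \<or> e' \<tau> = 0"
    proof
      assume "xi (q t) = 0"
      then have "xi (q \<sigma>) = 0" if "\<sigma> \<in> {0..t}" for \<sigma> using mono[OF that] by auto
      from const[of "\<lambda>t. xi (q t)", OF n(2)[OF t(2)] t(1) this] show ?thesis by simp
    next
      assume "eta (q t) = 0"
      then have "eta (q \<sigma>) = 0" if "\<sigma> \<in> {0..t}" for \<sigma> using mono[OF that] by auto
      from const[of "\<lambda>t. eta (q t)", OF n(3)[OF t(2)] t(1) this] show ?thesis by simp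
    qed
    then show ?thesis using n(6)[OF t(2)] by auto
  qed
  moreover have "negligible (N \<union> {0, t})" using n(1) by (intro negligible_Un) auto
  ultimately show ?thesis using that by blast
qed

text \<open>
  A curve from the identity into \<open>M\<close> runs on the light cone for an initial time, possibly \<open>0\<close>, and then
  stays in \<open>M\<close>. The time \<open>s\<close> is the last zero of \<open>\<xi> \<eta>\<close>.
\<close>

lemma cone_exit_time:
  assumes c: "future_curve A q T" "q 0 = aff_id" and M: "q T \<in> M"
  obtains s where "0 \<le> s" "s < T" "xi (q s) = 0 \<or> eta (q s) = 0" "\<And>t. t \<in> {s<..T} \<Longrightarrow> q t \<in> M"
proof -
  obtain N x' e' B B' where n: "negligible N"
    "\<forall>t\<in>{0..T} - N. ((\<lambda>t. xi (q t)) has_real_derivative x' t) (at t)"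
    "\<forall>t\<in>{0..T} - N. ((\<lambda>t. eta (q t)) has_real_derivative e' t) (at t)"
    "\<forall>t\<in>{0..T} - N. x' t \<ge> 0" "\<forall>t\<in>{0..T} - N. e' t \<ge> 0"
    "\<forall>t\<in>{0..T} - N. speed q t = sqrt (x' t * e' t) / snd (q t)"
    "B-lipschitz_on {0..T} (\<lambda>t. xi (q t))" "B'-lipschitz_on {0..T} (\<lambda>t. eta (q t))"
    by (rule future_curve_nullE[OF c(1)])
  note n = n[rule_format]
  have T: "0 \<le> T" using c by (auto simp: future_curve_def)
  define Z where "Z = {t \<in> {0..T}. xi (q t) * eta (q t) = 0}"
  have "continuous_on {0..T} (\<lambda>t. xi (q t) * eta (q t))"
    by (intro continuous_on_mult lipschitz_on_continuous_on[OF n(7)] lipschitz_on_continuous_on[OF n(8)])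
  then have "closed Z" unfolding Z_def by (rule continuous_closed_preimage_constant) auto
  moreover have "0 \<in> Z" using T c by (auto simp: Z_def)
  moreover have bdd: "bdd_above Z" unfolding Z_def by (rule bdd_aboveI[of _ T]) auto
  ultimately have s: "Sup Z \<in> Z" by (intro closed_contains_Sup) auto
  have "T \<notin> Z" using M_pos[OF M] by (auto simp: Z_def)
  then have "Sup Z < T" using s by (cases "Sup Z = T") (auto simp: Z_def)
  moreover have "q t \<in> M" if t: "t \<in> {Sup Z<..T}" for t
  proof -
    have tT: "0 \<le> t" "t \<le> T" using t s by (auto simp: Z_def)
    have "t \<notin> Z" using cSup_upper[OF _ bdd, of t] t by auto
    then have "xi (q t) \<noteq> 0" "eta (q t) \<noteq> 0" using tT by (auto simp: Z_def)
    moreover have "0 \<le> xi (q t)" "0 \<le> eta (q t)" "xi (q t) \<le> xi (q T)" "eta (q t) \<le> eta (q T)"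
      using future_curve_mono[OF c(1), of 0 t] future_curve_mono[OF c(1), of t T] tT c by auto
    ultimately show ?thesis
      using c tT by (intro M_below[OF M]) (auto simp: future_curve_def image_subset_iff)
  qed
  ultimately show ?thesis using that s by (auto simp: Z_def)
qed

text \<open>
  The part on the light cone has length \<open>0\<close>. For the rest, \<open>length_le_dst_diff\<close> applies on \<open>{x..T}\<close> for
  all \<open>x > s\<close>, and the integral is continuous in its lower limit \<open>x\<close>. If the speed is not integrable, its
  integral is \<open>0\<close> by convention and the inequality holds trivially.
\<close>

lemma length_le_dst:
  assumes c: "future_curve A q T" "q 0 = aff_id" and M: "q T \<in> M"
  shows "integral {0..T} (speed q) \<le> dst (q T)"
proof (cases "speed q integrable_on {0..T}")
  case False
  then show ?thesis using dst_pos[OF M] by (simp add: not_integrable_integral)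
next
  case int: True
  obtain s where s: "0 \<le> s" "s < T" "xi (q s) = 0 \<or> eta (q s) = 0" "\<And>t. t \<in> {s<..T} \<Longrightarrow> q t \<in> M"
    using cone_exit_time[OF c M] by blast
  have int': "speed q integrable_on {s..T}"
    by (rule integrable_subinterval_real[OF int]) (use s in auto)
  obtain N where "negligible N" "\<And>\<tau>. \<tau> \<in> {0..s} - N \<Longrightarrow> speed q \<tau> = 0"
    using speed_0_on_cone[OF c s(1) _ s(3)] s by auto
  then have "(speed q has_integral 0) {0..s}"
    by (intro has_integral_spike[of N _ "speed q" "\<lambda>_. 0"]) auto
  then have 0: "integral {0..s} (speed q) = 0" by (rule integral_unique)
  have "integral {s..T} (speed q) \<le> dst (q T)"
  proof (rule tendsto_upperbound)
    have "continuous_on {s..T} (\<lambda>x. integral {x..T} (speed q))"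
      by (rule indefinite_integral_continuous_1'[OF int'])
    then have "((\<lambda>x. integral {x..T} (speed q)) \<longlongrightarrow> integral {s..T} (speed q)) (at s within {s..T})"
      using s by (auto simp: continuous_on)
    then show "((\<lambda>x. integral {x..T} (speed q)) \<longlongrightarrow> integral {s..T} (speed q)) (at_right s)"
      using s by (simp add: at_within_Icc_at_right)
    show "\<forall>\<^sub>F x in at_right s. integral {x..T} (speed q) \<le> dst (q T)"
      unfolding eventually_at_right[OF s(2)]
    proof (intro exI conjI allI impI)
      fix x assume x: "x > s" "x < T"
      have "integral {x..T} (speed q) \<le> dst (q T) - dst (q x)"
        by (rule length_le_dst_diff[OF c(1)])
          (use x s M in \<open>auto intro: integrable_subinterval_real[OF int']\<close>)
      also have "\<dots> \<le> dst (q T)" using dst_pos[of "q x"] s(4)[of x] x by simp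
      finally show "integral {x..T} (speed q) \<le> dst (q T)" .
    qed (use s in auto)
  qed simp
  moreover have "integral {0..T} (speed q) = integral {0..s} (speed q) + integral {s..T} (speed q)"
    using Henstock_Kurzweil_Integration.integral_combine[OF s(1) _ int] s by simp
  ultimately show ?thesis using 0 by simp
qed

lemma lor_length_speed: "lor_length A q T = integral {0..T} (speed q)"
  by (simp add: lor_length_def speed_def[abs_def])

text \<open>
  The two pieces of the curve before and after time \<open>t\<close> have lengths \<open>t\<close> and \<open>T - t\<close>. The calibration
  inequality for both of them pins down \<open>dst (q t) = t\<close>, and then \<open>rapidity_const\<close> applies.
\<close>

lemma unit_speed_maximizer_is_radial:
  assumes c: "future_curve A q T" "q 0 = aff_id" "arclength_param A q T" and M: "q T \<in> M"
    and T: "dst (q T) \<le> T" and t: "t \<in> {0<..T}"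
  shows "q t \<in> M" "dst (q t) = t" "rapidity (q t) = rapidity (q T)"
proof -
  obtain N where N: "negligible N" "\<And>t. t \<in> {0..T} - N \<Longrightarrow> speed q t = 1"
  proof -
    have "AE t in lebesgue. t \<in> {0..T} \<longrightarrow> speed q t = 1"
      using c(3) unfolding arclength_param_def
      by (subst (asm) AE_restrict_space_iff) (auto simp: speed_def elim: eventually_mono)
    then show ?thesis using that unfolding eventually_ae_filter_negligible by blast
  qed
  have int: "(speed q has_integral (b - a)) {a..b}" if "0 \<le> a" "a \<le> b" "b \<le> T" for a b
    by (rule has_integral_spike[OF N(1), of _ _ "\<lambda>_. 1"])
      (use that N(2) has_integral_const_real[of "1::real" a b] in auto)
  obtain s where s: "0 \<le> s" "s < T" "xi (q s) = 0 \<or> eta (q s) = 0" "\<And>t. t \<in> {s<..T} \<Longrightarrow> q t \<in> M"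
    using cone_exit_time[OF c(1,2) M] by blast
  \<comment> \<open>A curve of unit speed leaves the light cone at once, since the speed is \<open>0\<close> there.\<close>
  have "s = 0"
  proof (rule ccontr)
    assume "s \<noteq> 0"
    then have s0: "0 < s" using s by simp
    obtain N' where N': "negligible N'" "\<And>\<tau>. \<tau> \<in> {0..s} - N' \<Longrightarrow> speed q \<tau> = 0"
      using speed_0_on_cone[OF c(1,2) s(1) _ s(3)] s by auto
    have "(speed q has_integral 0) {0..s}"
      by (intro has_integral_spike[of N' _ "speed q" "\<lambda>_. 0"]) (use N' in auto)
    from has_integral_unique[OF this int[of 0 s]] show False using s s0 by simp
  qed
  then have inM: "q t \<in> M" if "t \<in> {0<..T}" for t using s(4) that by simp
  have dst: "dst (q t) = t" if t: "t \<in> {0<..T}" for t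
  proof (rule antisym)
    have "integral {t..T} (speed q) \<le> dst (q T) - dst (q t)"
      by (rule length_le_dst_diff[OF c(1) _ _ _ inM[OF t] M])
        (use t int[of t T] in \<open>auto intro: has_integral_integrable\<close>)
    then show "dst (q t) \<le> t" using integral_unique[OF int[of t T]] t T by simp
    have "integral {0..t} (speed q) \<le> dst (q t)"
      by (rule length_le_dst[OF future_curve_restrict[OF c(1)] c(2) inM[OF t]]) (use t in auto)
    then show "t \<le> dst (q t)" using integral_unique[OF int[of 0 t]] t by simp
  qed
  show "q t \<in> M" "dst (q t) = t" using inM dst t by auto
  show "rapidity (q t) = rapidity (q T)"
    by (rule rapidity_const[OF c(1) _ _ _ inM M, symmetric, of t N]) (use t dst N in auto)
qed

section \<open>Extremals are radial\<close>

lemma velocity_components: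
  assumes "q \<in> Aff"
  shows "v1 A q (c *\<^sub>R Y1 A q + s *\<^sub>R Y2 A q) = c" "v2 A q (c *\<^sub>R Y1 A q + s *\<^sub>R Y2 A q) = s"
proof -
  define r where "r = 1 / det A"
  have r: "r * (A$1$1 * A$2$2 - A$1$2 * A$2$1) = 1" using det_pos unfolding r_def det_A by simp
  have inv: "al A = A$2$2 * r" "be A = - A$1$2 * r" "ga A = - A$2$1 * r" "de A = A$1$1 * r"
    by (auto simp: inv_entries r_def)
  have "frame_coords q (c *\<^sub>R Y1 A q + s *\<^sub>R Y2 A q) = vector [c * al A + s * be A, c * ga A + s * de A]"
    using assms by (simp add: frame_coords_def Y1_def Y2_def X1_def X2_def Aff_def vec_eq_iff forall_2 field_simps)
  then have "v1 A q (c *\<^sub>R Y1 A q + s *\<^sub>R Y2 A q) = r * (A$1$1 * A$2$2 - A$1$2 * A$2$1) * c"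
    "v2 A q (c *\<^sub>R Y1 A q + s *\<^sub>R Y2 A q) = r * (A$1$1 * A$2$2 - A$1$2 * A$2$1) * s"
    by (simp_all add: v1_def v2_def matrix_vector_mult_def sum_2 inv algebra_simps)
  then show "v1 A q (c *\<^sub>R Y1 A q + s *\<^sub>R Y2 A q) = c" "v2 A q (c *\<^sub>R Y1 A q + s *\<^sub>R Y2 A q) = s"
    using r by simp_all
qed

lemma psi_equation_null: "de A * cosh x + ga A * sinh x = m * exp x - k * exp (- x)"
  by (simp add: m_def k_def cosh_def sinh_def field_simps)

lemma extremal_derivs:
  assumes "extremal_on A \<psi>0 I \<psi> q" "t \<in> I"
  shows "((\<lambda>t. xi (q t)) has_real_derivative snd (q t) * exp (- \<psi> t)) (at t)"
    "((\<lambda>t. eta (q t)) has_real_derivative snd (q t) * exp (\<psi> t)) (at t)"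
    "(\<psi> has_real_derivative m * exp (\<psi> t) - k * exp (- \<psi> t)) (at t)"
    "snd (q t) > 0"
proof -
  have q: "q t \<in> Aff" "(\<psi> has_real_derivative de A * cosh (\<psi> t) + ga A * sinh (\<psi> t)) (at t)"
    "(q has_vector_derivative cosh (\<psi> t) *\<^sub>R Y1 A (q t) + sinh (\<psi> t) *\<^sub>R Y2 A (q t)) (at t)"
    using assms by (auto simp: extremal_on_def)
  show "(\<psi> has_real_derivative m * exp (\<psi> t) - k * exp (- \<psi> t)) (at t)"
    using q(2) unfolding psi_equation_null .
  show "snd (q t) > 0" using q(1) by (simp add: Aff_def)
  show "((\<lambda>t. xi (q t)) has_real_derivative snd (q t) * exp (- \<psi> t)) (at t)"
    "((\<lambda>t. eta (q t)) has_real_derivative snd (q t) * exp (\<psi> t)) (at t)"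
    using null_derivatives[OF q(3,1)] by (simp_all add: velocity_components[OF q(1)] cosh_minus_sinh cosh_plus_sinh)
qed

text \<open>
  The metric has constant curvature, hence three independent Killing fields, and each of them gives a
  first integral. The fields are the boost \<open>Q \<partial>\<^sub>Q - P \<partial>\<^sub>P\<close> and the transvections \<open>\<partial>\<^sub>P - \<kappa> Q\<^sup>2 \<partial>\<^sub>Q\<close> and
  \<open>\<partial>\<^sub>Q - \<kappa> P\<^sup>2 \<partial>\<^sub>P\<close>, written in the coordinates \<open>\<xi>\<close>, \<open>\<eta>\<close> to avoid divisions by \<open>u\<close> and \<open>v\<close>, whose
  sign is not yet known along the extremal.
\<close>

lemma extremal_first_integrals:
  assumes ext: "extremal_on A \<psi>0 I \<psi> q" and t: "t \<in> I"
  shows "xi (q t) * u (q t) * exp (\<psi> t) = eta (q t) * v (q t) * exp (- \<psi> t)"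
    "exp (\<psi> t) * (u (q t))\<^sup>2 - \<kappa> * (eta (q t))\<^sup>2 * exp (- \<psi> t) = exp \<psi>0 * snd (q t)"
    "exp (- \<psi> t) * (v (q t))\<^sup>2 - \<kappa> * (xi (q t))\<^sup>2 * exp (\<psi> t) = exp (- \<psi>0) * snd (q t)"
proof -
  define x e y E F where "x t = xi (q t)" and "e t = eta (q t)" and "y t = snd (q t)"
    and "E t = exp (\<psi> t)" and "F t = exp (- \<psi> t)" for t
  have I: "open I" "convex I" "0 \<in> I" "q 0 = aff_id" "\<psi> 0 = \<psi>0"
    using ext by (auto simp: extremal_on_def is_interval_convex_1)
  have y: "y t = 1 + k * x t + m * e t" for t using snd_eq by (simp add: x_def e_def y_def)
  have EF: "E t * F t = 1" for t by (simp add: E_def F_def exp_minus)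
  have d: "(x has_real_derivative y t * F t) (at t)" "(e has_real_derivative y t * E t) (at t)"
    "(E has_real_derivative m * (E t)\<^sup>2 - k) (at t)" "(F has_real_derivative k * (F t)\<^sup>2 - m) (at t)"
    "y t > 0" if "t \<in> I" for t
  proof -
    note * = extremal_derivs[OF ext that]
    show "(x has_real_derivative y t * F t) (at t)" "(e has_real_derivative y t * E t) (at t)" "y t > 0"
      using * by (simp_all add: x_def[abs_def] e_def[abs_def] y_def E_def F_def)
    have "(E has_real_derivative E t * (m * E t - k * F t)) (at t)"
      "(F has_real_derivative F t * - (m * E t - k * F t)) (at t)"
      unfolding E_def[abs_def] F_def[abs_def] using *(3) by (auto intro!: derivative_eq_intros)
    moreover have "E t * (m * E t - k * F t) = m * (E t)\<^sup>2 - k * (E t * F t)"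
      "F t * - (m * E t - k * F t) = k * (F t)\<^sup>2 - m * (E t * F t)"
      by (simp_all add: power2_eq_square algebra_simps)
    ultimately show "(E has_real_derivative m * (E t)\<^sup>2 - k) (at t)" "(F has_real_derivative k * (F t)\<^sup>2 - m) (at t)"
      by (simp_all add: EF)
  qed
  have dy: "(y has_real_derivative y t * (k * F t + m * E t)) (at t)" if "t \<in> I" for t
    unfolding y[abs_def] using d[OF that] y[of t]
    by (auto intro!: derivative_eq_intros simp: algebra_simps)
  \<comment> \<open>\<open>y\<close> solves the linear equation \<open>n' = n (k F + m E)\<close>, so each solution is a multiple of \<open>y\<close>.\<close>
  have const: "n t = n 0 / y 0 * y t"
    if n: "\<And>t. t \<in> I \<Longrightarrow> (n has_real_derivative n t * (k * F t + m * E t)) (at t)" for n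
  proof -
    have "\<exists>c. \<forall>t\<in>I. n t / y t = c"
    proof (rule has_field_derivative_zero_constant[OF I(2)])
      fix t assume t: "t \<in> I"
      have "((\<lambda>t. n t / y t) has_real_derivative 0) (at t)"
        using d(5)[OF t] by (auto intro!: derivative_eq_intros n[OF t] dy[OF t] simp: field_simps)
      then show "((\<lambda>t. n t / y t) has_real_derivative 0) (at t within I)"
        by (rule has_field_derivative_at_within)
    qed
    then have "n t / y t = n 0 / y 0" using t I(3) by auto
    then show ?thesis using d(5)[OF t] by (simp add: field_simps)
  qed
  have 0: "x 0 = 0" "e 0 = 0" "y 0 = 1" "E 0 = exp \<psi>0" "F 0 = exp (- \<psi>0)"
    using I(4,5) by (auto simp: x_def e_def y_def E_def F_def aff_id_def)
      (auto simp: aff_id_def[symmetric])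
  note der = derivative_eq_intros
  have "x t * (1 + k * x t) * E t - e t * (1 + m * e t) * F t = 0"
  proof -
    have "((\<lambda>t. x t * (1 + k * x t) * E t - e t * (1 + m * e t) * F t) has_real_derivative
        (x t * (1 + k * x t) * E t - e t * (1 + m * e t) * F t) * (k * F t + m * E t)) (at t)"
      if t: "t \<in> I" for t
      by (rule DERIV_cong, (rule der d[OF t] refl)+) (use EF[of t] y[of t] in algebra)
    from const[OF this] show ?thesis by (simp add: 0)
  qed
  then show "xi (q t) * u (q t) * exp (\<psi> t) = eta (q t) * v (q t) * exp (- \<psi> t)"
    by (simp add: x_def e_def E_def F_def u_def v_def)
  have "E t * (1 + k * x t)\<^sup>2 - k * m * (e t)\<^sup>2 * F t = exp \<psi>0 * y t"
  proof -
    have "((\<lambda>t. E t * (1 + k * x t)\<^sup>2 - k * m * (e t)\<^sup>2 * F t) has_real_derivative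
        (E t * (1 + k * x t)\<^sup>2 - k * m * (e t)\<^sup>2 * F t) * (k * F t + m * E t)) (at t)"
      if t: "t \<in> I" for t unfolding power2_eq_square
      by (rule DERIV_cong, (rule der d[OF t] refl)+) (use EF[of t] y[of t] in algebra)
    from const[OF this] show ?thesis by (simp add: 0)
  qed
  then show "exp (\<psi> t) * (u (q t))\<^sup>2 - \<kappa> * (eta (q t))\<^sup>2 * exp (- \<psi> t) = exp \<psi>0 * snd (q t)"
    by (simp add: x_def e_def E_def F_def u_def v_def y_def \<kappa>_def)
  have "F t * (1 + m * e t)\<^sup>2 - k * m * (x t)\<^sup>2 * E t = exp (- \<psi>0) * y t"
  proof -
    have "((\<lambda>t. F t * (1 + m * e t)\<^sup>2 - k * m * (x t)\<^sup>2 * E t) has_real_derivative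
        (F t * (1 + m * e t)\<^sup>2 - k * m * (x t)\<^sup>2 * E t) * (k * F t + m * E t)) (at t)"
      if t: "t \<in> I" for t unfolding power2_eq_square
      by (rule DERIV_cong, (rule der d[OF t] refl)+) (use EF[of t] y[of t] in algebra)
    from const[OF this] show ?thesis by (simp add: 0)
  qed
  then show "exp (- \<psi> t) * (v (q t))\<^sup>2 - \<kappa> * (xi (q t))\<^sup>2 * exp (\<psi> t) = exp (- \<psi>0) * snd (q t)"
    by (simp add: x_def e_def E_def F_def u_def v_def y_def \<kappa>_def)
qed

text \<open>
  For \<open>K < 0\<close> the first integral of the boost shows that \<open>\<xi> u\<close> has the sign of \<open>\<eta> v\<close>, which is
  positive. So \<open>u\<close> cannot vanish before the extremal ends.
\<close>

lemma extremal_in_M: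
  assumes ext: "extremal_on A \<psi>0 I \<psi> q" and t: "t \<in> I" "t > 0"
  shows "q t \<in> M"
proof -
  have I: "is_interval I" "0 \<in> I" "q 0 = aff_id" using ext by (auto simp: extremal_on_def)
  have sub: "s \<in> I" if "0 \<le> s" "s \<le> t" for s
    using that I t by (metis atLeastAtMost_iff mem_is_interval_1_I)
  have x: "xi (q 0) < xi (q t)"
    by (rule DERIV_pos_imp_increasing[OF t(2)]) (use extremal_derivs[OF ext sub] in \<open>auto intro!: exI\<close>)
  have e: "eta (q 0) < eta (q t)"
    by (rule DERIV_pos_imp_increasing[OF t(2)]) (use extremal_derivs[OF ext sub] in \<open>auto intro!: exI\<close>)
  have pos: "xi (q t) > 0" "eta (q t) > 0" "snd (q t) > 0"
    using x e I extremal_derivs(4)[OF ext t(1)] by auto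
  have "u (q t) > 0 \<and> v (q t) > 0"
  proof (cases "sec_curv A < 0")
    case True
    have v: "v (q t) > 0" using M_im_negative_curvature(3)[OF True] pos by (simp add: v_def add_pos_pos)
    have "xi (q t) * u (q t) * exp (\<psi> t) > 0"
      unfolding extremal_first_integrals(1)[OF ext t(1)] using v pos by simp
    then show ?thesis using v pos by (simp add: zero_less_mult_iff)
  next
    case False
    then show ?thesis using u_v_pos_if_nonneg_curv[of "q t"] pos by auto
  qed
  then show ?thesis using pos by (simp add: M_def Aff_def)
qed

text \<open>
  The first integrals imply \<open>P e\<^bsup>\<psi>0\<^esup> = Q e\<^bsup>-\<psi>0\<^esup>\<close> and \<open>e\<^bsup>-\<psi>\<^esup> v = e\<^bsup>-\<psi>0\<^esup> u\<close>. By the second relation the common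
  value \<open>r\<close> in the first one solves \<open>r' = 1 - \<kappa> r\<^sup>2\<close>, that is, \<open>atn \<kappa> r\<close> is the time.
\<close>

lemma extremal_polar:
  assumes ext: "extremal_on A \<psi>0 I \<psi> q" and t: "t \<in> I" "t > 0"
  shows "rapidity (q t) = \<psi>0" "dst (q t) = t"
proof -
  have I: "is_interval I" "0 \<in> I" "q 0 = aff_id" "\<psi> 0 = \<psi>0" using ext by (auto simp: extremal_on_def)
  have sub: "s \<in> I" if "0 \<le> s" "s \<le> t" for s
    using that I t by (metis atLeastAtMost_iff mem_is_interval_1_I)
  have e1: "exp (\<psi> s) * exp (- \<psi> s) = 1" for s by (simp add: exp_minus)
  have key: "u (q s) > 0" "v (q s) > 0" "P (q s) * exp \<psi>0 = Q (q s) * exp (- \<psi>0)"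
    "exp (- \<psi> s) * v (q s) = exp (- \<psi>0) * u (q s)"
    if s: "0 \<le> s" "s \<le> t" for s
  proof -
    have "u (q s) > 0 \<and> v (q s) > 0 \<and> P (q s) * exp \<psi>0 = Q (q s) * exp (- \<psi>0) \<and>
      exp (- \<psi> s) * v (q s) = exp (- \<psi>0) * u (q s)"
    proof (cases "s = 0")
      case True
      then show ?thesis using I by (simp add: u_def v_def P_def Q_def)
    next
      case False
      then have s0: "s > 0" using s by simp
      note M = M_pos[OF extremal_in_M[OF ext sub[OF s] s0]]
      define x e uu vv y E F where "x = xi (q s)" and "e = eta (q s)" and "uu = u (q s)" and "vv = v (q s)"
        and "y = snd (q s)" and "E = exp (\<psi> s)" and "F = exp (- \<psi> s)"
      note defs = this
      note J = extremal_first_integrals[OF ext sub[OF s], folded defs]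
      have pos: "x > 0" "e > 0" "uu > 0" "vv > 0" "y > 0" "E > 0" "F > 0"
        using M by (auto simp: defs)
      have EF: "E * F = 1" by (simp add: defs exp_minus)
      \<comment> \<open>The two transvection integrals are compared by means of the boost integral.\<close>
      have "y * (e * uu * exp (- \<psi>0)) = e * uu * (F * vv\<^sup>2 - \<kappa> * x\<^sup>2 * E)" by (simp add: J(3))
      also have "\<dots> = x * vv * (E * uu\<^sup>2 - \<kappa> * e\<^sup>2 * F)" using J(1) by algebra
      also have "\<dots> = y * (x * vv * exp \<psi>0)" by (simp add: J(2))
      finally have eu: "e * uu * exp (- \<psi>0) = x * vv * exp \<psi>0" using pos by simp
      have "(F * vv)\<^sup>2 * e = (F * (exp \<psi>0 * exp (- \<psi>0)) * vv)\<^sup>2 * e" by (simp add: exp_minus)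
      also have "\<dots> = (exp (- \<psi>0) * uu)\<^sup>2 * e"
      proof -
        have "x * uu = e * vv * F * F"
        proof -
          have "x * uu = x * uu * E * F" using EF by (simp add: mult.assoc)
          then show ?thesis using J(1) by simp
        qed
        have ee: "exp \<psi>0 * exp (- \<psi>0) = 1" by (simp add: exp_minus)
        have "(F * vv)\<^sup>2 * e = vv * (x * uu)" unfolding \<open>x * uu = _\<close> by (simp add: power2_eq_square)
        also have "\<dots> = (x * vv * exp \<psi>0) * uu * exp (- \<psi>0)" using ee by algebra
        also have "\<dots> = (exp (- \<psi>0) * uu)\<^sup>2 * e" unfolding eu[symmetric] by (simp add: power2_eq_square)
        finally show ?thesis using ee by simp
      qed
      finally have "(F * vv)\<^sup>2 = (exp (- \<psi>0) * uu)\<^sup>2" using pos by simp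
      then have F: "F * vv = exp (- \<psi>0) * uu" using pos by (simp add: power2_eq_iff_nonneg)
      have PQ: "P (q s) * exp \<psi>0 = x * vv * exp \<psi>0 / (uu * vv)" "Q (q s) * exp (- \<psi>0) = e * uu * exp (- \<psi>0) / (uu * vv)"
        using pos by (simp_all add: P_def Q_def defs)
      have "P (q s) * exp \<psi>0 = Q (q s) * exp (- \<psi>0)" unfolding PQ eu ..
      then show ?thesis using F pos unfolding defs by blast
    qed
    then show "u (q s) > 0" "v (q s) > 0" "P (q s) * exp \<psi>0 = Q (q s) * exp (- \<psi>0)"
      "exp (- \<psi> s) * v (q s) = exp (- \<psi>0) * u (q s)" by auto
  qed
  have qM: "q t \<in> M" by (rule extremal_in_M[OF ext t])
  have PQ: "Q (q t) = P (q t) * exp \<psi>0 * exp \<psi>0" using key(3)[of t] t by (simp add: exp_minus field_simps)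
  then have "ln (Q (q t)) = ln (P (q t)) + 2 * \<psi>0" using M_pos(7)[OF qM] by (simp add: ln_mult)
  then show "rapidity (q t) = \<psi>0" by (simp add: rapidity_def)
  define r where "r s = P (q s) * exp \<psi>0" for s
  have r2: "(r s)\<^sup>2 = P (q s) * Q (q s)" if "0 \<le> s" "s \<le> t" for s
  proof -
    have "(r s)\<^sup>2 = r s * (Q (q s) * exp (- \<psi>0))" using key(3)[OF that] by (simp add: r_def power2_eq_square)
    then show ?thesis by (simp add: r_def exp_minus)
  qed
  have y: "snd (q s) = u (q s) * v (q s) * (1 - \<kappa> * (r s)\<^sup>2)" if "0 \<le> s" "s \<le> t" for s
    using snd_eq_PQ[OF key(1,2)[OF that]] r2[OF that] by simp
  have r_lt: "\<kappa> * (r s)\<^sup>2 < 1" if "0 \<le> s" "s \<le> t" for s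
    using y[OF that] extremal_derivs(4)[OF ext sub[OF that]] mult_pos_pos[OF key(1,2)[OF that]]
    by (simp add: zero_less_mult_iff)
  have dr: "(r has_real_derivative 1 - \<kappa> * (r s)\<^sup>2) (at s)" if s: "0 \<le> s" "s \<le> t" for s
  proof -
    have r: "r = (\<lambda>s. xi (q s) / (1 + k * xi (q s)) * exp \<psi>0)" by (auto simp: r_def P_def u_def)
    have "(r has_real_derivative snd (q s) * exp (- \<psi> s) / (u (q s))\<^sup>2 * exp \<psi>0) (at s)"
      unfolding r using key(1)[OF s]
      by (auto intro!: derivative_eq_intros extremal_derivs[OF ext sub[OF s]]
          simp: u_def field_simps power2_eq_square)
    moreover have "snd (q s) * exp (- \<psi> s) / (u (q s))\<^sup>2 * exp \<psi>0 = 1 - \<kappa> * (r s)\<^sup>2"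
    proof -
      have "snd (q s) * exp (- \<psi> s) = u (q s) * (exp (- \<psi> s) * v (q s)) * (1 - \<kappa> * (r s)\<^sup>2)"
        unfolding y[OF s] by simp
      also have "\<dots> = (u (q s))\<^sup>2 * exp (- \<psi>0) * (1 - \<kappa> * (r s)\<^sup>2)"
        unfolding key(4)[OF s] by (simp add: power2_eq_square)
      finally show ?thesis using key(1)[OF s] by (simp add: exp_minus)
    qed
    ultimately show ?thesis by simp
  qed
  have "atn \<kappa> (r t) - t = atn \<kappa> (r 0) - 0"
  proof (rule DERIV_isconst2[of 0 t "\<lambda>s. atn \<kappa> (r s) - s" t, OF t(2)])
    have D: "((\<lambda>s. atn \<kappa> (r s) - s) has_real_derivative 0) (at s)" if s: "0 \<le> s" "s \<le> t" for s
    proof -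
      have "((\<lambda>s. atn \<kappa> (r s)) has_real_derivative 1 / (1 - \<kappa> * (r s)\<^sup>2) * (1 - \<kappa> * (r s)\<^sup>2)) (at s)"
        by (rule DERIV_chain2[OF atn_has_derivative[OF r_lt[OF s]] dr[OF s]])
      then have "((\<lambda>s. atn \<kappa> (r s)) has_real_derivative 1) (at s)" using r_lt[OF s] by simp
      from DERIV_diff[OF this DERIV_ident] show ?thesis by simp
    qed
    show "continuous_on {0..t} (\<lambda>s. atn \<kappa> (r s) - s)"
      by (rule DERIV_continuous_on) (use D in \<open>auto intro: has_field_derivative_at_within\<close>)
    show "((\<lambda>s. atn \<kappa> (r s) - s) has_real_derivative 0) (at s)" if "0 < s" "s < t" for s
      using D that by auto
  qed (use t in auto)
  moreover have "r 0 = 0" using I by (simp add: r_def P_def)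
  moreover have "rad (q t) = r t"
  proof -
    have "rad (q t) = sqrt ((r t)\<^sup>2)" unfolding rad_def using r2[of t] t by simp
    then show ?thesis using M_pos(7)[OF qM] by (simp add: r_def)
  qed
  ultimately show "dst (q t) = t" by (simp add: dst_def)
qed

lemma polar_inj:
  assumes "p \<in> M" "q \<in> M" "rapidity p = rapidity q" "dst p = dst q"
  shows "p = q"
proof -
  have "rad p = rad q"
    by (rule atn_inj[of _ _ \<kappa>]) (use assms(4) M_pos(9)[OF assms(1)] M_pos(9)[OF assms(2)] rad_bound[OF assms(1)] rad_bound[OF assms(2)]
        in \<open>auto simp: dst_def\<close>)
  then show ?thesis using assms PQ_inj PQ_polar by metis
qed

lemma pt_has_vector_derivative:
  assumes "(x has_real_derivative y * (c - s)) (at t)" "(e has_real_derivative y * (c + s)) (at t)"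
    "snd (pt (x t) (e t)) = y"
  shows "((\<lambda>t. pt (x t) (e t)) has_vector_derivative
    c *\<^sub>R Y1 A (pt (x t) (e t)) + s *\<^sub>R Y2 A (pt (x t) (e t))) (at t)"
proof -
  define r where "r = 1 / (2 * det A)"
  have inv: "al A = 2 * A$2$2 * r" "be A = - 2 * A$1$2 * r" "ga A = - 2 * A$2$1 * r" "de A = 2 * A$1$1 * r"
    by (auto simp: inv_entries r_def)
  have "((\<lambda>t. r * ((A$1$2 + A$2$2) * x t - (A$1$2 - A$2$2) * e t)) has_real_derivative
      y * (c * al A + s * be A)) (at t)"
    by (rule DERIV_cong, (rule derivative_eq_intros assms(1,2) refl)+) (simp add: inv algebra_simps)
  moreover have "((\<lambda>t. 1 + r * ((A$1$1 - A$2$1) * e t - (A$1$1 + A$2$1) * x t)) has_real_derivative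
      y * (c * ga A + s * de A)) (at t)"
    by (rule DERIV_cong, (rule derivative_eq_intros assms(1,2) refl)+) (simp add: inv algebra_simps)
  ultimately have "((\<lambda>t. pt (x t) (e t)) has_vector_derivative
      (y * (c * al A + s * be A), y * (c * ga A + s * de A))) (at t)"
    unfolding has_real_derivative_iff_has_vector_derivative pt_def
    by (auto intro!: has_vector_derivative_Pair simp: r_def)
  moreover have "(y * (c * al A + s * be A), y * (c * ga A + s * de A)) =
      c *\<^sub>R Y1 A (pt (x t) (e t)) + s *\<^sub>R Y2 A (pt (x t) (e t))"
    using assms(3) by (simp add: Y1_def Y2_def X1_def X2_def algebra_simps)
  ultimately show ?thesis by simp
qed

text \<open>
  The extremal is written down explicitly from \<open>r = tn \<kappa>\<close>. Here \<open>p1 = 1 / u\<close> and \<open>p2 = 1 / v\<close> along the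
  extremal, so it lives as long as \<open>p1\<close> and \<open>p2\<close> are positive. This condition holds on \<open>{0..dst p}\<close> since
  it holds at \<open>dst p\<close> and \<open>r\<close> is increasing.
\<close>

lemma extremal_exists:
  assumes p: "p \<in> M"
  obtains I \<psi> q where "extremal_on A (rapidity p) I \<psi> q" "dst p \<in> I"
proof -
  define \<psi>0 E r where "\<psi>0 = rapidity p" and "E = exp \<psi>0" and "r = tn \<kappa>"
  have E: "E > 0" by (simp add: E_def)
  define p1 where "p1 t = 1 - k / E * r t" for t
  define p2 where "p2 t = 1 - m * E * r t" for t
  define S where "S = {t \<in> tn_dom \<kappa>. p1 t > 0} \<inter> {t \<in> tn_dom \<kappa>. p2 t > 0}"
  \<comment> \<open>an open interval that contains \<open>{0..dst p}\<close>, because \<open>S\<close> is open and contains it\<close>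
  define I where "I = connected_component_set S 0"
  have r': "(r has_real_derivative 1 - \<kappa> * (r t)\<^sup>2) (at t)" and r_lt: "\<kappa> * (r t)\<^sup>2 < 1" if "t \<in> tn_dom \<kappa>" for t
    using tn_has_derivative[OF that] by (auto simp: r_def)
  have r_cont: "continuous_on (tn_dom \<kappa>) r"
    by (rule DERIV_continuous_on) (use r' in \<open>auto intro: has_field_derivative_at_within\<close>)
  have "S = (tn_dom \<kappa> \<inter> p1 -` {0<..}) \<inter> (tn_dom \<kappa> \<inter> p2 -` {0<..})" by (auto simp: S_def)
  also have "open \<dots>"
    unfolding p1_def[abs_def] p2_def[abs_def]
    by (intro open_Int continuous_open_preimage continuous_intros r_cont open_tn_dom open_greaterThan)
  finally have "open S" .
  have T: "dst p \<in> tn_dom \<kappa>" "r (dst p) = rad p"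
    using tn_atn[OF rad_bound[OF p]] by (auto simp: dst_def r_def)
  have T0: "dst p > 0" by (rule dst_pos[OF p])
  have kp: "k / E * rad p < 1" "m * E * rad p < 1"
  proof -
    have "P p = rad p / E" "Q p = E * rad p"
      using PQ_polar[OF p] by (simp_all add: E_def \<psi>0_def exp_minus field_simps)
    then show "k / E * rad p < 1" "m * E * rad p < 1"
      using coords_from_PQ(3,4)[OF M_pos(5,6)[OF p]] by (simp_all add: field_simps)
  qed
  \<comment> \<open>Both conditions have the form \<open>c r < 1\<close>, which is inherited by smaller \<open>r \<ge> 0\<close>.\<close>
  have bnd: "c * x < 1" if "0 \<le> x" "x \<le> rad p" "c * rad p < 1" for c x :: real
  proof (cases "c \<le> 0")
    case True
    then have "c * x \<le> 0" using that by (simp add: mult_nonpos_nonneg)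
    then show ?thesis by simp
  next
    case False
    then have "c * x \<le> c * rad p" using that by (intro mult_left_mono) auto
    then show ?thesis using that by simp
  qed
  have "{0..dst p} \<subseteq> S"
  proof
    fix t assume t: "t \<in> {0..dst p}"
    have dom: "t \<in> tn_dom \<kappa>" using tn_dom_Icc(1)[OF T(1)] t by auto
    have rt: "0 \<le> r t" "r t \<le> rad p"
      using tn_mono[of 0 t \<kappa>] tn_mono[of t "dst p" \<kappa>] t dom T by (auto simp: r_def)
    then show "t \<in> S" using bnd[OF rt kp(1)] bnd[OF rt kp(2)] dom by (simp add: S_def p1_def p2_def)
  qed
  moreover have "connected {0..dst p}" "0 \<in> {0..dst p}" using T0 by auto
  ultimately have sub: "{0..dst p} \<subseteq> I"
    unfolding I_def using connected_component_maximal by blast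
  have I: "open I" "is_interval I" "I \<subseteq> S"
    unfolding I_def using open_connected_component[OF \<open>open S\<close>]
    by (auto simp: is_interval_connected_1 connected_connected_component connected_component_subset)
  define x where "x t = r t / E / p1 t" for t
  define e where "e t = E * r t / p2 t" for t
  define q where "q t = pt (x t) (e t)" for t
  define \<psi> where "\<psi> t = \<psi>0 + ln (p1 t) - ln (p2 t)" for t
  have "extremal_on A \<psi>0 I \<psi> q"
    unfolding extremal_on_def
  proof (intro conjI ballI)
    show "0 \<in> I" using sub T0 by auto
    have r0: "r 0 = 0" by (simp add: r_def)
    show "\<psi> 0 = \<psi>0" by (simp add: \<psi>_def p1_def p2_def r0)
    show "q 0 = aff_id"
      by (rule xi_eta_inj) (simp_all add: q_def x_def e_def r0)
    fix t assume "t \<in> I"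
    then have t: "t \<in> tn_dom \<kappa>" "p1 t > 0" "p2 t > 0" using I(3) by (auto simp: S_def)
    define R where "R = 1 - \<kappa> * (r t)\<^sup>2"
    have R: "R > 0" using r_lt[OF t(1)] by (simp add: R_def)
    have dr: "(r has_real_derivative R) (at t)" using r'[OF t(1)] by (simp add: R_def)
    have R_eq: "R = p1 t + p2 t - p1 t * p2 t"
      using E by (simp add: R_def p1_def p2_def \<kappa>_def power2_eq_square algebra_simps)
    have uv1: "u (q t) = 1 / p1 t" "v (q t) = 1 / p2 t"
    proof -
      have "k * (r t / E) = 1 - p1 t" "m * (E * r t) = 1 - p2 t" by (simp_all add: p1_def p2_def)
      moreover have "u (q t) = 1 + k * (r t / E) / p1 t" "v (q t) = 1 + m * (E * r t) / p2 t"
        by (simp_all add: u_def v_def q_def x_def e_def)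
      ultimately show "u (q t) = 1 / p1 t" "v (q t) = 1 / p2 t"
        using t by (simp_all only:) (simp_all add: field_simps)
    qed
    have "P (q t) * Q (q t) = (r t)\<^sup>2"
      using E t unfolding P_def Q_def uv1 by (simp add: q_def x_def e_def power2_eq_square)
    then have y: "snd (q t) = R / (p1 t * p2 t)"
      using snd_eq_PQ[of "q t"] uv1 t by (simp add: R_def)
    show "q t \<in> Aff" using y R t by (simp add: Aff_def)
    have dp: "(p1 has_real_derivative - (k / E * R)) (at t)" "(p2 has_real_derivative - (m * E * R)) (at t)"
      unfolding p1_def[abs_def] p2_def[abs_def] using E by (auto intro!: derivative_eq_intros dr)
    have ex: "exp (\<psi> t) = E * p1 t / p2 t" "exp (- \<psi> t) = p2 t / (E * p1 t)"
      using t E by (simp_all add: \<psi>_def exp_diff exp_add exp_minus E_def[symmetric])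
    have "(\<psi> has_real_derivative - (k / E * R) / p1 t + m * E * R / p2 t) (at t)"
      unfolding \<psi>_def[abs_def] using t
      by (auto intro!: derivative_eq_intros dp simp: field_simps)
    moreover have "- (k / E * R) / p1 t + m * E * R / p2 t = m * exp (\<psi> t) - k * exp (- \<psi> t)"
    proof -
      have "k / E * (p1 t + p2 t - p1 t * p2 t) * p2 t - m * E * (p1 t + p2 t - p1 t * p2 t) * p1 t
         = k / E * p2 t * p2 t - m * E * p1 t * p1 t"
      proof -
        have "a * (1 - a * r t + (1 - b * r t) - (1 - a * r t) * (1 - b * r t)) * (1 - b * r t) -
          b * (1 - a * r t + (1 - b * r t) - (1 - a * r t) * (1 - b * r t)) * (1 - a * r t) =
          a * (1 - b * r t) * (1 - b * r t) - b * (1 - a * r t) * (1 - a * r t)" for a b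
          by (simp add: algebra_simps)
        from this[of "k / E" "m * E"] show ?thesis unfolding p1_def p2_def by simp
      qed
      then have "(m * E * R) * p1 t - (k / E * R) * p2 t = m * E * p1 t * p1 t - k / E * p2 t * p2 t"
        unfolding R_eq by simp
      then have "((m * E * R) * p1 t - (k / E * R) * p2 t) / (p1 t * p2 t) =
          (m * E * p1 t * p1 t - k / E * p2 t * p2 t) / (p1 t * p2 t)" by simp
      then show ?thesis unfolding ex using t E by (simp add: diff_divide_distrib)
    qed
    ultimately show "(\<psi> has_real_derivative de A * cosh (\<psi> t) + ga A * sinh (\<psi> t)) (at t)"
      unfolding psi_equation_null by simp
    have cs: "cosh (\<psi> t) - sinh (\<psi> t) = exp (- \<psi> t)" "cosh (\<psi> t) + sinh (\<psi> t) = exp (\<psi> t)"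
      by (simp_all add: cosh_minus_sinh cosh_plus_sinh)
    show "(q has_vector_derivative cosh (\<psi> t) *\<^sub>R Y1 A (q t) + sinh (\<psi> t) *\<^sub>R Y2 A (q t)) (at t)"
      unfolding q_def[abs_def]
    proof (rule pt_has_vector_derivative[where y="snd (q t)"])
      have "(x has_real_derivative (R / E * p1 t + r t / E * (k / E * R)) / (p1 t)\<^sup>2) (at t)"
        unfolding x_def[abs_def] using DERIV_divide[OF DERIV_cdivide[OF dr, of E] dp(1)] t
        by (simp add: power2_eq_square)
      moreover have "R / E * p1 t + r t / E * (k / E * R) = R / E"
        using E by (simp add: p1_def algebra_simps)
      ultimately have "(x has_real_derivative R / E / (p1 t)\<^sup>2) (at t)" by simp
      then show "(x has_real_derivative snd (q t) * (cosh (\<psi> t) - sinh (\<psi> t))) (at t)"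
        unfolding cs y ex using t E by (simp add: power2_eq_square field_simps)
      have "(e has_real_derivative (E * R * p2 t + E * r t * (m * E * R)) / (p2 t)\<^sup>2) (at t)"
        unfolding e_def[abs_def] using DERIV_divide[OF DERIV_cmult[OF dr, of E] dp(2)] t
        by (simp add: power2_eq_square)
      moreover have "E * R * p2 t + E * r t * (m * E * R) = E * R"
        by (simp add: p2_def algebra_simps)
      ultimately have "(e has_real_derivative E * R / (p2 t)\<^sup>2) (at t)" by simp
      then show "(e has_real_derivative snd (q t) * (cosh (\<psi> t) + sinh (\<psi> t))) (at t)"
        unfolding cs y ex using t E by (simp add: power2_eq_square field_simps)
    qed (simp add: q_def)
  qed (use I in auto)
  moreover have "dst p \<in> I" using sub T0 by auto
  ultimately show ?thesis using that unfolding \<psi>0_def by blast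
qed

section \<open>The exponential mapping\<close>

text \<open>
  Solutions of the extremal equations agree because their polar coordinates are prescribed by \<open>\<psi>\<^sub>0\<close> and \<open>t\<close>.
\<close>

lemma Exp_eq:
  assumes ext: "extremal_on A \<psi>0 I \<psi> q" and t: "t \<in> I" "0 \<le> t"
  shows "Exp A (\<psi>0, t) = q t"
  unfolding Exp_def prod.case
proof (rule the_equality)
  show "\<exists>I \<psi> q'. extremal_on A \<psi>0 I \<psi> q' \<and> t \<in> I \<and> q' t = q t" using ext t by blast
  fix p assume "\<exists>I \<psi> q'. extremal_on A \<psi>0 I \<psi> q' \<and> t \<in> I \<and> q' t = p"
  then obtain I' \<psi>' q' where e': "extremal_on A \<psi>0 I' \<psi>' q'" "t \<in> I'" "q' t = p" by blast
  show "p = q t"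
  proof (cases "t = 0")
    case True
    then show ?thesis using e' ext by (simp add: extremal_on_def)
  next
    case False
    then have "t > 0" using t by simp
    with extremal_polar[OF e'(1,2)] extremal_polar[OF ext t(1)]
      extremal_in_M[OF e'(1,2)] extremal_in_M[OF ext t(1)] e'(3)
    show ?thesis by (intro polar_inj) auto
  qed
qed

lemma N_dom_iff: "(\<psi>0, t) \<in> N_dom A \<longleftrightarrow> t > 0 \<and> (\<exists>I \<psi> q. extremal_on A \<psi>0 I \<psi> q \<and> t \<in> I)"
proof (intro iffI conjI)
  assume N: "(\<psi>0, t) \<in> N_dom A"
  then show "t > 0" by (simp add: N_dom_def)
  from N obtain t' where t': "t' \<in> max_interval A \<psi>0" "t < t'"
    by (auto simp: N_dom_def t_max_def less_SUP_iff)
  then obtain I \<psi> q where e: "extremal_on A \<psi>0 I \<psi> q" "t' \<in> I" by (auto simp: max_interval_def)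
  then have "is_interval I" "0 \<in> I" by (auto simp: extremal_on_def)
  then have "t \<in> I" using e(2) t'(2) \<open>t > 0\<close> by (meson mem_is_interval_1_I less_imp_le)
  then show "\<exists>I \<psi> q. extremal_on A \<psi>0 I \<psi> q \<and> t \<in> I" using e by blast
next
  assume "t > 0 \<and> (\<exists>I \<psi> q. extremal_on A \<psi>0 I \<psi> q \<and> t \<in> I)"
  then obtain I \<psi> q where e: "extremal_on A \<psi>0 I \<psi> q" "t \<in> I" and t: "t > 0" by blast
  then have "open I" by (simp add: extremal_on_def)
  then obtain d where d: "d > 0" "cball t d \<subseteq> I" using e(2) open_contains_cball by blast
  then have "t + d \<in> I" by (auto simp: dist_real_def)
  then have "t + d \<in> max_interval A \<psi>0" using e(1) by (auto simp: max_interval_def)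
  then have "ereal t < t_max A \<psi>0"
    using d(1) unfolding t_max_def less_SUP_iff by (intro bexI[of _ "t + d"]) auto
  then show "(\<psi>0, t) \<in> N_dom A" using t by (simp add: N_dom_def)
qed

lemma Exp_in_M:
  assumes "(\<psi>0, t) \<in> N_dom A"
  shows "Exp A (\<psi>0, t) \<in> M" "rapidity (Exp A (\<psi>0, t)) = \<psi>0" "dst (Exp A (\<psi>0, t)) = t"
proof -
  obtain I \<psi> q where e: "extremal_on A \<psi>0 I \<psi> q" "t \<in> I" and t: "t > 0"
    using assms by (auto simp: N_dom_iff)
  then show "Exp A (\<psi>0, t) \<in> M" "rapidity (Exp A (\<psi>0, t)) = \<psi>0" "dst (Exp A (\<psi>0, t)) = t"
    using extremal_in_M[OF e t] extremal_polar[OF e t] Exp_eq[OF e] by auto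
qed

lemma polar_in_N_dom:
  assumes "p \<in> M"
  shows "(rapidity p, dst p) \<in> N_dom A"
  using extremal_exists[OF assms] dst_pos[OF assms] by (metis N_dom_iff)

lemma Exp_polar:
  assumes "p \<in> M"
  shows "Exp A (rapidity p, dst p) = p"
  using Exp_in_M[OF polar_in_N_dom[OF assms]] assms by (intro polar_inj) auto

lemma bij_Exp: "bij_betw (Exp A) (N_dom A) M"
proof (rule bij_betw_byWitness[where f'="\<lambda>p. (rapidity p, dst p)"])
  show "\<forall>a\<in>N_dom A. (rapidity (Exp A a), dst (Exp A a)) = a" using Exp_in_M by auto
  show "\<forall>p\<in>M. Exp A (rapidity p, dst p) = p" using Exp_polar by blast
  show "Exp A ` N_dom A \<subseteq> M" using Exp_in_M by auto
  show "(\<lambda>p. (rapidity p, dst p)) ` M \<subseteq> N_dom A" using polar_in_N_dom by auto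
qed

lemma the_inv_Exp:
  assumes "p \<in> M"
  shows "the_inv_into (N_dom A) (Exp A) p = (rapidity p, dst p)"
  using the_inv_into_f_eq[OF bij_betw_imp_inj_on[OF bij_Exp]] Exp_polar polar_in_N_dom assms by blast

section \<open>The image of the exponential mapping\<close>

text \<open>
  One inclusion is monotonicity of \<open>\<xi>\<close> and \<open>\<eta>\<close>. For the other one, the straight segment from the
  identity is future directed, as \<open>\<xi>\<close> and \<open>\<eta>\<close> are affine functions.
\<close>

lemma J_plus_eq: "J_plus A = {q \<in> Aff. xi q \<ge> 0 \<and> eta q \<ge> 0}"
proof (intro equalityI subsetI)
  fix p assume "p \<in> J_plus A"
  then obtain q T where q: "future_curve A q T" "q 0 = aff_id" "q T = p" by (auto simp: J_plus_def)
  then have "0 \<le> T" "p \<in> Aff" by (auto simp: future_curve_def image_subset_iff)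
  then show "p \<in> {q \<in> Aff. xi q \<ge> 0 \<and> eta q \<ge> 0}"
    using future_curve_mono[OF q(1), of 0 T] q by auto
next
  fix p assume "p \<in> {q \<in> Aff. xi q \<ge> 0 \<and> eta q \<ge> 0}"
  then have p: "snd p > 0" "xi p \<ge> 0" "eta p \<ge> 0" by (auto simp: Aff_def)
  define q where "q t = aff_id + t *\<^sub>R (p - aff_id)" for t
  have q': "(q has_vector_derivative p - aff_id) (at t)" for t
    unfolding q_def[abs_def] by (auto intro!: derivative_eq_intros simp: has_vector_derivative_def)
  have Aff: "q t \<in> Aff" if "t \<in> {0..1}" for t
  proof -
    have "snd (q t) = (1 - t) + t * snd p" by (simp add: q_def aff_id_def algebra_simps)
    moreover have "(1 - t) + t * snd p > 0"
      using that p(1) by (cases "t = 0") (auto intro: add_nonneg_pos)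
    ultimately show ?thesis by (simp add: Aff_def)
  qed
  have nonsp: "future_nonspacelike A (q t) (p - aff_id)" if "t \<in> {0..1}" for t
  proof -
    have s: "snd (q t) > 0" using Aff[OF that] by (simp add: Aff_def)
    have "(A$1$1 - A$2$1, A$1$2 - A$2$2) \<bullet> (p - aff_id) = xi p"
      "(A$1$1 + A$2$1, A$1$2 + A$2$2) \<bullet> (p - aff_id) = eta p"
      unfolding xi_linear eta_linear by (simp_all add: inner_diff_right aff_id_def inner_prod_def algebra_simps)
    with v1_v2[OF Aff[OF that], of "p - aff_id"] p
    have "snd (q t) * (v1 A (q t) (p - aff_id) - v2 A (q t) (p - aff_id)) \<ge> 0"
      "snd (q t) * (v1 A (q t) (p - aff_id) + v2 A (q t) (p - aff_id)) \<ge> 0" by auto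
    then show ?thesis using s by (auto simp: future_nonspacelike_def zero_le_mult_iff)
  qed
  have "future_curve A q 1"
    unfolding future_curve_def
  proof (intro conjI)
    show "\<exists>C. C-lipschitz_on {0..1} q" by (rule lipschitz_on_C1[OF q']) auto
    show "AE t in lebesgue_on {0..1}. q differentiable at t \<and>
        future_nonspacelike A (q t) (vector_derivative q (at t))"
      using q' nonsp vector_derivative_at[OF q']
      by (auto intro!: AE_I2 simp: differentiable_def has_vector_derivative_def)
  qed (use Aff in auto)
  moreover have "q 0 = aff_id" "q 1 = p" by (auto simp: q_def)
  ultimately show "p \<in> J_plus A" unfolding J_plus_def by blast
qed

text \<open>
  For \<open>K \<ge> 0\<close> the set \<open>J_plus\<close> is an intersection of three half planes, whose interior is found by
  making the inequalities strict.
\<close>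

lemma M_im_eq: "M_im A = M"
proof (cases "sec_curv A < 0")
  case True
  then show ?thesis by (rule M_im_negative_curvature)
next
  case False
  have "det A = A$1$1 * (A$1$2 + A$2$2) - A$1$2 * (A$1$1 + A$2$1)"
    "det A = A$1$2 * (A$1$1 - A$2$1) - A$1$1 * (A$1$2 - A$2$2)"
    by (simp_all add: det_A algebra_simps)
  then have nz: "(A$1$1 - A$2$1, A$1$2 - A$2$2) \<noteq> 0" "(A$1$1 + A$2$1, A$1$2 + A$2$2) \<noteq> 0"
    using det_pos by (auto simp: zero_prod_def)
  have "interior (J_plus A) = interior ({q. (0, 1) \<bullet> q > 0} \<inter>
      {q. (A$1$1 - A$2$1, A$1$2 - A$2$2) \<bullet> q \<ge> A$1$2 - A$2$2} \<inter>
      {q. (A$1$1 + A$2$1, A$1$2 + A$2$2) \<bullet> q \<ge> A$1$2 + A$2$2})"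
    unfolding J_plus_eq by (rule arg_cong[where f=interior]) (auto simp: xi_linear eta_linear Aff_def inner_prod_def)
  also have "\<dots> = {q. (0, 1) \<bullet> q > 0} \<inter> {q. (A$1$1 - A$2$1, A$1$2 - A$2$2) \<bullet> q > A$1$2 - A$2$2} \<inter>
      {q. (A$1$1 + A$2$1, A$1$2 + A$2$2) \<bullet> q > A$1$2 + A$2$2}"
    unfolding interior_Int interior_halfspace_ge[OF nz(1)] interior_halfspace_ge[OF nz(2)]
    by (simp add: interior_open open_halfspace_gt)
  also have "\<dots> = M"
    using u_v_pos_if_nonneg_curv False
    by (auto simp: M_def xi_linear eta_linear Aff_def inner_prod_def)
  finally show ?thesis using False by (simp add: M_im_def)
qed

section \<open>Radial curves are the unique maximizers\<close>

text \<open>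
  The curve agrees with an extremal on \<open>{0..dst p}\<close>, so its two-sided derivatives are those of the
  extremal in \<open>{0<..<dst p}\<close>, that is, almost everywhere.
\<close>

lemma Exp_curve:
  assumes p: "p \<in> M"
  defines "T \<equiv> dst p" and "c \<equiv> \<lambda>t. Exp A (rapidity p, t)"
  shows "future_curve A c T" "arclength_param A c T" "lor_length A c T = T" "c 0 = aff_id" "c T = p"
proof -
  obtain I \<psi> q where ext: "extremal_on A (rapidity p) I \<psi> q" "T \<in> I"
    using extremal_exists[OF p] unfolding T_def by blast
  have T: "T > 0" using dst_pos[OF p] by (simp add: T_def)
  have I: "is_interval I" "0 \<in> I" using ext(1) by (auto simp: extremal_on_def)
  have sub: "{0..T} \<subseteq> I" using mem_is_interval_1_I[OF I ext(2)] by auto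
  have cq: "c t = q t" if "t \<in> {0..T}" for t using Exp_eq[OF ext(1)] sub that by (auto simp: c_def)
  show "c 0 = aff_id" using cq[of 0] T ext(1) by (simp add: extremal_on_def)
  show "c T = p" using Exp_polar[OF p] by (simp add: c_def T_def)
  define w where "w t = cosh (\<psi> t) *\<^sub>R Y1 A (q t) + sinh (\<psi> t) *\<^sub>R Y2 A (q t)" for t
  have q: "q t \<in> Aff" "(q has_vector_derivative w t) (at t)" "isCont \<psi> t" "isCont q t" if "t \<in> {0..T}" for t
  proof -
    have "t \<in> I" using sub that by blast
    then show "q t \<in> Aff" and q': "(q has_vector_derivative w t) (at t)"
      using ext(1) by (auto simp: extremal_on_def w_def)
    show "isCont \<psi> t" using DERIV_isCont[OF extremal_derivs(3)[OF ext(1) \<open>t \<in> I\<close>]] .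
    show "isCont q t" using has_vector_derivative_continuous[OF q'] .
  qed
  have "continuous_on {0..T} \<psi>" "continuous_on {0..T} q"
    using q(3,4) by (auto intro!: continuous_at_imp_continuous_on)
  then have "continuous_on {0..T} w"
    unfolding w_def[abs_def] Y1_def Y2_def X1_def X2_def by (intro continuous_intros)
  then obtain C where "C-lipschitz_on {0..T} q"
    using lipschitz_on_C1[OF q(2)] by blast
  then have lip: "C-lipschitz_on {0..T} c"
    by (rule lipschitz_on_transform) (simp add: cq)
  have c': "(c has_vector_derivative w t) (at t)" "c t = q t" if "t \<in> {0<..<T}" for t
  proof -
    show "(c has_vector_derivative w t) (at t)"
      by (rule has_vector_derivative_transform_within_open[OF q(2), where S="{0<..<T}"])
        (use that cq in auto)
    show "c t = q t" using that cq by auto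
  qed
  have N: "negligible {0, T}" by auto
  have v: "v1 A (c t) (vector_derivative c (at t)) = cosh (\<psi> t)"
    "v2 A (c t) (vector_derivative c (at t)) = sinh (\<psi> t)" if "t \<in> {0<..<T}" for t
    using vector_derivative_at[OF c'(1)[OF that]] c'(2)[OF that] velocity_components[OF q(1)] that
    by (auto simp: w_def)
  have sp: "- lorentz_form A (c t) (vector_derivative c (at t)) = 1" if "t \<in> {0<..<T}" for t
    unfolding lorentz_form_def v[OF that] using hyperbolic_pythagoras[of "\<psi> t"] by simp
  have AE: "AE t in lebesgue_on {0..T}. R t" if "\<And>t. t \<in> {0<..<T} \<Longrightarrow> R t" for R
  proof -
    have "t \<in> {0, T}" if "\<not> (t \<in> {0..T} \<longrightarrow> R t)" for t
      using that \<open>\<And>t. t \<in> {0<..<T} \<Longrightarrow> R t\<close>[of t] by (cases "t = 0 \<or> t = T") auto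
    then have "AE t in lebesgue. t \<in> {0..T} \<longrightarrow> R t"
      unfolding eventually_ae_filter_negligible using N by blast
    then show ?thesis by (subst AE_restrict_space_iff) auto
  qed
  show "future_curve A c T"
    unfolding future_curve_def
  proof (intro conjI AE)
    show "c ` {0..T} \<subseteq> Aff" using cq q(1) by auto
    show "\<exists>C. C-lipschitz_on {0..T} c" using lip by blast
    fix t assume t: "t \<in> {0<..<T}"
    show "c differentiable at t"
      using c'(1)[OF t] by (auto simp: differentiable_def has_vector_derivative_def)
    show "future_nonspacelike A (c t) (vector_derivative c (at t))"
      unfolding future_nonspacelike_def v[OF t] using sinh_le_cosh_real[of "\<psi> t"] sinh_le_cosh_real[of "- \<psi> t"]
      by (simp add: abs_le_iff)
  qed (use T in auto)
  show "arclength_param A c T" unfolding arclength_param_def by (rule AE[OF sp])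
  have "((\<lambda>t. sqrt (- lorentz_form A (c t) (vector_derivative c (at t)))) has_integral (T - 0)) {0..T}"
    by (rule has_integral_spike[OF N, of _ _ "\<lambda>_. 1"])
      (use sp T has_integral_const_real[of "1::real" 0 T] in auto)
  then show "lor_length A c T = T" unfolding lor_length_def by (simp add: integral_unique)
qed

lemma arclength_imp_length:
  assumes "arclength_param A q T" "0 \<le> T"
  shows "lor_length A q T = T"
proof -
  have "AE t in lebesgue. t \<in> {0..T} \<longrightarrow> speed q t = 1"
    using assms(1) unfolding arclength_param_def
    by (subst (asm) AE_restrict_space_iff) (auto simp: speed_def elim: eventually_mono)
  then obtain N where N: "negligible N" "\<And>t. t \<in> {0..T} - N \<Longrightarrow> speed q t = 1"
    unfolding eventually_ae_filter_negligible by blast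
  have "(speed q has_integral (T - 0)) {0..T}"
    by (rule has_integral_spike[OF N(1), of _ _ "\<lambda>_. 1"])
      (use assms N(2) has_integral_const_real[of "1::real" 0 T] in auto)
  then show ?thesis unfolding lor_length_speed by (simp add: integral_unique)
qed

lemma Exp_optimal:
  assumes p: "p \<in> M"
  shows "optimal_arclength_from_id_to A p (\<lambda>t. Exp A (rapidity p, t)) (dst p)"
  unfolding optimal_arclength_from_id_to_def length_maximizer_def
  using Exp_curve[OF p] length_le_dst p by (auto simp: lor_length_speed)

lemma optimal_unique:
  assumes p: "p \<in> M" and opt: "optimal_arclength_from_id_to A p q T"
  shows "T = dst p" "\<forall>t\<in>{0..dst p}. q t = Exp A (rapidity p, t)"
proof -
  note c = Exp_curve[OF p]
  have q: "future_curve A q T" "arclength_param A q T" "q 0 = aff_id" "q T = p"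
    and max: "\<And>p S. future_curve A p S \<Longrightarrow> p 0 = q 0 \<Longrightarrow> p S = q T \<Longrightarrow> lor_length A p S \<le> lor_length A q T"
    using opt by (auto simp: optimal_arclength_from_id_to_def length_maximizer_def)
  have T0: "0 \<le> T" using q(1) by (simp add: future_curve_def)
  have qM: "q T \<in> M" using q p by simp
  have T: "dst (q T) \<le> T"
    using max[OF c(1)] c(3-5) q arclength_imp_length[OF q(2) T0] by simp
  have "T > 0" using T dst_pos[OF qM] by simp
  note rad = unit_speed_maximizer_is_radial[OF q(1,3,2) qM T]
  show TT: "T = dst p" using rad(2)[of T] \<open>T > 0\<close> q(4) by simp
  show "\<forall>t\<in>{0..dst p}. q t = Exp A (rapidity p, t)"
  proof
    fix t assume t: "t \<in> {0..dst p}"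
    show "q t = Exp A (rapidity p, t)"
    proof (cases "t = 0")
      case True
      then show ?thesis using c(4) q(3) by simp
    next
      case False
      then have "t \<in> {0<..T}" using t TT by auto
      from Exp_polar[OF rad(1)[OF this]] rad(2,3)[OF this] q(4) show ?thesis by simp
    qed
  qed
qed

end

section \<open>Hyperbolic and circular identities\<close>

lemma arctan_diff_pos:
  assumes "x > 0" "y > 0"
  shows "arctan x - arctan y = arctan ((x - y) / (1 + x * y))"
proof -
  have p: "0 < arctan x" "0 < arctan y" "arctan x < pi / 2" "arctan y < pi / 2"
    using assms arctan_ubound by auto
  have b: "- (pi / 2) < arctan x - arctan y" "arctan x - arctan y < pi / 2"
    using p by linarith+
  have "cos (arctan x - arctan y) \<noteq> 0" using cos_gt_zero_pi[OF b] by simp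
  from tan_diff[OF cos_arctan_not_zero cos_arctan_not_zero this]
  have "tan (arctan x - arctan y) = (x - y) / (1 + x * y)" by (simp only: tan_arctan)
  from arctan_unique[OF b this] show ?thesis by (rule sym)
qed

text \<open>
  The Gudermannian function: the first argument is \<open>tanh (ln e)\<close>, and \<open>arcsin (tanh s) = arctan (sinh s)\<close>
  is \<open>2 arctan (e\<^sup>s) - \<pi> / 2\<close>.
\<close>

lemma arcsin_gudermann:
  fixes e :: real
  assumes e: "e > 0"
  shows "arcsin ((e\<^sup>2 - 1) / (e\<^sup>2 + 1)) = 2 * arctan e - pi / 2"
    "arsinh (tan (2 * arctan e - pi / 2)) = ln e"
proof -
  define x where "x = arctan e"
  have e2: "1 + e\<^sup>2 > 0" using e by (simp add: add_pos_pos)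
  have x: "0 < x" "x < pi / 2" using e arctan_ubound by (auto simp: x_def)
  have cs: "cos x = 1 / sqrt (1 + e\<^sup>2)" "sin x = e / sqrt (1 + e\<^sup>2)"
    by (simp_all add: x_def cos_arctan sin_arctan)
  have c2: "cos (2 * x) = (1 - e\<^sup>2) / (1 + e\<^sup>2)" "sin (2 * x) = 2 * e / (1 + e\<^sup>2)"
    using e2 by (simp_all add: cos_double sin_double cs power_divide diff_divide_distrib)
  have "sin (2 * x - pi / 2) = - cos (2 * x)" "cos (2 * x - pi / 2) = sin (2 * x)"
    unfolding sin_diff cos_diff sin_pi_half cos_pi_half by simp_all
  then have s: "sin (2 * x - pi / 2) = (e\<^sup>2 - 1) / (e\<^sup>2 + 1)" "cos (2 * x - pi / 2) = 2 * e / (1 + e\<^sup>2)"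
    using c2 by (simp_all only: minus_divide_left minus_diff_eq add.commute)
  show "arcsin ((e\<^sup>2 - 1) / (e\<^sup>2 + 1)) = 2 * arctan e - pi / 2"
    using arcsin_sin[of "2 * x - pi / 2"] x unfolding s(1) by (simp add: x_def)
  have "tan (2 * x - pi / 2) = ((e\<^sup>2 - 1) / (1 + e\<^sup>2)) / (2 * e / (1 + e\<^sup>2))"
    by (simp only: tan_def s add.commute)
  also have "\<dots> = (e\<^sup>2 - 1) / (2 * e)" using e2 by simp
  also have "\<dots> = (e - 1 / e) / 2" using e by (simp add: field_simps power2_eq_square)
  also have "\<dots> = sinh (ln e)" using e by (simp add: sinh_ln_real field_simps)
  finally show "arsinh (tan (2 * arctan e - pi / 2)) = ln e"
    by (simp add: x_def arsinh_sinh_real)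
qed

text \<open>
  The involution \<open>s \<mapsto> ln (coth (s / 2))\<close> exchanges \<open>cosh\<close> and \<open>coth\<close>. With \<open>s = ln E\<close>, the quotient
  \<open>(E\<^sup>2 + 1) / (E\<^sup>2 - 1)\<close> is \<open>coth s\<close>, and \<open>(E + 1) / (E - 1)\<close> is \<open>coth (s / 2)\<close>.
\<close>

lemma arcosh_ratio:
  fixes E :: real
  assumes E: "E > 1"
  shows "arcosh ((E\<^sup>2 + 1) / (E\<^sup>2 - 1)) = ln ((E + 1) / (E - 1))"
    "arcosh (coth (ln ((E + 1) / (E - 1)))) = ln E"
proof -
  have inv: "cosh (ln x) = (x\<^sup>2 + 1) / (2 * x)" "sinh (ln x) = (x\<^sup>2 - 1) / (2 * x)" if "x > 0" for x :: real
    using that by (simp_all add: cosh_ln_real sinh_ln_real field_simps power2_eq_square)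
  define R where "R = (E + 1) / (E - 1)"
  have R: "R > 1" using E by (simp add: R_def)
  have E2: "E\<^sup>2 > 1" using E by (simp add: one_less_power)
  have "R\<^sup>2 = (E + 1)\<^sup>2 / (E - 1)\<^sup>2" by (simp add: R_def power_divide)
  then have R2: "R\<^sup>2 + 1 = 2 * (E\<^sup>2 + 1) / (E - 1)\<^sup>2" "R\<^sup>2 - 1 = 4 * E / (E - 1)\<^sup>2"
    using E by (simp_all add: field_simps) (simp_all add: power2_eq_square algebra_simps)
  have "R * (E - 1)\<^sup>2 = (R * (E - 1)) * (E - 1)" by (simp add: power2_eq_square)
  also have "R * (E - 1) = E + 1" using E by (simp add: R_def)
  finally have RE: "R * (E - 1)\<^sup>2 = E\<^sup>2 - 1" by (simp add: power2_eq_square algebra_simps)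
  have "cosh (ln R) = (2 * (E\<^sup>2 + 1)) / (2 * (R * (E - 1)\<^sup>2))"
    unfolding inv(1)[of R, OF less_trans[OF zero_less_one R]] R2 by (simp add: mult_ac)
  then have "cosh (ln R) = (E\<^sup>2 + 1) / (R * (E - 1)\<^sup>2)" by (simp only: mult_divide_mult_cancel_left_if) simp
  then have "cosh (ln R) = (E\<^sup>2 + 1) / (E\<^sup>2 - 1)" unfolding RE .
  then show "arcosh ((E\<^sup>2 + 1) / (E\<^sup>2 - 1)) = ln ((E + 1) / (E - 1))"
    using arcosh_cosh_real[of "ln R"] R by (simp add: R_def)
  have "coth (ln R) = (R\<^sup>2 + 1) / (R\<^sup>2 - 1)" using R by (simp add: coth_def inv)
  also have "\<dots> = (2 * (E\<^sup>2 + 1)) / (2 * (2 * E))" using E unfolding R2 by simp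
  also have "\<dots> = (E\<^sup>2 + 1) / (2 * E)" by (simp only: mult_divide_mult_cancel_left_if) simp
  also have "\<dots> = cosh (ln E)" using E by (simp add: inv)
  finally show "arcosh (coth (ln ((E + 1) / (E - 1)))) = ln E"
    using arcosh_cosh_real[of "ln E"] E by (simp add: R_def)
qed

section \<open>Explicit inversion\<close>

context aff_lorentz
begin

lemma de_ga_km: "de A = m - k" "ga A = m + k"
  by (simp_all add: m_def k_def field_simps)

lemma Delta_eq: "Delta A = 2 * sqrt \<bar>\<kappa>\<bar>"
proof -
  have sq: "(de A)\<^sup>2 - (ga A)\<^sup>2 = 4 * (- \<kappa>)" "(ga A)\<^sup>2 - (de A)\<^sup>2 = 4 * \<kappa>"
    by (simp_all add: de_ga_km \<kappa>_def power2_eq_square algebra_simps)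
  show ?thesis unfolding Delta_def sec_curv_eq sq real_sqrt_mult by (simp add: abs_if)
qed

text \<open>
  Adding the two equations that define \<open>\<theta>\<close> gives \<open>2 m = \<gamma> + \<delta> = \<Delta> e\<^sup>\<theta>\<close>, up to the sign \<open>s\<^sub>1\<close> for \<open>K > 0\<close>.
  The solution is unique since \<open>sinh\<close> is injective.
\<close>

lemma exp_theta:
  assumes "\<kappa> \<noteq> 0"
  shows "exp (theta A) = (if \<kappa> < 0 then m else s1 A * m) / sqrt \<bar>\<kappa>\<bar>"
proof -
  define \<omega> where "\<omega> = sqrt \<bar>\<kappa>\<bar>"
  have \<omega>: "\<omega> > 0" "\<omega> * \<omega> = \<bar>\<kappa>\<bar>" using assms by (auto simp: \<omega>_def)
  define n where "n = (if \<kappa> < 0 then m else s1 A * m)"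
  have s1: "s1 A * s1 A = 1" "s1 A * m > 0" if "\<kappa> > 0"
  proof -
    from that have "k > 0 \<and> m > 0 \<or> k < 0 \<and> m < 0" by (auto simp: \<kappa>_def zero_less_mult_iff)
    then show "s1 A * s1 A = 1" "s1 A * m > 0" by (auto simp: s1_def de_ga_km)
  qed
  have n: "n > 0"
    using M_im_negative_curvature(3) sec_curv_eq s1(2) assms by (auto simp: n_def)
  define \<theta> where "\<theta> = ln (n / \<omega>)"
  have e: "exp \<theta> = n / \<omega>" using n \<omega> by (simp add: \<theta>_def)
  have cs: "2 * \<omega> * cosh \<theta> = n + \<bar>\<kappa>\<bar> / n" "2 * \<omega> * sinh \<theta> = n - \<bar>\<kappa>\<bar> / n"
    unfolding \<omega>(2)[symmetric] cosh_field_def sinh_field_def exp_minus e using \<omega> n by (auto simp: field_simps)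
  have eqs: "if sec_curv A < 0 then de A = Delta A * cosh \<theta> \<and> ga A = Delta A * sinh \<theta>
     else ga A = s1 A * Delta A * cosh \<theta> \<and> de A = s1 A * Delta A * sinh \<theta>"
  proof (cases "\<kappa> < 0")
    case True
    then have "n = m" "\<bar>\<kappa>\<bar> / n = - k" using n by (auto simp: n_def \<kappa>_def)
    then show ?thesis using True cs by (simp add: sec_curv_eq Delta_eq de_ga_km \<omega>_def)
  next
    case False
    then have K: "\<kappa> > 0" using assms by simp
    then have nn: "n = s1 A * m" by (simp add: n_def)
    have nk: "\<bar>\<kappa>\<bar> / n = s1 A * k"
    proof -
      have "\<kappa> * (s1 A * s1 A) = s1 A * k * n" unfolding nn \<kappa>_def by (simp only: mult_ac)
      then have "\<kappa> = s1 A * k * n" using s1(1)[OF K] by simp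
      then have "\<kappa> / n = s1 A * k" using n by (metis nonzero_mult_div_cancel_right less_irrefl)
      then show ?thesis using K by simp
    qed
    have "s1 A * (2 * \<omega> * cosh \<theta>) = (s1 A * s1 A) * (m + k)" "s1 A * (2 * \<omega> * sinh \<theta>) = (s1 A * s1 A) * (m - k)"
      unfolding cs nk unfolding nn by (simp_all add: algebra_simps)
    then show ?thesis using K s1(1)[OF K] by (simp add: sec_curv_eq Delta_eq de_ga_km \<omega>_def mult.assoc)
  qed
  have "theta A = \<theta>"
    unfolding theta_def
  proof (rule the_equality)
    show "if sec_curv A < 0 then de A = Delta A * cosh \<theta> \<and> ga A = Delta A * sinh \<theta>
      else ga A = s1 A * Delta A * cosh \<theta> \<and> de A = s1 A * Delta A * sinh \<theta>" by (rule eqs)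
    fix x assume x: "if sec_curv A < 0 then de A = Delta A * cosh x \<and> ga A = Delta A * sinh x
      else ga A = s1 A * Delta A * cosh x \<and> de A = s1 A * Delta A * sinh x"
    have "sec_curv A < 0 \<or> s1 A \<noteq> 0" using s1 assms by (auto simp: sec_curv_eq)
    moreover have "Delta A \<noteq> 0" using \<omega> by (simp add: Delta_eq \<omega>_def)
    ultimately have "sinh x = sinh \<theta>" using x eqs by (auto split: if_splits)
    then show "x = \<theta>" by simp
  qed
  then show ?thesis using e by (simp add: n_def \<omega>_def)
qed

lemma lam_nu_entries:
  assumes "\<kappa> \<noteq> 0"
  defines "S \<equiv> (if \<kappa> < 0 then 1 else - 1) * ((A$1$1)\<^sup>2 - (A$2$1)\<^sup>2)"
  shows "S > 0" "lam A = det A / S" "nu A = (A$2$1 * A$2$2 - A$1$1 * A$1$2) / S"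
proof -
  have k4: "4 * (det A)\<^sup>2 * \<kappa> = (A$2$1)\<^sup>2 - (A$1$1)\<^sup>2"
  proof -
    have "4 * (det A)\<^sup>2 * \<kappa> = (2 * det A * k) * (2 * det A * m)" by (simp add: \<kappa>_def power2_eq_square)
    then show ?thesis unfolding km_alt by (simp add: power2_eq_square algebra_simps)
  qed
  have S: "S = 4 * (det A)\<^sup>2 * \<bar>\<kappa>\<bar>" using k4 by (auto simp: S_def abs_if)
  then show "S > 0" using det_pos assms(1) by simp
  have D2: "(Delta A)\<^sup>2 = S / (det A)\<^sup>2" using det_pos by (simp add: Delta_eq S power_mult_distrib)
  have "al A * de A - be A * ga A = (A$1$1 * A$2$2 - A$1$2 * A$2$1) / (det A)\<^sup>2"
    by (simp add: inv_entries power2_eq_square diff_divide_distrib mult.commute)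
  then have "al A * de A - be A * ga A = det A / (det A)\<^sup>2" by (simp only: det_A)
  then show "lam A = det A / S" using det_pos \<open>S > 0\<close> by (simp add: lam_def D2)
  have "be A * de A - al A * ga A = (A$2$1 * A$2$2 - A$1$1 * A$1$2) / (det A)\<^sup>2"
    by (simp add: inv_entries power2_eq_square diff_divide_distrib mult.commute)
  then show "nu A = (A$2$1 * A$2$2 - A$1$1 * A$1$2) / S" using det_pos \<open>S > 0\<close> by (simp add: nu_def D2)
qed

lemma m_eta_minus_k_xi:
  "m * eta q - k * xi q = (((A$1$1)\<^sup>2 - (A$2$1)\<^sup>2) * fst q + (A$1$1 * A$1$2 - A$2$1 * A$2$2) * (snd q - 1)) / det A"
proof -
  have "2 * det A * (m * eta q - k * xi q) = (2 * det A * m) * eta q - (2 * det A * k) * xi q"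
    by (simp add: algebra_simps)
  also have "\<dots> = 2 * (((A$1$1)\<^sup>2 - (A$2$1)\<^sup>2) * fst q + (A$1$1 * A$1$2 - A$2$1 * A$2$2) * (snd q - 1))"
    unfolding km_alt xi_def eta_def lambda1_def lambda2_def by (simp add: power2_eq_square algebra_simps)
  finally show ?thesis using det_pos by (simp add: field_simps)
qed

text \<open>
  In this and the next lemma, \<open>w\<close> is recognized as the coordinate that is conjugate to \<open>y = 1 + k \<xi> + m \<eta>\<close>.
  Both sides are affine in \<open>(x, y)\<close>.
\<close>

lemma w_negative_curvature:
  assumes "\<kappa> < 0"
  shows "(fst q - nu A * (snd q - 1)) / lam A = m * eta q - k * xi q"
proof -
  define S N where "S = (A$1$1)\<^sup>2 - (A$2$1)\<^sup>2" and "N = A$2$1 * A$2$2 - A$1$1 * A$1$2"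
  have S: "S > 0" and l: "lam A = det A / S" "nu A = N / S" using lam_nu_entries assms by (simp_all add: S_def N_def)
  have "fst q - N / S * (snd q - 1) = (S * fst q - N * (snd q - 1)) / S" using S by (simp add: diff_divide_distrib)
  then have "(fst q - nu A * (snd q - 1)) / lam A = (S * fst q - N * (snd q - 1)) / det A"
    unfolding l using S by simp
  then show ?thesis unfolding m_eta_minus_k_xi by (simp add: S_def N_def algebra_simps)
qed

lemma w_positive_curvature:
  assumes "\<kappa> > 0"
  shows "(fst q + nu A * (snd q - 1)) / lam A = k * xi q - m * eta q"
proof -
  define S N where "S = (A$2$1)\<^sup>2 - (A$1$1)\<^sup>2" and "N = A$2$1 * A$2$2 - A$1$1 * A$1$2"
  have S: "S > 0" and l: "lam A = det A / S" "nu A = N / S" using lam_nu_entries assms by (simp_all add: S_def N_def)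
  have "fst q + N / S * (snd q - 1) = (S * fst q + N * (snd q - 1)) / S" using S by (simp add: add_divide_distrib)
  then have "(fst q + nu A * (snd q - 1)) / lam A = (S * fst q + N * (snd q - 1)) / det A"
    unfolding l using S by simp
  also have "\<dots> = - (m * eta q - k * xi q)"
    unfolding m_eta_minus_k_xi minus_divide_left by (simp add: S_def N_def algebra_simps)
  finally show ?thesis by simp
qed

lemma exp_rapidity:
  assumes q: "q \<in> M"
  shows "(exp (rapidity q))\<^sup>2 = (eta q * u q) / (xi q * v q)"
proof -
  have "(exp (rapidity q))\<^sup>2 = exp (ln (Q q) - ln (P q))"
    by (simp add: power2_eq_square rapidity_def flip: exp_add)
  also have "\<dots> = Q q / P q" using M_pos(7,8)[OF q] by (simp add: exp_diff)
  finally show ?thesis using M_pos[OF q] by (simp add: P_def Q_def)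
qed

lemma rad_sq_xi_eta: "q \<in> M \<Longrightarrow> (rad q)\<^sup>2 = xi q * eta q / (u q * v q)"
  using rad_sq by (simp add: P_def Q_def)

text \<open>
  Put \<open>\<phi> = \<psi> + \<theta>\<close>, and let \<open>e0\<close> and \<open>e1\<close> be the values of \<open>e\<^sup>\<phi>\<close> at the beginning and at the end of the
  extremal. The arguments of \<open>arcsin\<close> in \<open>\<rho>\<close> and \<open>\<tau>\<close> are \<open>tanh \<phi>\<close> at the beginning and at the end, so
  \<open>\<tau> - \<rho>\<close> is \<open>2 (arctan e1 - arctan e0)\<close>, which the subtraction formula turns into \<open>2 arctan (\<omega> r)\<close>.
\<close>

lemma inverse_negative_curvature:
  assumes K: "\<kappa> < 0" and q: "q \<in> M"
  defines "w \<equiv> m * eta q - k * xi q"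
  defines "\<tau> \<equiv> arcsin (((snd q)\<^sup>2 + w\<^sup>2 - 1) / (2 * snd q * w))"
    and "\<rho> \<equiv> arcsin (((snd q)\<^sup>2 - w\<^sup>2 - 1) / (2 * w))"
  shows "dst q = (\<tau> - \<rho>) / Delta A" "rapidity q = arsinh (tan \<rho>) - theta A"
proof -
  note qM = M_pos[OF q]
  have km: "k < 0" "m > 0" using M_im_negative_curvature(2,3) K by (auto simp: sec_curv_eq)
  define \<omega> where "\<omega> = sqrt (- \<kappa>)"
  have \<omega>: "\<omega> > 0" "\<omega>\<^sup>2 = - \<kappa>" using K by (auto simp: \<omega>_def)
  \<comment> \<open>With these two positive numbers, \<open>y = 1 + b - a\<close>, \<open>w = a + b\<close>, \<open>u = 1 - a\<close> and \<open>v = 1 + b\<close>.\<close>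
  define a b where "a = - k * xi q" and "b = m * eta q"
  have uv1: "u q = 1 - a" "v q = 1 + b" by (simp_all add: u_def v_def a_def b_def)
  have ab: "a > 0" "b > 0" "1 - a > 0" "1 + b > 0"
    using km qM uv1 by (auto simp: a_def b_def mult_neg_pos)
  have y: "snd q = 1 + b - a" and w: "w = a + b" by (simp_all add: snd_eq a_def b_def w_def)
  have y0: "1 + b - a > 0" using qM(2) y by simp
  define e0 where "e0 = exp (rapidity q + theta A)"
  define e1 where "e1 = e0 * (1 + b) / (1 - a)"
  have e0: "e0 > 0" "e1 > 0" using ab by (simp_all add: e0_def e1_def)
  have "e0\<^sup>2 = (eta q * u q) / (xi q * v q) * (m / \<omega>)\<^sup>2"
    unfolding e0_def exp_add power_mult_distrib exp_rapidity[OF q]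
    using exp_theta K by (simp add: \<omega>_def)
  also have "\<dots> = (eta q * u q) / (xi q * v q) * (m / (- k))"
  proof -
    have "(m / \<omega>)\<^sup>2 = m\<^sup>2 / (- (k * m))" by (simp add: power_divide \<omega>(2) \<kappa>_def)
    then have "(m / \<omega>)\<^sup>2 = m / (- k)" using km by (simp add: power2_eq_square)
    then show ?thesis by (simp only:)
  qed
  also have "\<dots> = b * (1 - a) / (a * (1 + b))"
    using qM km unfolding uv1 by (simp add: a_def b_def mult_ac)
  finally have e0_sq: "e0\<^sup>2 = b * (1 - a) / (a * (1 + b))" .
  have "e1\<^sup>2 = b * (1 - a) / (a * (1 + b)) * ((1 + b) / (1 - a))\<^sup>2"
    by (simp add: e1_def power_mult_distrib power_divide e0_sq)
  also have "\<dots> = b * (1 + b) / (a * (1 - a))"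
    using ab by (simp add: power2_eq_square)
  finally have e1_sq: "e1\<^sup>2 = b * (1 + b) / (a * (1 - a))" .
  have fr: "(N / D' - 1) / (N / D' + 1) = (N - D') / (N + D')" if "D' \<noteq> 0" for N D' :: real
  proof -
    have "N / D' - 1 = (N - D') / D'" "N / D' + 1 = (N + D') / D'" using that by (auto simp: field_simps)
    then show ?thesis using that by simp
  qed
  have "((snd q)\<^sup>2 - w\<^sup>2 - 1) / (2 * w) = (e0\<^sup>2 - 1) / (e0\<^sup>2 + 1)"
  proof -
    have "(e0\<^sup>2 - 1) / (e0\<^sup>2 + 1) = (b * (1 - a) - a * (1 + b)) / (b * (1 - a) + a * (1 + b))"
      unfolding e0_sq using ab by (intro fr) auto
    also have "\<dots> = (2 * (b * (1 - a) - a * (1 + b))) / (2 * (b * (1 - a) + a * (1 + b)))" by (simp only: mult_divide_mult_cancel_left_if) simp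
    also have "2 * (b * (1 - a) - a * (1 + b)) = (snd q)\<^sup>2 - w\<^sup>2 - 1" unfolding y w by (simp add: power2_eq_square algebra_simps)
    also have "2 * (b * (1 - a) + a * (1 + b)) = 2 * w" unfolding w by (simp add: algebra_simps)
    finally show ?thesis by simp
  qed
  then have \<rho>: "\<rho> = 2 * arctan e0 - pi / 2" using arcsin_gudermann(1)[OF e0(1)] by (simp add: \<rho>_def)
  have "((snd q)\<^sup>2 + w\<^sup>2 - 1) / (2 * snd q * w) = (e1\<^sup>2 - 1) / (e1\<^sup>2 + 1)"
  proof -
    have "(e1\<^sup>2 - 1) / (e1\<^sup>2 + 1) = (b * (1 + b) - a * (1 - a)) / (b * (1 + b) + a * (1 - a))"
      unfolding e1_sq using ab by (intro fr) auto
    also have "\<dots> = (2 * (b * (1 + b) - a * (1 - a))) / (2 * (b * (1 + b) + a * (1 - a)))" by (simp only: mult_divide_mult_cancel_left_if) simp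
    also have "2 * (b * (1 + b) - a * (1 - a)) = (snd q)\<^sup>2 + w\<^sup>2 - 1" unfolding y w by (simp add: power2_eq_square algebra_simps)
    also have "2 * (b * (1 + b) + a * (1 - a)) = 2 * snd q * w" unfolding y w by (simp add: algebra_simps)
    finally show ?thesis by simp
  qed
  then have \<tau>: "\<tau> = 2 * arctan e1 - pi / 2" using arcsin_gudermann(1)[OF e0(2)] by (simp add: \<tau>_def)
  have "arsinh (tan \<rho>) = ln e0" unfolding \<rho> by (rule arcsin_gudermann(2)[OF e0(1)])
  then show "rapidity q = arsinh (tan \<rho>) - theta A" by (simp add: e0_def)
  have e10: "e1 * e0 = b / a"
  proof -
    have "e1 * e0 = e0\<^sup>2 * ((1 + b) / (1 - a))" by (simp add: e1_def power2_eq_square)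
    then show ?thesis unfolding e0_sq using ab by simp
  qed
  have "(e1 - e0) / (1 + e1 * e0) = e0 * a / (1 - a)"
  proof -
    have "e1 - e0 = e0 * (a + b) / (1 - a)" using ab by (simp add: e1_def field_simps)
    moreover have "1 + e1 * e0 = (a + b) / a" unfolding e10 using ab by (simp add: field_simps)
    ultimately show ?thesis using ab by simp
  qed
  also have "\<dots> = \<omega> * rad q"
  proof -
    have "(e0 * a / (1 - a))\<^sup>2 = a * b / ((1 - a) * (1 + b))"
      unfolding power_divide power_mult_distrib e0_sq using ab by (simp add: power2_eq_square mult_ac)
    moreover have "(\<omega> * rad q)\<^sup>2 = a * b / ((1 - a) * (1 + b))"
      unfolding power_mult_distrib \<omega>(2) rad_sq_xi_eta[OF q] uv1 by (simp add: \<kappa>_def a_def b_def)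
    ultimately have "(e0 * a / (1 - a))\<^sup>2 = (\<omega> * rad q)\<^sup>2" by simp
    then show ?thesis by (rule power2_eq_imp_eq) (use ab e0 \<omega>(1) qM(9) in simp_all)
  qed
  finally have "\<tau> - \<rho> = 2 * arctan (\<omega> * rad q)"
    using arctan_diff_pos[OF e0(2,1)] unfolding \<tau> \<rho> by simp
  then show "dst q = (\<tau> - \<rho>) / Delta A"
    using K by (simp add: dst_def atn_def Delta_eq \<omega>_def)
qed

text \<open>
  Let \<open>\<phi>\<close>, \<open>e0\<close> and \<open>e1\<close> be as in the case of negative curvature. Up to the sign \<open>s\<^sub>2\<close> of \<open>\<phi>\<close>, the arguments
  of \<open>arcosh\<close> in \<open>\<rho>\<close> and \<open>\<tau>\<close> are \<open>coth \<phi>\<close> at the beginning and at the end. So \<open>\<rho>\<close> and \<open>\<tau>\<close> are the values of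
  \<open>ln (coth (\<bar>\<phi>\<bar> / 2))\<close>. Along the extremal \<open>tanh (\<phi> / 2)\<close> is multiplied by \<open>(1 + z) / (1 - z)\<close>, where
  \<open>z = s\<^sub>1 \<omega> r\<close> and \<open>artanh (\<omega> r) = \<omega> t\<^sub>1\<close>. If \<open>w = 0\<close>, then \<open>\<phi>\<close> is constantly \<open>0\<close>.
\<close>

lemma inverse_positive_curvature:
  assumes K: "\<kappa> > 0" and q: "q \<in> M"
  defines "w \<equiv> k * xi q - m * eta q"
  defines "\<tau> \<equiv> arcosh (s2 A w * ((1 - (snd q)\<^sup>2 - w\<^sup>2) / (2 * snd q * w)))"
    and "\<rho> \<equiv> arcosh (s2 A w * ((1 - (snd q)\<^sup>2 + w\<^sup>2) / (2 * w)))"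
  shows "w = 0 \<Longrightarrow> dst q = s1 A * (ln (snd q) / Delta A)" "w = 0 \<Longrightarrow> rapidity q = - theta A"
    "w \<noteq> 0 \<Longrightarrow> dst q = s1 A * ((\<rho> - \<tau>) / Delta A)"
    "w \<noteq> 0 \<Longrightarrow> rapidity q = s2 A w * arcosh (coth \<rho>) - theta A"
proof -
  note qM = M_pos[OF q]
  define \<omega> where "\<omega> = sqrt \<kappa>"
  have \<omega>: "\<omega> > 0" "\<omega>\<^sup>2 = \<kappa>" using K by (auto simp: \<omega>_def)
  define s where "s = s1 A"
  have s: "s = 1 \<and> k > 0 \<and> m > 0 \<or> s = - 1 \<and> k < 0 \<and> m < 0"
    using K by (auto simp: \<kappa>_def zero_less_mult_iff s_def s1_def de_ga_km)
  define a b where "a = k * xi q" and "b = m * eta q"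
  have uv1: "u q = 1 + a" "v q = 1 + b" by (simp_all add: u_def v_def a_def b_def)
  have ab: "s * a > 0" "s * b > 0" "1 + a > 0" "1 + b > 0" "a * b > 0" "a \<noteq> 0" "b \<noteq> 0"
    using s qM uv1 by (auto simp: a_def b_def mult_neg_pos mult_neg_neg zero_less_mult_iff)
  have y: "snd q = 1 + a + b" and w: "w = a - b" by (simp_all add: snd_eq a_def b_def w_def)
  have y0: "1 + a + b > 0" using qM(2) y by simp
  define e0 where "e0 = exp (rapidity q + theta A)"
  define e1 where "e1 = e0 * (1 + b) / (1 + a)"
  define z where "z = e0 * a / (1 + a)"
  have e0: "e0 > 0" "e1 > 0" using ab by (simp_all add: e0_def e1_def)
  have "e0\<^sup>2 = (eta q * u q) / (xi q * v q) * (s * m / \<omega>)\<^sup>2"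
    unfolding e0_def exp_add power_mult_distrib exp_rapidity[OF q]
    using exp_theta K by (simp add: \<omega>_def s_def)
  also have "\<dots> = (eta q * u q) / (xi q * v q) * (m / k)"
  proof -
    have "(s * m / \<omega>)\<^sup>2 = m\<^sup>2 / (k * m)" using s by (auto simp: power_divide \<omega>(2) \<kappa>_def)
    then have "(s * m / \<omega>)\<^sup>2 = m / k" using s by (auto simp: power2_eq_square)
    then show ?thesis by (simp only:)
  qed
  also have "\<dots> = b * (1 + a) / (a * (1 + b))"
    using qM s unfolding uv1 by (simp add: a_def b_def mult_ac)
  finally have e0_sq: "e0\<^sup>2 = b * (1 + a) / (a * (1 + b))" .
  have "e1\<^sup>2 = b * (1 + a) / (a * (1 + b)) * ((1 + b) / (1 + a))\<^sup>2"
    by (simp add: e1_def power_mult_distrib power_divide e0_sq)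
  also have "\<dots> = b * (1 + b) / (a * (1 + a))"
    using ab by (simp add: power2_eq_square)
  finally have e1_sq: "e1\<^sup>2 = b * (1 + b) / (a * (1 + a))" .
  have e10: "e1 * e0 = b / a"
  proof -
    have "e1 * e0 = e0\<^sup>2 * ((1 + b) / (1 + a))" by (simp add: e1_def power2_eq_square)
    then show ?thesis unfolding e0_sq using ab by simp
  qed
  have z_rad: "z = s * (\<omega> * rad q)"
  proof -
    have "(s * z)\<^sup>2 = a * b / ((1 + a) * (1 + b))"
      unfolding z_def power_divide power_mult_distrib e0_sq using ab s by (auto simp: power2_eq_square mult_ac)
    moreover have "(\<omega> * rad q)\<^sup>2 = a * b / ((1 + a) * (1 + b))"
      unfolding power_mult_distrib \<omega>(2) rad_sq_xi_eta[OF q] uv1 by (simp add: \<kappa>_def a_def b_def)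
    ultimately have "(s * z)\<^sup>2 = (\<omega> * rad q)\<^sup>2" by simp
    moreover have "s * z = e0 * (s * a) / (1 + a)" by (simp add: z_def)
    then have "s * z \<ge> 0" using ab e0 by simp
    ultimately have "s * z = \<omega> * rad q"
      by (rule power2_eq_imp_eq) (use \<omega>(1) qM(9) in simp)
    then show ?thesis using s by auto
  qed
  have z1: "\<bar>z\<bar> < 1"
    using abs_sqrt_mult_less_1[OF K rad_bound[OF q]] s unfolding z_rad by (auto simp: \<omega>_def)
  have dst: "dst q = s * ln ((1 + z) / (1 - z)) / Delta A"
  proof -
    have "artanh (\<omega> * rad q) = s * artanh z"
      using s artanh_minus_real[of "\<omega> * rad q"] z1 by (auto simp: z_rad)
    then have "dst q = s * artanh z / \<omega>" using K by (simp add: dst_def atn_def \<omega>_def)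
    then show ?thesis using K by (simp add: artanh_def Delta_eq \<omega>_def)
  qed
  show "dst q = s1 A * (ln (snd q) / Delta A)" "rapidity q = - theta A" if "w = 0"
  proof -
    have "a = b" using that w by simp
    then have "e0\<^sup>2 = 1" using e0_sq ab by simp
    then have e01: "e0 = 1" using e0 by (simp add: power2_eq_1_iff)
    then show "rapidity q = - theta A" by (simp add: e0_def)
    have "1 + z = (1 + a + b) / (1 + a)" "1 - z = 1 / (1 + a)"
      using \<open>a = b\<close> ab by (simp_all add: z_def e01 field_simps)
    then have "(1 + z) / (1 - z) = snd q" using ab y by simp
    then show "dst q = s1 A * (ln (snd q) / Delta A)" by (simp add: dst s_def)
  qed
  assume w0: "w \<noteq> 0"
  then have ba: "b \<noteq> a" using w by simp
  have s2: "s2 A w = sgn (s * (b - a))"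
  proof -
    have "lam A > 0" using lam_nu_entries(1,2) K det_pos by simp
    then have "sgn (lam A * w) = sgn (a - b)" by (simp add: sgn_mult w)
    then show ?thesis using s by (auto simp: s2_def s_def[symmetric] sgn_if)
  qed
  \<comment> \<open>\<open>E e = e\<^bsup>\<bar>\<phi>\<bar>\<^esup>\<close> for \<open>e = e\<^sup>\<phi>\<close>, because \<open>s (b - a)\<close> has the sign of \<open>\<phi>\<close>\<close>
  define E where "E e = (if s * (b - a) > 0 then e else 1 / e)" for e :: real
  have fr: "(N / D' + 1) / (N / D' - 1) = (N + D') / (N - D')" if "D' \<noteq> 0" for N D' :: real
  proof -
    have "N / D' - 1 = (N - D') / D'" "N / D' + 1 = (N + D') / D'" using that by (auto simp: field_simps)
    then show ?thesis using that by simp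
  qed
  have E_ratio: "(E e)\<^sup>2 > 1 \<and> s2 A w * ((e\<^sup>2 + 1) / (e\<^sup>2 - 1)) = ((E e)\<^sup>2 + 1) / ((E e)\<^sup>2 - 1)"
    if "e > 0" "e\<^sup>2 - 1 > 0 \<longleftrightarrow> s * (b - a) > 0" "e\<^sup>2 \<noteq> 1" for e
  proof (cases "s * (b - a) > 0")
    case True
    then show ?thesis using that by (simp add: E_def s2)
  next
    case False
    then have "s * (b - a) < 0" using s ba by auto
    then have sE: "s2 A w = - 1" "(E e)\<^sup>2 = 1 / e\<^sup>2" by (simp_all add: s2 E_def power_divide)
    have "e\<^sup>2 < 1" using that False by linarith
    then have inv1: "1 < 1 / e\<^sup>2" using that by simp
    have "(1 / e\<^sup>2 + 1) / (1 / e\<^sup>2 - 1) = - ((e\<^sup>2 + 1) / (e\<^sup>2 - 1))"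
      using fr[of "e\<^sup>2" 1] that by (subst fr) (auto simp: add.commute minus_divide_right)
    then show ?thesis unfolding sE by (simp only: mult_minus1 inv1 simp_thms)
  qed
  have gt1: "e > 1" if "e > 0" "e\<^sup>2 > 1" for e :: real
    using that by (metis less_imp_le one_power2 power2_less_imp_less)
  have Epos: "E e > 0" if "e > 0" for e using that by (simp add: E_def)
  have fr1: "N / D' - 1 = (s * (N - D')) / (s * D')" if "D' \<noteq> 0" for N D' :: real
    using that s by (auto simp: diff_divide_distrib)
  have sq0: "e0\<^sup>2 - 1 = (s * (b - a)) / (s * a * (1 + b))"
  proof -
    have n: "b * (1 + a) - a * (1 + b) = b - a" by (simp add: algebra_simps)
    show ?thesis unfolding e0_sq mult.assoc unfolding n[symmetric] by (rule fr1) (use ab in auto)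
  qed
  have sq1: "e1\<^sup>2 - 1 = (s * (b - a)) * (1 + a + b) / (s * a * (1 + a))"
  proof -
    have n: "b * (1 + b) - a * (1 + a) = (b - a) * (1 + a + b)" by (simp add: algebra_simps)
    show ?thesis unfolding e1_sq mult.assoc n[symmetric] by (rule fr1) (use ab in auto)
  qed
  have pd: "0 < N / D' \<longleftrightarrow> 0 < N" and pm: "0 < N * D' \<longleftrightarrow> 0 < N" if "D' > 0" for N D' :: real
    using that by (simp_all add: zero_less_divide_iff zero_less_mult_iff)
  have iff0: "e0\<^sup>2 - 1 > 0 \<longleftrightarrow> s * (b - a) > 0" "e0\<^sup>2 \<noteq> 1"
  proof -
    have "s * a * (1 + b) > 0" using ab by simp
    then show "e0\<^sup>2 - 1 > 0 \<longleftrightarrow> s * (b - a) > 0" unfolding sq0 by (rule pd)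
    have "e0\<^sup>2 - 1 \<noteq> 0" unfolding sq0 using ab ba s by auto
    then show "e0\<^sup>2 \<noteq> 1" by simp
  qed
  have iff1: "e1\<^sup>2 - 1 > 0 \<longleftrightarrow> s * (b - a) > 0" "e1\<^sup>2 \<noteq> 1"
  proof -
    have "s * a * (1 + a) > 0" using ab by simp
    then show "e1\<^sup>2 - 1 > 0 \<longleftrightarrow> s * (b - a) > 0" unfolding sq1 using pm[OF y0] pd by blast
    have "e1\<^sup>2 - 1 \<noteq> 0" unfolding sq1 using ab ba s y0 by auto
    then show "e1\<^sup>2 \<noteq> 1" by simp
  qed
  have E0: "E e0 > 1" "s2 A w * ((e0\<^sup>2 + 1) / (e0\<^sup>2 - 1)) = ((E e0)\<^sup>2 + 1) / ((E e0)\<^sup>2 - 1)"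
    and E1: "E e1 > 1" "s2 A w * ((e1\<^sup>2 + 1) / (e1\<^sup>2 - 1)) = ((E e1)\<^sup>2 + 1) / ((E e1)\<^sup>2 - 1)"
    using E_ratio[OF e0(1) iff0] E_ratio[OF e0(2) iff1] gt1 Epos e0 by auto
  have cancel: "- 2 * N / (- 2 * D') = N / D'" for N D' :: real
    by (simp add: minus_divide_left[symmetric])
  have c0: "(1 - (snd q)\<^sup>2 + w\<^sup>2) / (2 * w) = (e0\<^sup>2 + 1) / (e0\<^sup>2 - 1)"
  proof -
    have num: "1 - (snd q)\<^sup>2 + w\<^sup>2 = - 2 * (b * (1 + a) + a * (1 + b))"
      and den: "2 * w = - 2 * (b * (1 + a) - a * (1 + b))"
      unfolding y w by (simp_all add: power2_eq_square algebra_simps)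
    have "(1 - (snd q)\<^sup>2 + w\<^sup>2) / (2 * w) = (b * (1 + a) + a * (1 + b)) / (b * (1 + a) - a * (1 + b))"
      unfolding num den by (rule cancel)
    moreover have "(e0\<^sup>2 + 1) / (e0\<^sup>2 - 1) = (b * (1 + a) + a * (1 + b)) / (b * (1 + a) - a * (1 + b))"
      unfolding e0_sq using ab by (intro fr) auto
    ultimately show ?thesis by simp
  qed
  have c1: "(1 - (snd q)\<^sup>2 - w\<^sup>2) / (2 * snd q * w) = (e1\<^sup>2 + 1) / (e1\<^sup>2 - 1)"
  proof -
    have num: "1 - (snd q)\<^sup>2 - w\<^sup>2 = - 2 * (b * (1 + b) + a * (1 + a))"
      and den: "2 * snd q * w = - 2 * (b * (1 + b) - a * (1 + a))"
      unfolding y w by (simp_all add: power2_eq_square algebra_simps)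
    have "(1 - (snd q)\<^sup>2 - w\<^sup>2) / (2 * snd q * w) = (b * (1 + b) + a * (1 + a)) / (b * (1 + b) - a * (1 + a))"
      unfolding num den by (rule cancel)
    moreover have "(e1\<^sup>2 + 1) / (e1\<^sup>2 - 1) = (b * (1 + b) + a * (1 + a)) / (b * (1 + b) - a * (1 + a))"
      unfolding e1_sq using ab by (intro fr) auto
    ultimately show ?thesis by simp
  qed
  have \<rho>: "\<rho> = ln ((E e0 + 1) / (E e0 - 1))" unfolding \<rho>_def c0 E0(2) by (rule arcosh_ratio(1)[OF E0(1)])
  have \<tau>: "\<tau> = ln ((E e1 + 1) / (E e1 - 1))" unfolding \<tau>_def c1 E1(2) by (rule arcosh_ratio(1)[OF E1(1)])
  have "s2 A w * arcosh (coth \<rho>) = s2 A w * ln (E e0)" unfolding \<rho> arcosh_ratio(2)[OF E0(1)] by (rule refl)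
  also have "\<dots> = ln e0"
    using e0 s ba by (auto simp: s2 E_def sgn_if ln_div)
  finally show "rapidity q = s2 A w * arcosh (coth \<rho>) - theta A" by (simp add: e0_def)
  \<comment> \<open>the addition theorem for \<open>tanh (\<phi> / 2)\<close>, cleared of denominators\<close>
  have cross: "(e0 + 1) * (e1 - 1) * (1 - z) = (1 + z) * ((e0 - 1) * (e1 + 1))"
  proof -
    have "z * (e1 * e0 - 1) = e0 * (b - a) / (1 + a)"
    proof -
      have "b / a - 1 = (b - a) / a" using ab by (simp add: diff_divide_distrib)
      then show ?thesis unfolding e10 z_def using ab by simp
    qed
    also have "\<dots> = e1 - e0" using ab by (simp add: e1_def field_simps)
    finally show ?thesis by algebra
  qed
  have lnd: "ln X - ln Y = ln (X / Y)" if "X > 0" "Y > 0" for X Y :: real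
    using that by (simp add: ln_div)
  have "((E e0 + 1) / (E e0 - 1)) / ((E e1 + 1) / (E e1 - 1)) = (1 + z) / (1 - z)"
  proof -
    have ne: "e0 \<noteq> 1" "e1 \<noteq> 1" using iff0(2) iff1(2) by auto
    have "((E e0 + 1) / (E e0 - 1)) / ((E e1 + 1) / (E e1 - 1)) = (e0 + 1) * (e1 - 1) / ((e0 - 1) * (e1 + 1))"
    proof (cases "s * (b - a) > 0")
      case True
      then show ?thesis by (simp add: E_def)
    next
      case False
      have "(1 / e + 1) / (1 / e - 1) = - ((e + 1) / (e - 1))" if "e > 0" "e \<noteq> 1" for e :: real
        using that by (subst fr) (auto simp: add.commute minus_divide_right)
      then show ?thesis using False e0 ne by (simp add: E_def)
    qed
    also have "\<dots> = (1 + z) / (1 - z)"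
      using cross ne e0 z1 by (simp add: frac_eq_eq)
    finally show ?thesis .
  qed
  moreover have "\<rho> - \<tau> = ln (((E e0 + 1) / (E e0 - 1)) / ((E e1 + 1) / (E e1 - 1)))"
    unfolding \<rho> \<tau> by (rule lnd) (use E0(1) E1(1) in auto)
  ultimately show "dst q = s1 A * ((\<rho> - \<tau>) / Delta A)" by (simp add: dst s_def)
qed

text \<open>
  Here one of \<open>k\<close>, \<open>m\<close> vanishes and the other one is \<open>\<gamma>\<close>, so \<open>y\<close> depends on one null coordinate only, and
  \<open>w\<close> is \<open>- \<gamma>\<close> times the other one. The metric is flat: \<open>t\<^sub>1\<close> is \<open>sqrt (P Q)\<close> and \<open>\<rho>\<close> is
  \<open>e\<^bsup>-s1 \<psi>0\<^esup>\<close>, while \<open>\<tau> = \<rho> / y\<close>.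
\<close>

lemma inverse_zero_curvature:
  assumes K: "\<kappa> = 0" and q: "q \<in> M"
  defines "f \<equiv> - (al A - s1 A * be A) / (2 * ga A)" and "g \<equiv> - (al A + s1 A * be A) / (2 * ga A)"
  defines "w \<equiv> (fst q - g * (1 - snd q)) / f"
  defines "\<tau> \<equiv> sqrt (w / (snd q - (snd q)\<^sup>2))" and "\<rho> \<equiv> sqrt (w * snd q / (1 - snd q))"
  shows "dst q = (\<rho> - \<tau>) / ga A" "rapidity q = - s1 A * ln \<rho>"
proof -
  note qM = M_pos[OF q]
  define r where "r = 1 / det A"
  have r: "r > 0" "r * (A$1$1 * A$2$2 - A$1$2 * A$2$1) = 1" using det_pos unfolding r_def det_A by auto
  have inv: "al A = A$2$2 * r" "be A = - A$1$2 * r" "ga A = - A$2$1 * r" "de A = A$1$1 * r"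
    by (auto simp: inv_entries r_def)
  have km: "k = 0 \<and> m > 0 \<or> m = 0 \<and> k < 0"
  proof -
    have "k \<noteq> 0 \<or> m \<noteq> 0"
    proof (rule ccontr)
      assume "\<not> (k \<noteq> 0 \<or> m \<noteq> 0)"
      then have "A$1$1 = 0" "A$2$1 = 0" using de_ga_km inv r(1) by auto
      then show False using r(2) by simp
    qed
    then show ?thesis using K k_le_m by (auto simp: \<kappa>_def)
  qed
  have dst_rad: "dst q = rad q" using K by (simp add: dst_def atn_def)
  have r2: "(rad q)\<^sup>2 = xi q * eta q / snd q"
    using rad_sq_xi_eta[OF q] snd_eq_uv[of q] K by simp
  define y where "y = snd q"
  have y0: "y > 0" using qM by (simp add: y_def)
  define R where "R = exp (rapidity q)"
  have R0: "R > 0" by (simp add: R_def)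
  have "w / (y - y\<^sup>2) = w * y / (1 - y) / y\<^sup>2"
  proof -
    have "y - y\<^sup>2 = (1 - y) * y" by (simp add: power2_eq_square algebra_simps)
    then show ?thesis using y0 by (simp add: power2_eq_square)
  qed
  then have tau: "\<tau> = sqrt (w * y / (1 - y) / y\<^sup>2)" by (simp only: \<tau>_def y_def)
  have tau_rho: "\<tau> = \<rho> / y"
    unfolding tau real_sqrt_divide using y0 by (simp add: \<rho>_def y_def real_sqrt_divide)
  then have diff: "\<rho> - \<tau> = \<rho> * (y - 1) / y" using y0 by (simp add: field_simps)
  from km have "dst q = (\<rho> - \<tau>) / ga A \<and> rapidity q = - s1 A * ln \<rho>"
  proof
    assume c: "k = 0 \<and> m > 0"
    then have s1: "s1 A = 1" and g: "ga A = m" by (auto simp: s1_def de_ga_km)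
    have yc: "y = 1 + m * eta q" using c snd_eq[of q] by (simp add: y_def)
    have "A$2$1 * r = (- A$1$1) * r" using c de_ga_km inv by simp
    then have "A$2$1 = - A$1$1" using r(1) by (metis less_irrefl mult_right_cancel)
    have fw: "w = - m * xi q"
    proof -
      have a0: "A$1$1 \<noteq> 0" using r(2) \<open>A$2$1 = _\<close> by auto
      have "r * A$1$1 * (A$2$2 + A$1$2) = 1" using r(2) \<open>A$2$1 = _\<close> by (simp add: algebra_simps)
      then have bd: "A$2$2 + A$1$2 = 1 / (r * A$1$1)" "A$2$2 + A$1$2 \<noteq> 0"
        using a0 r(1) by (metis nonzero_mult_div_cancel_left mult_eq_0_iff less_irrefl, metis mult_zero_right zero_neq_one)
      have f: "f = - (A$2$2 + A$1$2) / (2 * A$1$1)" "g = - (A$2$2 - A$1$2) / (2 * A$1$1)"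
        using r(1) a0 by (simp_all add: f_def g_def s1 inv \<open>A$2$1 = _\<close> field_simps)
      have "w = (- 2 * A$1$1 * fst q - (A$2$2 - A$1$2) * (1 - snd q)) / (A$2$2 + A$1$2)"
      proof -
        have "(X - (- n / (2 * h)) * Y) / (- p / (2 * h)) = (- 2 * h * X - n * Y) / p"
          if "h \<noteq> 0" "p \<noteq> 0" for X Y n h p :: real
          using that by (simp add: field_simps)
        from this[OF a0 bd(2)] show ?thesis unfolding w_def f .
      qed
      also have "\<dots> = - (r * A$1$1) * (2 * A$1$1 * fst q + (A$2$2 - A$1$2) * (1 - snd q))"
        unfolding bd(1) using a0 r(1) by (simp add: field_simps)
      also have "\<dots> = - m * xi q"
        using c de_ga_km inv \<open>A$2$1 = _\<close> by (simp add: xi_def lambda1_def algebra_simps)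
      finally show ?thesis .
    qed
    have R2: "R\<^sup>2 = eta q / (xi q * y)"
      using exp_rapidity[OF q] c yc by (simp add: R_def u_def v_def)
    have "w * y / (1 - y) = 1 / R\<^sup>2"
      using c qM unfolding fw R2 by (simp add: yc)
    then have rho: "\<rho> = 1 / R" using R0 by (simp add: \<rho>_def y_def[symmetric] real_sqrt_divide)
    have "(eta q / (R * y))\<^sup>2 = (rad q)\<^sup>2"
      unfolding r2 power_divide power_mult_distrib R2 using qM y0 by (simp add: power2_eq_square y_def)
    then have "rad q = eta q / (R * y)" using qM R0 y0 by (simp add: power2_eq_iff_nonneg)
    moreover have "(\<rho> - \<tau>) / ga A = eta q / (R * y)"
    proof -
      have "y - 1 = m * eta q" using yc by simp
      then have "(\<rho> - \<tau>) / ga A = 1 / R * (m * eta q) / y / m" unfolding diff g by (simp only: rho)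
      then show ?thesis using c by simp
    qed
    moreover have "rapidity q = - s1 A * ln \<rho>" unfolding rho s1 using R0 by (simp add: ln_div R_def)
    ultimately show ?thesis unfolding dst_rad by simp
  next
    assume c: "m = 0 \<and> k < 0"
    then have s1: "s1 A = - 1" and g: "ga A = k" by (auto simp: s1_def de_ga_km)
    have yc: "y = 1 + k * xi q" using c snd_eq[of q] by (simp add: y_def)
    have "A$2$1 * r = A$1$1 * r" using c de_ga_km inv by simp
    then have A21: "A$2$1 = A$1$1" using r(1) by (metis less_irrefl mult_right_cancel)
    have fw: "w = - k * eta q"
    proof -
      have a0: "A$1$1 \<noteq> 0" using r(2) A21 by auto
      have "r * A$1$1 * (A$2$2 - A$1$2) = 1" using r(2) A21 by (simp add: algebra_simps)
      then have bd: "A$2$2 - A$1$2 = 1 / (r * A$1$1)" "A$2$2 - A$1$2 \<noteq> 0"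
        using a0 r(1) by (metis nonzero_mult_div_cancel_left mult_eq_0_iff less_irrefl, metis mult_zero_right zero_neq_one)
      have f: "f = (A$2$2 - A$1$2) / (2 * A$1$1)" "g = (A$2$2 + A$1$2) / (2 * A$1$1)"
        using r(1) a0 by (simp_all add: f_def g_def s1 inv A21 field_simps)
      have "w = (2 * A$1$1 * fst q - (A$2$2 + A$1$2) * (1 - snd q)) / (A$2$2 - A$1$2)"
      proof -
        have "(X - n / (2 * h) * Y) / (p / (2 * h)) = (2 * h * X - n * Y) / p"
          if "h \<noteq> 0" "p \<noteq> 0" for X Y n h p :: real
          using that by (simp add: field_simps)
        from this[OF a0 bd(2)] show ?thesis unfolding w_def f .
      qed
      also have "\<dots> = (r * A$1$1) * (2 * A$1$1 * fst q - (A$2$2 + A$1$2) * (1 - snd q))"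
        unfolding bd(1) using a0 r(1) by (simp add: field_simps)
      also have "\<dots> = - k * eta q"
        using c de_ga_km inv A21 by (simp add: eta_def lambda2_def algebra_simps)
      finally show ?thesis .
    qed
    have R2: "R\<^sup>2 = eta q * y / xi q"
      using exp_rapidity[OF q] c yc by (simp add: R_def u_def v_def)
    have "w * y / (1 - y) = R\<^sup>2"
      using c qM unfolding fw R2 by (simp add: yc)
    then have rho: "\<rho> = R" using R0 by (simp add: \<rho>_def y_def[symmetric])
    have "(xi q * R / y)\<^sup>2 = (rad q)\<^sup>2"
      unfolding r2 power_divide power_mult_distrib R2 using qM y0 by (simp add: power2_eq_square y_def)
    then have "rad q = xi q * R / y" using qM R0 y0 by (simp add: power2_eq_iff_nonneg)
    moreover have "(\<rho> - \<tau>) / ga A = xi q * R / y"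
    proof -
      have "y - 1 = k * xi q" using yc by simp
      then have "(\<rho> - \<tau>) / ga A = R * (k * xi q) / y / k" unfolding diff g by (simp only: rho)
      then show ?thesis using c by simp
    qed
    moreover have "rapidity q = - s1 A * ln \<rho>" unfolding rho s1 by (simp add: R_def)
    ultimately show ?thesis unfolding dst_rad by simp
  qed
  then show "dst q = (\<rho> - \<tau>) / ga A" "rapidity q = - s1 A * ln \<rho>" by auto
qed

end

section \<open>Inverse exponential mapping and optimal trajectories\<close>

theorem theorem12:
  fixes A :: "real^2^2"
  assumes "det A > 0" and "A$1$1 \<ge> 0"
  shows "bij_betw (Exp A) (N_dom A) (M_im A) \<and>
    (\<forall>x\<^sub>1 y\<^sub>1 \<psi>\<^sub>0 t\<^sub>1.
      (x\<^sub>1, y\<^sub>1) \<in> M_im A \<and> (\<psi>\<^sub>0, t\<^sub>1) = the_inv_into (N_dom A) (Exp A) (x\<^sub>1, y\<^sub>1) \<longrightarrow>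
      (sec_curv A < 0 \<longrightarrow>
        (let w = (x\<^sub>1 - nu A * (y\<^sub>1 - 1)) / lam A;
             \<tau> = arcsin ((y\<^sub>1\<^sup>2 + w\<^sup>2 - 1) / (2 * y\<^sub>1 * w));
             \<rho> = arcsin ((y\<^sub>1\<^sup>2 - w\<^sup>2 - 1) / (2 * w))
         in t\<^sub>1 = (\<tau> - \<rho>) / Delta A \<and> \<psi>\<^sub>0 = arsinh (tan \<rho>) - theta A)) \<and>
      (sec_curv A > 0 \<longrightarrow>
        (let w = (x\<^sub>1 + nu A * (y\<^sub>1 - 1)) / lam A
         in (w = 0 \<longrightarrow> t\<^sub>1 = s1 A * (ln y\<^sub>1 / Delta A) \<and> \<psi>\<^sub>0 = - theta A) \<and>
            (w \<noteq> 0 \<longrightarrow>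
              (let \<tau> = arcosh (s2 A w * ((1 - y\<^sub>1\<^sup>2 - w\<^sup>2) / (2 * y\<^sub>1 * w)));
                   \<rho> = arcosh (s2 A w * ((1 - y\<^sub>1\<^sup>2 + w\<^sup>2) / (2 * w)))
               in t\<^sub>1 = s1 A * ((\<rho> - \<tau>) / Delta A) \<and>
                  \<psi>\<^sub>0 = s2 A w * arcosh (coth \<rho>) - theta A)))) \<and>
      (sec_curv A = 0 \<longrightarrow>
        (let f = - (al A - s1 A * be A) / (2 * ga A);
             g = - (al A + s1 A * be A) / (2 * ga A);
             w = (x\<^sub>1 - g * (1 - y\<^sub>1)) / f;
             \<tau> = sqrt (w / (y\<^sub>1 - y\<^sub>1\<^sup>2));
             \<rho> = sqrt (w * y\<^sub>1 / (1 - y\<^sub>1))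
         in t\<^sub>1 = (\<rho> - \<tau>) / ga A \<and> \<psi>\<^sub>0 = - s1 A * ln \<rho>)) \<and>
      optimal_arclength_from_id_to A (x\<^sub>1, y\<^sub>1) (\<lambda>t. Exp A (\<psi>\<^sub>0, t)) t\<^sub>1 \<and>
      (\<forall>q T. optimal_arclength_from_id_to A (x\<^sub>1, y\<^sub>1) q T \<longrightarrow>
        T = t\<^sub>1 \<and> (\<forall>t\<in>{0..t\<^sub>1}. q t = Exp A (\<psi>\<^sub>0, t))))"
proof -
  interpret aff_lorentz A by unfold_locales (use assms in auto)
  have "bij_betw (Exp A) (N_dom A) (M_im A)" using bij_Exp by (simp add: M_im_eq)
  moreover have
    "(sec_curv A < 0 \<longrightarrow>
        (let w = (x\<^sub>1 - nu A * (y\<^sub>1 - 1)) / lam A;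
             \<tau> = arcsin ((y\<^sub>1\<^sup>2 + w\<^sup>2 - 1) / (2 * y\<^sub>1 * w));
             \<rho> = arcsin ((y\<^sub>1\<^sup>2 - w\<^sup>2 - 1) / (2 * w))
         in t\<^sub>1 = (\<tau> - \<rho>) / Delta A \<and> \<psi>\<^sub>0 = arsinh (tan \<rho>) - theta A)) \<and>
      (sec_curv A > 0 \<longrightarrow>
        (let w = (x\<^sub>1 + nu A * (y\<^sub>1 - 1)) / lam A
         in (w = 0 \<longrightarrow> t\<^sub>1 = s1 A * (ln y\<^sub>1 / Delta A) \<and> \<psi>\<^sub>0 = - theta A) \<and>
            (w \<noteq> 0 \<longrightarrow>
              (let \<tau> = arcosh (s2 A w * ((1 - y\<^sub>1\<^sup>2 - w\<^sup>2) / (2 * y\<^sub>1 * w)));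
                   \<rho> = arcosh (s2 A w * ((1 - y\<^sub>1\<^sup>2 + w\<^sup>2) / (2 * w)))
               in t\<^sub>1 = s1 A * ((\<rho> - \<tau>) / Delta A) \<and>
                  \<psi>\<^sub>0 = s2 A w * arcosh (coth \<rho>) - theta A)))) \<and>
      (sec_curv A = 0 \<longrightarrow>
        (let f = - (al A - s1 A * be A) / (2 * ga A);
             g = - (al A + s1 A * be A) / (2 * ga A);
             w = (x\<^sub>1 - g * (1 - y\<^sub>1)) / f;
             \<tau> = sqrt (w / (y\<^sub>1 - y\<^sub>1\<^sup>2));
             \<rho> = sqrt (w * y\<^sub>1 / (1 - y\<^sub>1))
         in t\<^sub>1 = (\<rho> - \<tau>) / ga A \<and> \<psi>\<^sub>0 = - s1 A * ln \<rho>)) \<and>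
      optimal_arclength_from_id_to A (x\<^sub>1, y\<^sub>1) (\<lambda>t. Exp A (\<psi>\<^sub>0, t)) t\<^sub>1 \<and>
      (\<forall>q T. optimal_arclength_from_id_to A (x\<^sub>1, y\<^sub>1) q T \<longrightarrow>
        T = t\<^sub>1 \<and> (\<forall>t\<in>{0..t\<^sub>1}. q t = Exp A (\<psi>\<^sub>0, t)))"
    if "(x\<^sub>1, y\<^sub>1) \<in> M_im A \<and> (\<psi>\<^sub>0, t\<^sub>1) = the_inv_into (N_dom A) (Exp A) (x\<^sub>1, y\<^sub>1)" for x\<^sub>1 y\<^sub>1 \<psi>\<^sub>0 t\<^sub>1
  proof -
    define p where "p = (x\<^sub>1, y\<^sub>1)"
    have p: "p \<in> M" and xy: "x\<^sub>1 = fst p" "y\<^sub>1 = snd p" using that by (simp_all add: M_im_eq p_def)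
    have t: "\<psi>\<^sub>0 = rapidity p" "t\<^sub>1 = dst p" using that the_inv_Exp[OF p] by (simp_all add: p_def)
    show ?thesis
      unfolding t p_def[symmetric] unfolding xy Let_def sec_curv_eq
    proof (intro conjI impI allI)
      assume "4 * \<kappa> < 0"
      then have K: "\<kappa> < 0" by simp
      show "dst p = (arcsin (((snd p)\<^sup>2 + ((fst p - nu A * (snd p - 1)) / lam A)\<^sup>2 - 1) /
              (2 * snd p * ((fst p - nu A * (snd p - 1)) / lam A))) -
            arcsin (((snd p)\<^sup>2 - ((fst p - nu A * (snd p - 1)) / lam A)\<^sup>2 - 1) /
              (2 * ((fst p - nu A * (snd p - 1)) / lam A)))) / Delta A"
        unfolding w_negative_curvature[OF K] by (rule inverse_negative_curvature(1)[OF K p])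
      show "rapidity p = arsinh (tan (arcsin (((snd p)\<^sup>2 - ((fst p - nu A * (snd p - 1)) / lam A)\<^sup>2 - 1) /
              (2 * ((fst p - nu A * (snd p - 1)) / lam A))))) - theta A"
        unfolding w_negative_curvature[OF K] by (rule inverse_negative_curvature(2)[OF K p])
    next
      let ?w = "(fst p + nu A * (snd p - 1)) / lam A"
      assume "0 < 4 * \<kappa>"
      then have K: "\<kappa> > 0" by simp
      note pos = inverse_positive_curvature[OF K p, folded w_positive_curvature[OF K]]
      show "?w = 0 \<Longrightarrow> dst p = s1 A * (ln (snd p) / Delta A)" by (rule pos(1))
      show "?w = 0 \<Longrightarrow> rapidity p = - theta A" by (rule pos(2))
      show "?w \<noteq> 0 \<Longrightarrow> dst p = s1 A * ((arcosh (s2 A ?w * ((1 - (snd p)\<^sup>2 + ?w\<^sup>2) / (2 * ?w))) -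
          arcosh (s2 A ?w * ((1 - (snd p)\<^sup>2 - ?w\<^sup>2) / (2 * snd p * ?w)))) / Delta A)" by (rule pos(3))
      show "?w \<noteq> 0 \<Longrightarrow> rapidity p = s2 A ?w *
          arcosh (coth (arcosh (s2 A ?w * ((1 - (snd p)\<^sup>2 + ?w\<^sup>2) / (2 * ?w))))) - theta A" by (rule pos(4))
    next
      assume "4 * \<kappa> = 0"
      then have K: "\<kappa> = 0" by simp
      note zero = inverse_zero_curvature[OF K p]
      let ?w = "(fst p - - (al A + s1 A * be A) / (2 * ga A) * (1 - snd p)) / (- (al A - s1 A * be A) / (2 * ga A))"
      show "dst p = (sqrt (?w * snd p / (1 - snd p)) - sqrt (?w / (snd p - (snd p)\<^sup>2))) / ga A" by (rule zero(1))
      show "rapidity p = - s1 A * ln (sqrt (?w * snd p / (1 - snd p)))" by (rule zero(2))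
    next
      show "optimal_arclength_from_id_to A p (\<lambda>t. Exp A (rapidity p, t)) (dst p)" by (rule Exp_optimal[OF p])
    next
      fix q T assume "optimal_arclength_from_id_to A p q T"
      then show "T = dst p" "\<forall>t\<in>{0..dst p}. q t = Exp A (rapidity p, t)" using optimal_unique[OF p] by blast+
    qed
  qed
  ultimately show ?thesis by blast
qed

end
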